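(* Let $\lambda$ be a positive real number, and let $\phi_n$ be any test such that, for every $\mathcal B\in\mathcal S$, $$\beta_{\mathcal B}(\phi_n|\tilde P_{\mathrm N},\tilde{\mathbf P}_T)\le\exp(-n\lambda)\qquad\text{for all tuples of nominal and anomalous distributions }(\tilde P_{\mathrm N},\tilde{\mathbf P}_T).$$ Then for any tuple of nominal and anomalous distributions $(P_{\mathrm N},\mathbf P_T)$ and each $\mathcal B\in\mathcal S$, $$\zeta_{\mathcal B}(\phi_n|P_{\mathrm N},\mathbf P_T)\ge 1+O\Big(\frac1{\sqrt n}\Big)-\mathrm Q_{|\mathcal S|-1}\Big(\sqrt n\,\bar\mu(\lambda,P_{\mathrm N},\mathbf P_{\mathcal B});\,\mathbf 0_{|\mathcal S|-1};\,\mathbf V(\mathcal B,P_{\mathrm N},\mathbf P_{\mathcal B})\Big),$$ where $\bar\mu(\lambda,P_{\mathrm N},\mathbf P_{\mathcal B})$ is the vector of length $|\mathcal S|-1$ given by $$\big(\lambda-\mathrm{GD}(\mathcal B,\mathcal C_1,P_{\mathrm N},\mathbf P_{\mathcal B}),\ldots,\lambda-\mathrm{GD}(\mathcal B,\mathcal C_{|\mathcal S|-1},P_{\mathrm N},\mathbf P_{\mathcal B})\big)+\mathbf 1_{|\mathcal S|-1}\times O\Big(\frac{\log n}{n}\Big).$$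
   Context: Setup. $\mathcal X$ is a finite alphabet, $D(\cdot\|\cdot)$ the Kullback--Leibler divergence, $\log$ the natural logarithm, $[k]=\{1,\ldots,k\}$. $M\in\mathbb N$ is the number of observed sequences, $T:=\lceil \frac M2-1\rceil$, and $\mathcal S:=\bigcup_{t\in[T]}\{\mathcal B\subseteq[M]:|\mathcal B|=t\}$. For $\mathcal B\in\mathcal S$ let $\mathcal M_{\mathcal B}:=[M]\setminus\mathcal B$ and $\mathcal S_{\mathcal B}:=\mathcal S\setminus\{\mathcal B\}$. A tuple of nominal and anomalous distributions $(P_{\mathrm N},\mathbf P_T)$, $\mathbf P_T=(P_{\mathrm A,1},\ldots,P_{\mathrm A,T})$, consists of distributions on $\mathcal X$ with the same support, with $P_{\mathrm A,j}\ne P_{\mathrm N}$ for every $j$; $\mathbf P_{\mathcal B}:=(P_{\mathrm A,1},\ldots,P_{\mathrm A,|\mathcal B|})$. For $i\in\mathcal B$, $\jmath_{\mathcal B}(i):=j$ if $i$ is the $j$-th smallest element of $\mathcal B$. The observation is $\mathbf X^n=(X_1^n,\ldots,X_M^n)$, $M$ independent sequences of length $n$ over $\mathcal X$. Under hypothesis $\mathrm H_{\mathcal B}$ ($\mathcal B\in\mathcal S$), with probability law $\mathbb P_{\mathcal B}$, $X_i^n$ is i.i.d. from $P_{\mathrm A,\jmath_{\mathcal B}(i)}$ for $i\in\mathcal B$ and i.i.d. from $P_{\mathrm N}$ for $i\in\mathcal M_{\mathcal B}$. $\mathrm H_{\mathrm r}$ denotes the hypothesis that there is no outlier. A test is a map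 $\phi_n:\mathcal X^{Mn}\to\{\{\mathrm H_{\mathcal B}\}_{\mathcal B\in\mathcal S},\mathrm H_{\mathrm r}\}$ (not depending on the distributions). Its misclassification and false reject probabilities are $\beta_{\mathcal B}(\phi_n|P_{\mathrm N},\mathbf P_T):=\mathbb P_{\mathcal B}\{\phi_n(\mathbf X^n)\notin\{\mathrm H_{\mathcal B},\mathrm H_{\mathrm r}\}\}$ and $\zeta_{\mathcal B}(\phi_n|P_{\mathrm N},\mathbf P_T):=\mathbb P_{\mathcal B}\{\phi_n(\mathbf X^n)=\mathrm H_{\mathrm r}\}$. Second-order quantities. For $(\mathcal B,\mathcal C)\in\mathcal S^2$ define $P_{\rm Mix}^{(\mathcal B,\mathcal C,P_{\mathrm N},\mathbf P_{\mathcal B})}(x):=\frac1{M-|\mathcal C|}\Big(\sum_{i\in\mathcal B\cap\mathcal M_{\mathcal C}}P_{\mathrm A,\jmath_{\mathcal B}(i)}(x)+\sum_{i\in\mathcal M_{\mathcal B}\cap\mathcal M_{\mathcal C}}P_{\mathrm N}(x)\Big)$ (written $P_{\rm Mix}$ below), $\mathrm{GD}(\mathcal B,\mathcal C,P_{\mathrm N},\mathbf P_{\mathcal B}):=\sum_{i\in\mathcal B\cap\mathcal M_{\mathcal C}}D(P_{\mathrm A,\jmath_{\mathcal B}(i)}\|P_{\rm Mix})+\sum_{i\in\mathcal M_{\mathcal B}\cap\mathcal M_{\mathcal C}}D(P_{\mathrm N}\|P_{\rm Mix})$, $\imath_{1,l}(x|\mathcal B,\mathcal C,P_{\mathrm N},\mathbf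 P_{\mathcal B}):=\log\frac{P_{\mathrm A,l}(x)}{P_{\rm Mix}(x)}$ for $l\in[|\mathcal B|]$, $\imath_2(x|\mathcal B,\mathcal C,P_{\mathrm N},\mathbf P_{\mathcal B}):=\log\frac{P_{\mathrm N}(x)}{P_{\rm Mix}(x)}$, $\mathrm V(\mathcal B,\mathcal C,P_{\mathrm N},\mathbf P_{\mathcal B}):=\sum_{i\in\mathcal B\cap\mathcal M_{\mathcal C}}\mathrm{Var}_{P_{\mathrm A,\jmath_{\mathcal B}(i)}}[\imath_{1,\jmath_{\mathcal B}(i)}(X|\mathcal B,\mathcal C,P_{\mathrm N},\mathbf P_{\mathcal B})]+\sum_{i\in\mathcal M_{\mathcal B}\cap\mathcal M_{\mathcal C}}\mathrm{Var}_{P_{\mathrm N}}[\imath_2(X|\mathcal B,\mathcal C,P_{\mathrm N},\mathbf P_{\mathcal B})]$, $\imath_{\mathcal B,\mathcal C}(x_1,\ldots,x_M|P_{\mathrm N},\mathbf P_{\mathcal B}):=\sum_{j\in\mathcal B\cap\mathcal M_{\mathcal C}}\imath_{1,\jmath_{\mathcal B}(j)}(x_j|\mathcal B,\mathcal C,P_{\mathrm N},\mathbf P_{\mathcal B})+\sum_{j\in\mathcal M_{\mathcal B}\cap\mathcal M_{\mathcal C}}\imath_2(x_j|\mathcal B,\mathcal C,P_{\mathrm N},\mathbf P_{\mathcal B})$. Order the elements of $\mathcal S_{\mathcal B}$ as $\mathcal C_1,\ldots,\mathcal C_{|\mathcal S|-1}$. The matrix $\mathbf V(\mathcal B,P_{\mathrm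 N},\mathbf P_{\mathcal B})$ of size $(|\mathcal S|-1)\times(|\mathcal S|-1)$ has diagonal entries $\mathrm V(\mathcal B,\mathcal C_i,P_{\mathrm N},\mathbf P_{\mathcal B})$ and off-diagonal $(i,k)$ entries equal to the covariance of $\imath_{\mathcal B,\mathcal C_i}(X_1,\ldots,X_M|P_{\mathrm N},\mathbf P_{\mathcal B})$ and $\imath_{\mathcal B,\mathcal C_k}(X_1,\ldots,X_M|P_{\mathrm N},\mathbf P_{\mathcal B})$, where $X_1,\ldots,X_M$ are independent with $X_i\sim P_{\mathrm A,\jmath_{\mathcal B}(i)}$ for $i\in\mathcal B$ and $X_i\sim P_{\mathrm N}$ for $i\in\mathcal M_{\mathcal B}$. For $k\in\mathbb N$, $\mathrm Q_k(x_1,\ldots,x_k;\boldsymbol\mu;\boldsymbol\Sigma):=\int_{x_1}^\infty\cdots\int_{x_k}^\infty\mathcal N(\mathbf x;\boldsymbol\mu;\boldsymbol\Sigma)\,d\mathbf x$ is the $k$-variate Gaussian complementary cdf with mean $\boldsymbol\mu$ and covariance $\boldsymbol\Sigma$, i.e. the probability that a Gaussian vector $Z\sim\mathcal N(\boldsymbol\mu,\boldsymbol\Sigma)$ satisfies $Z_i\ge x_i$ for all $i$ (this also defines it for singular $\boldsymbol\Sigma$). $\mathbf 1_k$ and $\mathbf 0_k$ are the all-one and all-zero vectors of length $k$. The $O(\cdot)$ terms are as $n\to\infty$, with constants not depending on $n$ (they may depend on $\lambda$, $M$, $\mathcal X$ and the distributions). *)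

theory Defs
  imports "HOL-Probability.Probability" "HOL-Library.Landau_Symbols"
begin

section \<open>Hypotheses and distributions\<close>

definition max_outliers :: "nat \<Rightarrow> nat" where
  "max_outliers M = nat \<lceil>real M / 2 - 1\<rceil>"

definition outlier_sets :: "nat \<Rightarrow> nat set set" where
  "outlier_sets M = (\<Union>t\<in>{1..max_outliers M}. {B. B \<subseteq> {1..M} \<and> card B = t})"

text \<open>Only the values of \<open>PA\<close> on \<open>{1..max_outliers M}\<close> are relevant.\<close>

definition distribution_tuple :: "nat \<Rightarrow> 'x pmf \<Rightarrow> (nat \<Rightarrow> 'x pmf) \<Rightarrow> bool" where
  "distribution_tuple M PN PA \<longleftrightarrow>
     (\<forall>j\<in>{1..max_outliers M}. set_pmf (PA j) = set_pmf PN \<and> PA j \<noteq> PN)"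

text \<open>\<open>outlier_pos B i = j\<close> iff \<open>i\<close> is the \<open>j\<close>-th smallest element of \<open>B\<close> (for \<open>i \<in> B\<close>, counted from 1).\<close>

definition outlier_pos :: "nat set \<Rightarrow> nat \<Rightarrow> nat" where
  "outlier_pos B i = card {k \<in> B. k \<le> i}"

definition source :: "nat set \<Rightarrow> 'x pmf \<Rightarrow> (nat \<Rightarrow> 'x pmf) \<Rightarrow> nat \<Rightarrow> 'x pmf" where
  "source B PN PA i = (if i \<in> B then PA (outlier_pos B i) else PN)"


section \<open>Tests and error probabilities\<close>

text \<open>An observation maps \<open>i \<in> {1..M}\<close> and \<open>t \<in> {1..n}\<close> to the \<open>t\<close>-th symbol of the \<open>i\<close>-th sequence.
  Taking \<open>undefined\<close> as default value of \<open>Pi_pmf\<close> makes the product law live on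
  the extensional functions \<open>observations M n\<close>.\<close>

definition observations :: "nat \<Rightarrow> nat \<Rightarrow> (nat \<Rightarrow> nat \<Rightarrow> 'x) set" where
  "observations M n = ({1..M} \<rightarrow>\<^sub>E ({1..n} \<rightarrow>\<^sub>E UNIV))"

definition observation_law ::
  "nat \<Rightarrow> nat \<Rightarrow> nat set \<Rightarrow> 'x pmf \<Rightarrow> (nat \<Rightarrow> 'x pmf) \<Rightarrow> (nat \<Rightarrow> nat \<Rightarrow> 'x) pmf" where
  "observation_law M n B PN PA =
     Pi_pmf {1..M} undefined (\<lambda>i. Pi_pmf {1..n} undefined (\<lambda>_. source B PN PA i))"

lemma set_observation_law: "set_pmf (observation_law M n B PN PA) \<subseteq> observations M n"
  unfolding observation_law_def observations_def
  by (auto simp: set_Pi_pmf PiE_dflt_def PiE_def extensional_def)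

datatype decision = Hyp "nat set" | Reject

definition is_test :: "nat \<Rightarrow> nat \<Rightarrow> ((nat \<Rightarrow> nat \<Rightarrow> 'x) \<Rightarrow> decision) \<Rightarrow> bool" where
  "is_test M n \<phi> \<longleftrightarrow> \<phi> \<in> observations M n \<rightarrow> insert Reject (Hyp ` outlier_sets M)"

definition misclassification_prob ::
  "nat \<Rightarrow> nat \<Rightarrow> ((nat \<Rightarrow> nat \<Rightarrow> 'x) \<Rightarrow> decision) \<Rightarrow> nat set \<Rightarrow> 'x pmf \<Rightarrow> (nat \<Rightarrow> 'x pmf) \<Rightarrow> real" where
  "misclassification_prob M n \<phi> B PN PA =
     measure_pmf.prob (observation_law M n B PN PA) {x. \<phi> x \<notin> {Hyp B, Reject}}"

definition false_reject_prob ::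
  "nat \<Rightarrow> nat \<Rightarrow> ((nat \<Rightarrow> nat \<Rightarrow> 'x) \<Rightarrow> decision) \<Rightarrow> nat set \<Rightarrow> 'x pmf \<Rightarrow> (nat \<Rightarrow> 'x pmf) \<Rightarrow> real" where
  "false_reject_prob M n \<phi> B PN PA =
     measure_pmf.prob (observation_law M n B PN PA) {x. \<phi> x = Reject}"


section \<open>Information quantities\<close>

text \<open>In the definitions below the set \<open>\<M>\<^sub>C\<close> is written \<open>{1..M} - C\<close>.\<close>

definition mix :: "nat \<Rightarrow> nat set \<Rightarrow> nat set \<Rightarrow> 'x pmf \<Rightarrow> (nat \<Rightarrow> 'x pmf) \<Rightarrow> 'x pmf" where
  "mix M B C PN PA = embed_pmf (\<lambda>x. 1 / (real M - real (card C)) *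
     ((\<Sum>i\<in>B \<inter> ({1..M} - C). pmf (PA (outlier_pos B i)) x)
      + (\<Sum>i\<in>({1..M} - B) \<inter> ({1..M} - C). pmf PN x)))"

lemma card_outlier_set_less:
  assumes "C \<in> outlier_sets M"
  shows "card C < M"
proof -
  obtain t where t: "1 \<le> t" "t \<le> max_outliers M" "card C = t"
    using assms unfolding outlier_sets_def by auto
  have "real (max_outliers M) < M"
    using t unfolding max_outliers_def by linarith
  then show ?thesis
    using t by linarith
qed

lemma pmf_mix:
  fixes PN :: "'x::finite pmf"
  assumes "B \<subseteq> {1..M}" "C \<in> outlier_sets M"
  shows "pmf (mix M B C PN PA) x = 1 / (real M - real (card C)) *
     ((\<Sum>i\<in>B \<inter> ({1..M} - C). pmf (PA (outlier_pos B i)) x)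
      + (\<Sum>i\<in>({1..M} - B) \<inter> ({1..M} - C). pmf PN x))"
proof -
  define I J where "I = B \<inter> ({1..M} - C)" and "J = ({1..M} - B) \<inter> ({1..M} - C)"
  define f where "f x = 1 / (real M - real (card C)) *
     ((\<Sum>i\<in>I. pmf (PA (outlier_pos B i)) x) + (\<Sum>i\<in>J. pmf PN x))" for x
  have lt: "card C < M"
    by (rule card_outlier_set_less[OF assms(2)])
  have sub: "C \<subseteq> {1..M}"
    using assms(2) by (auto simp: outlier_sets_def)
  have IJ: "I \<union> J = {1..M} - C" "I \<inter> J = {}" "finite I" "finite J"
    using assms(1) by (auto simp: I_def J_def)
  have "card I + card J = M - card C"
    using card_Un_disjoint[OF IJ(3,4,2)] card_Diff_subset[OF finite_subset[OF sub] sub] IJ(1)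
    by simp
  then have card: "real (card I) + real (card J) = real M - real (card C)"
    using lt by linarith
  have nonneg: "f x \<ge> 0" for x
    unfolding f_def using lt by (intro mult_nonneg_nonneg add_nonneg_nonneg sum_nonneg) auto
  have one: "(\<Sum>x\<in>UNIV. pmf p x) = 1" for p :: "'x pmf"
    by (rule sum_pmf_eq_1) auto
  have "(\<Sum>x\<in>UNIV. f x) = 1 / (real M - real (card C)) *
      ((\<Sum>i\<in>I. \<Sum>x\<in>UNIV. pmf (PA (outlier_pos B i)) x) + (\<Sum>i\<in>J. \<Sum>x\<in>UNIV. pmf PN x))"
    unfolding f_def sum_distrib_left[symmetric] sum.distrib
    by (subst (1 2) sum.swap) (rule refl)
  also have "\<dots> = 1"
    using lt by (simp only: one) (simp add: card)
  finally have "(\<integral>\<^sup>+x. ennreal (f x) \<partial>count_space UNIV) = 1"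
    using nonneg by (simp add: nn_integral_count_space_finite sum_ennreal)
  then have "pmf (embed_pmf f) x = f x"
    by (intro pmf_embed_pmf nonneg)
  then show ?thesis
    by (simp add: mix_def f_def[abs_def] I_def J_def)
qed

text \<open>\<open>KL_divergence b M N\<close> of the library is the divergence of \<open>N\<close> from \<open>M\<close>, that is
  \<open>D(N \<parallel> M)\<close> in the usual notation.\<close>

definition KL :: "'x pmf \<Rightarrow> 'x pmf \<Rightarrow> real" where
  "KL P Q = KL_divergence (exp 1) (measure_pmf Q) (measure_pmf P)"

lemma KL_eq_sum:
  fixes P Q :: "'x::finite pmf"
  assumes "set_pmf P \<subseteq> set_pmf Q"
  shows "KL P Q = (\<Sum>x\<in>UNIV. pmf P x * ln (pmf P x / pmf Q x))"
proof -
  have ac: "x \<in> set_pmf P \<Longrightarrow> pmf Q x \<noteq> 0" for x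
    using assms by (auto simp: set_pmf_eq)
  have "KL P Q = KL_divergence (exp 1) (density (count_space UNIV) (\<lambda>x. ennreal (pmf Q x)))
      (density (count_space UNIV) (\<lambda>x. ennreal (pmf P x)))"
    by (simp add: KL_def measure_pmf_eq_density[symmetric])
  also have "\<dots> = (\<integral>x. pmf P x * log (exp 1) (pmf P x / pmf Q x) \<partial>count_space UNIV)"
    using ac by (intro sigma_finite_measure.KL_density_density
        sigma_finite_measure_count_space_finite)
      (auto simp: AE_count_space set_pmf_eq)
  also have "\<dots> = (\<Sum>x\<in>UNIV. pmf P x * ln (pmf P x / pmf Q x))"
    by (simp add: lebesgue_integral_count_space_finite log_def)
  finally show ?thesis .
qed

definition GD :: "nat \<Rightarrow> nat set \<Rightarrow> nat set \<Rightarrow> 'x pmf \<Rightarrow> (nat \<Rightarrow> 'x pmf) \<Rightarrow> real" where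
  "GD M B C PN PA =
     (\<Sum>i\<in>B \<inter> ({1..M} - C). KL (PA (outlier_pos B i)) (mix M B C PN PA))
     + (\<Sum>i\<in>({1..M} - B) \<inter> ({1..M} - C). KL PN (mix M B C PN PA))"

definition info1 ::
  "nat \<Rightarrow> nat \<Rightarrow> nat set \<Rightarrow> nat set \<Rightarrow> 'x pmf \<Rightarrow> (nat \<Rightarrow> 'x pmf) \<Rightarrow> 'x \<Rightarrow> real" where
  "info1 M l B C PN PA x = ln (pmf (PA l) x / pmf (mix M B C PN PA) x)"

definition info2 ::
  "nat \<Rightarrow> nat set \<Rightarrow> nat set \<Rightarrow> 'x pmf \<Rightarrow> (nat \<Rightarrow> 'x pmf) \<Rightarrow> 'x \<Rightarrow> real" where
  "info2 M B C PN PA x = ln (pmf PN x / pmf (mix M B C PN PA) x)"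

definition dispersion :: "nat \<Rightarrow> nat set \<Rightarrow> nat set \<Rightarrow> 'x pmf \<Rightarrow> (nat \<Rightarrow> 'x pmf) \<Rightarrow> real" where
  "dispersion M B C PN PA =
     (\<Sum>i\<in>B \<inter> ({1..M} - C).
        measure_pmf.variance (PA (outlier_pos B i)) (info1 M (outlier_pos B i) B C PN PA))
     + (\<Sum>i\<in>({1..M} - B) \<inter> ({1..M} - C).
        measure_pmf.variance PN (info2 M B C PN PA))"

definition info_sum ::
  "nat \<Rightarrow> nat set \<Rightarrow> nat set \<Rightarrow> 'x pmf \<Rightarrow> (nat \<Rightarrow> 'x pmf) \<Rightarrow> (nat \<Rightarrow> 'x) \<Rightarrow> real" where
  "info_sum M B C PN PA xs =
     (\<Sum>j\<in>B \<inter> ({1..M} - C). info1 M (outlier_pos B j) B C PN PA (xs j))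
     + (\<Sum>j\<in>({1..M} - B) \<inter> ({1..M} - C). info2 M B C PN PA (xs j))"

definition covariance :: "'a pmf \<Rightarrow> ('a \<Rightarrow> real) \<Rightarrow> ('a \<Rightarrow> real) \<Rightarrow> real" where
  "covariance p X Y = measure_pmf.expectation p
     (\<lambda>x. (X x - measure_pmf.expectation p X) * (Y x - measure_pmf.expectation p Y))"

text \<open>The sequence \<open>C 1, C 2, \<dots>\<close> is the chosen ordering of \<open>outlier_sets M - {B}\<close>.\<close>

definition dispersion_matrix ::
  "nat \<Rightarrow> nat set \<Rightarrow> (nat \<Rightarrow> nat set) \<Rightarrow> 'x pmf \<Rightarrow> (nat \<Rightarrow> 'x pmf) \<Rightarrow> nat \<Rightarrow> nat \<Rightarrow> real" where
  "dispersion_matrix M B C PN PA i k =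
     (if i = k then dispersion M B (C i) PN PA
      else covariance (Pi_pmf {1..M} undefined (source B PN PA))
             (info_sum M B (C i) PN PA) (info_sum M B (C k) PN PA))"


section \<open>Multivariate Gaussian complementary distribution function\<close>

text \<open>Vectors of length \<open>k\<close> are functions on \<open>{1..k}\<close>. A law on \<open>\<real>\<^sup>k\<close> is Gaussian with mean \<open>\<mu>\<close> and
  covariance matrix \<open>\<Sigma>\<close>, where \<open>\<Sigma>\<close> may be singular, if it is the law of \<open>\<mu> + A W\<close> with
  \<open>A A\<^sup>T = \<Sigma>\<close> and \<open>W\<close> a vector of independent standard normal variables. Such a law exists iff
  \<open>\<Sigma>\<close> is symmetric and positive semidefinite; it depends only on \<open>\<mu>\<close> and \<open>\<Sigma>\<close> and not on
  \<open>A\<close>, its characteristic function being determined by \<open>\<mu>\<close> and \<open>\<Sigma>\<close>.\<close>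

definition is_gaussian_law ::
  "nat \<Rightarrow> (nat \<Rightarrow> real) \<Rightarrow> (nat \<Rightarrow> nat \<Rightarrow> real) \<Rightarrow> (nat \<Rightarrow> real) measure \<Rightarrow> bool" where
  "is_gaussian_law k \<mu> \<Sigma> N \<longleftrightarrow>
     (\<exists>(m::nat) A. (\<forall>i\<in>{1..k}. \<forall>j\<in>{1..k}. \<Sigma> i j = (\<Sum>l\<in>{1..m}. A i l * A j l)) \<and>
        N = distr (Pi\<^sub>M {1..m} (\<lambda>_. density lborel std_normal_density))
              (Pi\<^sub>M {1..k} (\<lambda>_. borel))
              (\<lambda>w. \<lambda>i\<in>{1..k}. \<mu> i + (\<Sum>l\<in>{1..m}. A i l * w l)))"

definition gaussian_law ::
  "nat \<Rightarrow> (nat \<Rightarrow> real) \<Rightarrow> (nat \<Rightarrow> nat \<Rightarrow> real) \<Rightarrow> (nat \<Rightarrow> real) measure" where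
  "gaussian_law k \<mu> \<Sigma> = (SOME N. is_gaussian_law k \<mu> \<Sigma> N)"

definition gaussian_Q ::
  "nat \<Rightarrow> (nat \<Rightarrow> real) \<Rightarrow> (nat \<Rightarrow> real) \<Rightarrow> (nat \<Rightarrow> nat \<Rightarrow> real) \<Rightarrow> real" where
  "gaussian_Q k x \<mu> \<Sigma> =
     (let N = gaussian_law k \<mu> \<Sigma> in measure N {z \<in> space N. \<forall>i\<in>{1..k}. x i \<le> z i})"

end

theory Submission
  imports Defs
begin

text \<open>Converse. Fix \<open>C \<noteq> B\<close> and write \<open>J\<close> for the sum over time of the information densities \<open>info_sum\<close> of
  \<open>(B, C)\<close>. The law under \<open>H\<^sub>C\<close> with nominal distribution \<open>mix\<close> and, for \<open>i \<in> C\<close>, the true law of the \<open>i\<close>-th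
  sequence as anomalous distribution has likelihood ratio \<open>exp J\<close> with the true law. Since the test errs
  under it with probability at most \<open>exp (- n \<lambda>)\<close>, deciding \<open>H\<^sub>B\<close> while \<open>J < n \<lambda> - ln n\<close> has true
  probability \<open>O(1 / n)\<close>. So up to \<open>O(1 / n)\<close> an observation that is not rejected satisfies
  \<open>J \<ge> n \<lambda> - ln n\<close> for all \<open>C \<noteq> B\<close>, an orthant event for a sum of independent vectors.

  Orthant events are estimated by Bergstroem's method: replacing the summands one at a time by Gaussian
  ones, the error at a step with Gaussian variance \<open>\<tau>\<close> is \<open>O(\<tau> powr (- 3 / 2))\<close> times the distance already
  known for fewer summands, and induction on the number of summands gives the rate \<open>1 / sqrt n\<close>. The
  covariance may be singular. Characteristic functions show that a Gaussian orthant probability depends on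
  the factor \<open>A\<close> of the covariance only through \<open>A A\<^sup>T\<close>.\<close>

text \<open>An orthant indicator enters Bergstroem's method only through its supremum, so no smooth
  test function has to be built. The method does need a Gaussian density, which a singular
  covariance lacks. The walk is therefore lifted to one Gaussian coordinate per symbol of the joint
  alphabet: there the step can be made centred with identity covariance, \<open>A\<close> projects
  it back to the information densities, and all likelihood ratios are taken before projecting.
  Degenerate rows do occur: for \<open>B\<close> strictly inside \<open>C\<close> the mixture is
  \<open>PN\<close> and the row of \<open>C\<close> vanishes. Anti-concentration is used for the
  other rows only.

  The induction closes because the Gaussian part that is kept has a fixed variance \<open>s\<close>:
  removing it costs \<open>O(1 / sqrt n)\<close>, while a large \<open>s\<close> makes the
  coefficient of the inductive bound smaller than 1.

  The threshold is lowered by \<open>ln n\<close> so that the change of measure costs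
  \<open>exp a * \<beta> = 1 / n\<close>; this shift is the whole of \<open>g\<close>. The error
  bound covers admissible tuples only, so the alternative must satisfy
  \<open>P\<^sub>A \<noteq> P\<^sub>N\<close> exactly; a perturbation of order \<open>1 / n\<close>
  per symbol keeps the likelihood within a factor 2.\<close>

section \<open>Affine changes of variables for products of standard normal laws\<close>

abbreviation std_gaussian :: "'l set \<Rightarrow> ('l \<Rightarrow> real) measure" where
  "std_gaussian L \<equiv> Pi\<^sub>M L (\<lambda>_. std_normal_distribution)"

interpretation std_normal: prob_space std_normal_distribution
  by (rule prob_space_normal_density) simp

interpretation std_gaussian: product_prob_space "\<lambda>_::'l. std_normal_distribution" UNIV
  by unfold_locales

lemma prob_space_std_gaussian: "prob_space (std_gaussian L)"
  by (intro prob_space_PiM std_normal.prob_space_axioms)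

text \<open>Both sides are the product over \<open>L\<close> of the one-dimensional laws
  \<open>distr std_normal_distribution borel (T l)\<close>: each agrees with it on boxes, and a
  finite product measure is determined by its values there.\<close>

lemma distr_std_gaussian_eq_density:
  fixes T :: "'l \<Rightarrow> real \<Rightarrow> real" and r :: "'l \<Rightarrow> real \<Rightarrow> ennreal"
  assumes L: "finite L"
    and [measurable]: "\<And>l. T l \<in> borel_measurable borel" "\<And>l. r l \<in> borel_measurable borel"
    and eq: "\<And>l. distr std_normal_distribution borel (T l) = density std_normal_distribution (r l)"
  shows "distr (std_gaussian L) (std_gaussian L) (\<lambda>w. \<lambda>l\<in>L. T l (w l))
    = density (std_gaussian L) (\<lambda>w. \<Prod>l\<in>L. r l (w l))"
proof -
  define N where "N l = distr std_normal_distribution borel (T l)" for l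
  have "prob_space (N l)" for l
    unfolding N_def by (intro std_normal.prob_space_distr) auto
  then interpret N: product_prob_space N UNIV
    by (simp add: product_prob_space_def product_prob_space_axioms_def product_sigma_finite_def
        prob_space_imp_sigma_finite)
  have sets_N: "sets (N l) = sets borel" for l
    by (simp add: N_def)
  have sets_PiN: "sets (Pi\<^sub>M L N) = sets (std_gaussian L)"
    by (intro sets_PiM_cong) (auto simp: N_def)
  have [measurable]: "(\<lambda>w. \<lambda>l\<in>L. T l (w l)) \<in> measurable (std_gaussian L) (std_gaussian L)"
    by (intro measurable_restrict) (simp add: measurable_compose[OF measurable_component_singleton])
  have [measurable]: "(\<lambda>w. \<Prod>l\<in>L. r l (w l)) \<in> borel_measurable (std_gaussian L)"
    by measurable
  have "distr (std_gaussian L) (std_gaussian L) (\<lambda>w. \<lambda>l\<in>L. T l (w l)) = Pi\<^sub>M L N"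
  proof (intro N.PiM_eqI L)
    fix A assume A: "\<And>i. i \<in> L \<Longrightarrow> A i \<in> sets (N i)"
    then have [measurable]: "\<And>i. i \<in> L \<Longrightarrow> A i \<in> sets borel"
      by (simp add: sets_N)
    have PA: "Pi\<^sub>E L A \<in> sets (std_gaussian L)"
      by (intro sets_PiM_I_finite L) auto
    have "emeasure (distr (std_gaussian L) (std_gaussian L) (\<lambda>w. \<lambda>l\<in>L. T l (w l))) (Pi\<^sub>E L A)
      = emeasure (std_gaussian L) ((\<lambda>w. \<lambda>l\<in>L. T l (w l)) -` Pi\<^sub>E L A \<inter> space (std_gaussian L))"
      using PA by (subst emeasure_distr) auto
    also have "(\<lambda>w. \<lambda>l\<in>L. T l (w l)) -` Pi\<^sub>E L A \<inter> space (std_gaussian L) = Pi\<^sub>E L (\<lambda>l. T l -` A l)"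
      by (auto simp: space_PiM PiE_def Pi_def)
    also have "emeasure (std_gaussian L) \<dots> = (\<Prod>l\<in>L. emeasure std_normal_distribution (T l -` A l))"
      using L measurable_sets[of "T _" borel borel "A _"] by (intro std_gaussian.emeasure_PiM) auto
    also have "\<dots> = (\<Prod>l\<in>L. emeasure (N l) (A l))"
      by (intro prod.cong) (auto simp: N_def emeasure_distr)
    finally show "emeasure (distr (std_gaussian L) (std_gaussian L) (\<lambda>w. \<lambda>l\<in>L. T l (w l))) (Pi\<^sub>E L A)
      = (\<Prod>l\<in>L. emeasure (N l) (A l))" .
  qed (simp add: sets_PiN)
  moreover have "density (std_gaussian L) (\<lambda>w. \<Prod>l\<in>L. r l (w l)) = Pi\<^sub>M L N"
  proof (intro N.PiM_eqI L)
    fix A assume A: "\<And>i. i \<in> L \<Longrightarrow> A i \<in> sets (N i)"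
    then have [measurable]: "\<And>i. i \<in> L \<Longrightarrow> A i \<in> sets borel"
      by (simp add: sets_N)
    have PA [measurable]: "Pi\<^sub>E L A \<in> sets (std_gaussian L)"
      by (intro sets_PiM_I_finite L) auto
    have "emeasure (density (std_gaussian L) (\<lambda>w. \<Prod>l\<in>L. r l (w l))) (Pi\<^sub>E L A)
      = (\<integral>\<^sup>+w. (\<Prod>l\<in>L. r l (w l)) * indicator (Pi\<^sub>E L A) w \<partial>std_gaussian L)"
      by (rule emeasure_density) auto
    also have "\<dots> = (\<integral>\<^sup>+w. (\<Prod>l\<in>L. r l (w l) * indicator (A l) (w l)) \<partial>std_gaussian L)"
    proof (intro nn_integral_cong)
      fix w assume w: "w \<in> space (std_gaussian L)"
      have "(\<Prod>l\<in>L. indicator (A l) (w l)) = (indicator (Pi\<^sub>E L A) w :: ennreal)"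
        using w L by (auto simp: space_PiM PiE_def Pi_def indicator_def prod_zero_iff)
      then show "(\<Prod>l\<in>L. r l (w l)) * indicator (Pi\<^sub>E L A) w = (\<Prod>l\<in>L. r l (w l) * indicator (A l) (w l))"
        by (simp add: prod.distrib)
    qed
    also have "\<dots> = (\<Prod>l\<in>L. \<integral>\<^sup>+x. r l x * indicator (A l) x \<partial>std_normal_distribution)"
      by (rule std_gaussian.product_nn_integral_prod[OF L]) auto
    also have "\<dots> = (\<Prod>l\<in>L. emeasure (N l) (A l))"
      unfolding N_def eq by (intro prod.cong) (auto simp: emeasure_density)
    finally show "emeasure (density (std_gaussian L) (\<lambda>w. \<Prod>l\<in>L. r l (w l))) (Pi\<^sub>E L A)
      = (\<Prod>l\<in>L. emeasure (N l) (A l))" .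
  qed (simp add: sets_PiN)
  ultimately show ?thesis by simp
qed

text \<open>The density is taken relative to the standard normal law and not to Lebesgue measure, so
  that it can be multiplied over \<open>L\<close> inside \<open>std_gaussian L\<close>. It is the
  quotient of the normal densities at \<open>(x - c) / a\<close> and at \<open>x\<close>, with
  \<open>1 / a\<close> from the Jacobian.\<close>

lemma distr_std_normal_affine:
  fixes c a :: real
  assumes a: "a > 0"
  shows "distr std_normal_distribution borel (\<lambda>x. a * x + c)
    = density std_normal_distribution (\<lambda>x. ennreal (exp (x\<^sup>2 / 2 - ((x - c) / a)\<^sup>2 / 2) / a))"
proof (rule measure_eqI)
  fix A :: "real set" assume "A \<in> sets (distr std_normal_distribution borel (\<lambda>x. a * x + c))"
  then have [measurable]: "A \<in> sets borel" by simp
  have "emeasure (distr std_normal_distribution borel (\<lambda>x. a * x + c)) A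
    = (\<integral>\<^sup>+x. indicator A x \<partial>distr std_normal_distribution borel (\<lambda>x. a * x + c))"
    by simp
  also have "\<dots> = (\<integral>\<^sup>+x. indicator A (a * x + c) \<partial>std_normal_distribution)"
    by (rule nn_integral_distr) auto
  also have "\<dots> = (\<integral>\<^sup>+x. ennreal (std_normal_density x) * indicator A (a * x + c) \<partial>lborel)"
    by (subst nn_integral_density) auto
  also have "\<dots> = ennreal (1 / a) * (\<integral>\<^sup>+x. ennreal (std_normal_density ((x - c) / a)) * indicator A x \<partial>lborel)" (is "_ = _ * ?J")
  proof -
    have "?J = ennreal \<bar>a\<bar> * (\<integral>\<^sup>+x. ennreal (std_normal_density ((c + a * x - c) / a)) * indicator A (c + a * x) \<partial>lborel)"
      using a by (intro nn_integral_real_affine) auto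
    also have "\<dots> = ennreal a * (\<integral>\<^sup>+x. ennreal (std_normal_density x) * indicator A (a * x + c) \<partial>lborel)"
      using a by (simp add: add.commute)
    finally have "ennreal (1 / a) * ?J = (ennreal (1 / a) * ennreal a) *
       (\<integral>\<^sup>+x. ennreal (std_normal_density x) * indicator A (a * x + c) \<partial>lborel)"
      by (simp add: mult.assoc)
    moreover have "ennreal (1 / a) * ennreal a = 1"
      using a by (simp add: ennreal_mult[symmetric])
    ultimately show ?thesis by simp
  qed
  also have "\<dots> = (\<integral>\<^sup>+x. ennreal (1 / a) * (ennreal (std_normal_density ((x - c) / a)) * indicator A x) \<partial>lborel)"
    by (rule nn_integral_cmult[symmetric]) auto
  also have "\<dots> = (\<integral>\<^sup>+x. ennreal (std_normal_density x) * (ennreal (exp (x\<^sup>2 / 2 - ((x - c) / a)\<^sup>2 / 2) / a) * indicator A x) \<partial>lborel)"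
  proof (intro nn_integral_cong)
    fix x :: real
    have "1 / a * std_normal_density ((x - c) / a) = std_normal_density x * (exp (x\<^sup>2 / 2 - ((x - c) / a)\<^sup>2 / 2) / a)"
      by (simp add: normal_density_def mult.assoc[symmetric] exp_add[symmetric])
    then show "ennreal (1 / a) * (ennreal (std_normal_density ((x - c) / a)) * indicator A x)
      = ennreal (std_normal_density x) * (ennreal (exp (x\<^sup>2 / 2 - ((x - c) / a)\<^sup>2 / 2) / a) * indicator A x)"
      using a by (simp add: mult.assoc[symmetric] ennreal_mult[symmetric] normal_density_nonneg)
  qed
  also have "\<dots> = emeasure (density std_normal_distribution (\<lambda>x. ennreal (exp (x\<^sup>2 / 2 - ((x - c) / a)\<^sup>2 / 2) / a))) A"
    by (subst emeasure_density, measurable, subst nn_integral_density) auto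
  finally show "emeasure (distr std_normal_distribution borel (\<lambda>x. a * x + c)) A
    = emeasure (density std_normal_distribution (\<lambda>x. ennreal (exp (x\<^sup>2 / 2 - ((x - c) / a)\<^sup>2 / 2) / a))) A" .
qed simp

text \<open>This moves shift and scale from the argument of \<open>f\<close> into a likelihood
  ratio, which is what lets merely measurable functions be compared under different Gaussian
  laws.\<close>

lemma integral_std_gaussian_affine:
  fixes f :: "('l \<Rightarrow> real) \<Rightarrow> real"
  assumes L: "finite L" and a: "a > 0" and [measurable]: "f \<in> borel_measurable (std_gaussian L)"
  shows "(\<integral>w. f (\<lambda>l\<in>L. a * w l + c l) \<partial>std_gaussian L)
    = (\<integral>w. (\<Prod>l\<in>L. exp ((w l)\<^sup>2 / 2 - ((w l - c l) / a)\<^sup>2 / 2) / a) * f w \<partial>std_gaussian L)"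
proof -
  define r where "r l x = exp (x\<^sup>2 / 2 - ((x - c l) / a)\<^sup>2 / 2) / a" for l x
  have "(\<integral>w. f (\<lambda>l\<in>L. a * w l + c l) \<partial>std_gaussian L)
    = (\<integral>w. f w \<partial>distr (std_gaussian L) (std_gaussian L) (\<lambda>w. \<lambda>l\<in>L. a * w l + c l))"
  proof (rule integral_distr[symmetric])
    show "(\<lambda>w. \<lambda>l\<in>L. a * w l + c l) \<in> measurable (std_gaussian L) (std_gaussian L)"
      by (intro measurable_restrict) measurable
  qed measurable
  also have "distr (std_gaussian L) (std_gaussian L) (\<lambda>w. \<lambda>l\<in>L. a * w l + c l)
    = density (std_gaussian L) (\<lambda>w. \<Prod>l\<in>L. ennreal (r l (w l)))"
    unfolding r_def using distr_std_normal_affine[OF a]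
    by (intro distr_std_gaussian_eq_density[OF L, where T="\<lambda>l x. a * x + c l"]) auto
  also have "\<dots> = density (std_gaussian L) (\<lambda>w. ennreal (\<Prod>l\<in>L. r l (w l)))"
    using a by (simp add: prod_ennreal r_def)
  also have "(\<integral>w. f w \<partial>density (std_gaussian L) (\<lambda>w. ennreal (\<Prod>l\<in>L. r l (w l))))
    = (\<integral>w. (\<Prod>l\<in>L. r l (w l)) *\<^sub>R f w \<partial>std_gaussian L)"
    unfolding r_def using a by (intro integral_density) (auto intro!: prod_nonneg)
  finally show ?thesis by (simp only: r_def real_scaleR_def)
qed

section \<open>Expansion of the likelihood ratios of a shift and of a scaling\<close>

lemma exp_taylor2_bound:
  fixes x :: real
  shows "\<bar>exp x - 1 - x\<bar> \<le> exp \<bar>x\<bar> * x\<^sup>2 / 2"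
proof -
  obtain t where t: "\<bar>t\<bar> \<le> \<bar>x\<bar>" "exp x = (\<Sum>m<2. x ^ m / fact m) + exp t / fact 2 * x ^ 2"
    using Maclaurin_exp_le[of x 2] by blast
  have eq: "exp x - 1 - x = exp t / 2 * x\<^sup>2"
    using t(2) by (simp add: eval_nat_numeral)
  have "exp t \<le> exp \<bar>x\<bar>" using t(1) by simp
  then have "exp t * x\<^sup>2 \<le> exp \<bar>x\<bar> * x\<^sup>2" by (intro mult_right_mono) auto
  moreover have "\<bar>exp x - 1 - x\<bar> = exp t * x\<^sup>2 / 2"
    unfolding eq abs_mult by simp
  ultimately show ?thesis by linarith
qed

lemma exp_taylor3_bound:
  fixes x :: real
  shows "\<bar>exp x - 1 - x - x\<^sup>2 / 2\<bar> \<le> exp \<bar>x\<bar> * \<bar>x\<bar> ^ 3 / 6"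
proof -
  obtain t where t: "\<bar>t\<bar> \<le> \<bar>x\<bar>" "exp x = (\<Sum>m<3. x ^ m / fact m) + exp t / fact 3 * x ^ 3"
    using Maclaurin_exp_le[of x 3] by blast
  have eq: "exp x - 1 - x - x\<^sup>2 / 2 = exp t / 6 * x ^ 3"
    using t(2) by (simp add: eval_nat_numeral)
  have "exp t \<le> exp \<bar>x\<bar>" using t(1) by simp
  then have "exp t * \<bar>x\<bar> ^ 3 \<le> exp \<bar>x\<bar> * \<bar>x\<bar> ^ 3" by (intro mult_right_mono) auto
  moreover have "\<bar>exp x - 1 - x - x\<^sup>2 / 2\<bar> = exp t * \<bar>x\<bar> ^ 3 / 6"
    unfolding eq abs_mult power_abs by simp
  ultimately show ?thesis by linarith
qed

text \<open>One term of the exponential series, all of whose terms are nonnegative. It serves to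
  absorb polynomial factors into exponentials.\<close>

lemma power_over_fact_le_exp:
  fixes x :: real
  assumes "x \<ge> 0"
  shows "x ^ n / fact n \<le> exp x"
proof -
  obtain t where t: "exp x = (\<Sum>m<Suc n. x ^ m / fact m) + exp t / fact (Suc n) * x ^ Suc n"
    using Maclaurin_exp_le[of x "Suc n"] by blast
  have "(\<Sum>m\<in>{n}. x ^ m / fact m) \<le> (\<Sum>m<Suc n. x ^ m / fact m)"
    using assms by (intro sum_mono2) auto
  moreover have "0 \<le> exp t / fact (Suc n) * x ^ Suc n"
    using assms by simp
  ultimately show ?thesis using t by simp
qed

text \<open>Both likelihood ratios equal \<open>1 + \<epsilon>\<^sup>2 (|w|\<^sup>2 - d) / 2\<close> up to \<open>O(\<epsilon>\<^sup>3)\<close>, because the first two moments of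
  \<open>\<xi>\<close> are those of a standard normal vector.\<close>

lemma likelihood_ratio_difference_bound:
  fixes q :: "'t \<Rightarrow> real" and \<xi> :: "'t \<Rightarrow> 'l \<Rightarrow> real"
  assumes L: "finite L" and T: "finite T"
    and q0: "\<And>\<theta>. \<theta> \<in> T \<Longrightarrow> q \<theta> \<ge> 0" and q1: "(\<Sum>\<theta>\<in>T. q \<theta>) = 1"
    and mean: "\<And>l. l \<in> L \<Longrightarrow> (\<Sum>\<theta>\<in>T. q \<theta> * \<xi> \<theta> l) = 0"
    and cov: "\<And>l l'. l \<in> L \<Longrightarrow> l' \<in> L \<Longrightarrow> (\<Sum>\<theta>\<in>T. q \<theta> * (\<xi> \<theta> l * \<xi> \<theta> l')) = (if l = l' then 1 else 0)"
  shows "\<exists>C\<ge>0. \<forall>\<epsilon>>0. \<epsilon>\<^sup>2 \<le> 1 / 2 \<longrightarrow> (\<forall>w.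
    \<bar>(\<Sum>\<theta>\<in>T. q \<theta> * exp (\<Sum>l\<in>L. \<epsilon> * w l * \<xi> \<theta> l - \<epsilon>\<^sup>2 * (\<xi> \<theta> l)\<^sup>2 / 2))
      - exp (\<Sum>l\<in>L. \<epsilon>\<^sup>2 * (w l)\<^sup>2 / (2 * (1 + \<epsilon>\<^sup>2)) - ln (1 + \<epsilon>\<^sup>2) / 2)\<bar>
    \<le> C * \<epsilon> ^ 3 * exp (\<Sum>l\<in>L. 3 / 8 * (w l)\<^sup>2))"
proof -
  \<comment> \<open>A uniform bound on all coordinates of \<xi>, available because \<open>T\<close>
    and \<open>L\<close> are finite.\<close>
  define R where "R = (\<Sum>\<theta>\<in>T. \<Sum>l\<in>L. \<bar>\<xi> \<theta> l\<bar>)"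
  define d where "d = real (card L)"
  have R: "\<bar>\<xi> \<theta> l\<bar> \<le> R" if "\<theta> \<in> T" "l \<in> L" for \<theta> l
  proof -
    have "\<bar>\<xi> \<theta> l\<bar> \<le> (\<Sum>l\<in>L. \<bar>\<xi> \<theta> l\<bar>)" using that L by (intro member_le_sum) auto
    also have "\<dots> \<le> R" unfolding R_def
      by (rule member_le_sum[where f="\<lambda>\<theta>. \<Sum>l\<in>L. \<bar>\<xi> \<theta> l\<bar>"]) (use that T in \<open>auto intro!: sum_nonneg\<close>)
    finally show ?thesis .
  qed
  have R0: "R \<ge> 0" unfolding R_def by (intro sum_nonneg) auto
  have d0: "d \<ge> 0" by (simp add: d_def)
  \<comment> \<open>The 3 is 1 + 2, from the cubic remainder (\<open>part1\<close>) and the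
    quadratic mismatch (\<open>part2\<close>); the 20 is 16 + 4, from the remainders of the scaling
    ratio (\<open>part3\<close>). The exponents are what remains of the bound on
    \<open>2 * \<kappa>\<close> and of \<open>3 / 8 * D\<close> once \<open>3 / 8 * N\<close> is
    split off.\<close>
  define K where "K = 3 * exp (6 * d * R\<^sup>2) + 20 * exp (3 / 8 * d)"
  have "\<bar>(\<Sum>\<theta>\<in>T. q \<theta> * exp (\<Sum>l\<in>L. \<epsilon> * w l * \<xi> \<theta> l - \<epsilon>\<^sup>2 * (\<xi> \<theta> l)\<^sup>2 / 2))
      - exp (\<Sum>l\<in>L. \<epsilon>\<^sup>2 * (w l)\<^sup>2 / (2 * (1 + \<epsilon>\<^sup>2)) - ln (1 + \<epsilon>\<^sup>2) / 2)\<bar>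
    \<le> K * \<epsilon> ^ 3 * exp (\<Sum>l\<in>L. 3 / 8 * (w l)\<^sup>2)"
    if e: "\<epsilon> > 0" "\<epsilon>\<^sup>2 \<le> 1 / 2" for \<epsilon> :: real and w :: "'l \<Rightarrow> real"
  proof -
    define y where "y = (\<Sum>l\<in>L. \<bar>w l\<bar>)"
    define N where "N = (\<Sum>l\<in>L. (w l)\<^sup>2)"
    define s where "s \<theta> = (\<Sum>l\<in>L. w l * \<xi> \<theta> l)" for \<theta>
    define r where "r \<theta> = (\<Sum>l\<in>L. (\<xi> \<theta> l)\<^sup>2)" for \<theta>
    \<comment> \<open>The exponent \<open>a \<theta>\<close> is at most
      \<open>\<epsilon> * \<kappa>\<close> in absolute value. Since \<kappa> grows linearly in
      \<open>w\<close>, its exponential is integrable against a Gaussian.\<close>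
    define \<kappa> where "\<kappa> = R * y + d * R\<^sup>2"
    define a where "a \<theta> = \<epsilon> * s \<theta> - \<epsilon>\<^sup>2 * r \<theta> / 2" for \<theta>
    have e1: "\<epsilon> \<le> 1"
    proof (rule ccontr)
      assume "\<not> \<epsilon> \<le> 1"
      then have "1 * 1 \<le> \<epsilon> * \<epsilon>" by (intro mult_mono) auto
      then show False using e by (simp add: power2_eq_square)
    qed
    have y0: "y \<ge> 0" unfolding y_def by (intro sum_nonneg) auto
    have N0: "N \<ge> 0" unfolding N_def by (intro sum_nonneg) auto
    have k0: "\<kappa> \<ge> 0" unfolding \<kappa>_def using R0 y0 d0 by auto
    have s_le: "\<bar>s \<theta>\<bar> \<le> R * y" if "\<theta> \<in> T" for \<theta>
    proof -
      have "\<bar>s \<theta>\<bar> \<le> (\<Sum>l\<in>L. \<bar>w l * \<xi> \<theta> l\<bar>)" unfolding s_def by (rule sum_abs)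
      also have "\<dots> \<le> (\<Sum>l\<in>L. R * \<bar>w l\<bar>)"
      proof (intro sum_mono)
        fix l assume "l \<in> L"
        then have "\<bar>\<xi> \<theta> l\<bar> * \<bar>w l\<bar> \<le> R * \<bar>w l\<bar>" using R[OF that] by (intro mult_right_mono) auto
        then show "\<bar>w l * \<xi> \<theta> l\<bar> \<le> R * \<bar>w l\<bar>" unfolding abs_mult mult.commute[of "\<bar>w l\<bar>"] .
      qed
      finally show ?thesis by (simp add: y_def sum_distrib_left)
    qed
    have r_le: "0 \<le> r \<theta>" "r \<theta> \<le> d * R\<^sup>2" if "\<theta> \<in> T" for \<theta>
    proof -
      show "0 \<le> r \<theta>" unfolding r_def by (intro sum_nonneg) auto
      have "r \<theta> \<le> (\<Sum>l\<in>L. R\<^sup>2)" unfolding r_def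
        using R[OF that] R0 by (intro sum_mono) (simp add: abs_le_square_iff[symmetric])
      then show "r \<theta> \<le> d * R\<^sup>2" by (simp add: d_def)
    qed
    have a_le: "\<bar>a \<theta>\<bar> \<le> \<epsilon> * \<kappa>" if "\<theta> \<in> T" for \<theta>
    proof -
      have "\<bar>a \<theta>\<bar> \<le> \<epsilon> * \<bar>s \<theta>\<bar> + \<epsilon>\<^sup>2 * r \<theta> / 2"
        unfolding a_def using e r_le[OF that] by (intro order_trans[OF abs_triangle_ineq4]) (simp add: abs_mult)
      also have "\<dots> \<le> \<epsilon> * (R * y) + \<epsilon> * (d * R\<^sup>2)"
      proof (intro add_mono mult_left_mono s_le that)
        have "\<epsilon>\<^sup>2 * r \<theta> / 2 \<le> \<epsilon>\<^sup>2 * r \<theta>" using r_le[OF that] by simp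
        also have "\<dots> \<le> \<epsilon> * (d * R\<^sup>2)"
          using e e1 r_le[OF that] by (intro mult_mono) (auto simp: power2_eq_square)
        finally show "\<epsilon>\<^sup>2 * r \<theta> / 2 \<le> \<epsilon> * (d * R\<^sup>2)" .
      qed (use e in auto)
      finally show ?thesis by (simp add: \<kappa>_def algebra_simps)
    qed
    have k3: "\<kappa> ^ 3 / 6 \<le> exp \<kappa>" and k2: "\<kappa>\<^sup>2 / 2 \<le> exp \<kappa>"
      using power_over_fact_le_exp[OF k0, of 3] power_over_fact_le_exp[OF k0, of 2]
      by (simp_all add: eval_nat_numeral)
    have rem: "\<bar>exp (a \<theta>) - 1 - a \<theta> - (a \<theta>)\<^sup>2 / 2\<bar> \<le> \<epsilon> ^ 3 * exp (2 * \<kappa>)" if "\<theta> \<in> T" for \<theta>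
    proof -
      have ak: "\<bar>a \<theta>\<bar> \<le> \<kappa>" using a_le[OF that] e e1 k0 mult_right_mono[of \<epsilon> 1 \<kappa>] by simp
      have "exp \<bar>a \<theta>\<bar> * \<bar>a \<theta>\<bar> ^ 3 \<le> exp \<kappa> * (\<epsilon> * \<kappa>) ^ 3"
        using ak a_le[OF that] by (intro mult_mono power_mono) auto
      also have "\<dots> = (\<epsilon> ^ 3 * exp \<kappa>) * \<kappa> ^ 3" by (simp only: power_mult_distrib mult_ac)
      also have "\<dots> \<le> (\<epsilon> ^ 3 * exp \<kappa>) * (6 * exp \<kappa>)"
      proof (rule mult_left_mono)
        show "\<kappa> ^ 3 \<le> 6 * exp \<kappa>" using k3 by linarith
        show "0 \<le> \<epsilon> ^ 3 * exp \<kappa>" using e(1) by (intro mult_nonneg_nonneg) auto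
      qed
      also have "\<dots> = 6 * (\<epsilon> ^ 3 * exp (2 * \<kappa>))"
        unfolding mult_2 exp_add by (simp only: mult_ac)
      finally show ?thesis
        using exp_taylor3_bound[of "a \<theta>"] by linarith
    qed
    have s_mean: "(\<Sum>\<theta>\<in>T. q \<theta> * s \<theta>) = 0"
    proof -
      have "(\<Sum>\<theta>\<in>T. q \<theta> * s \<theta>) = (\<Sum>l\<in>L. w l * (\<Sum>\<theta>\<in>T. q \<theta> * \<xi> \<theta> l))"
        unfolding s_def sum_distrib_left by (subst sum.swap) (simp add: mult_ac)
      then show ?thesis using mean by simp
    qed
    have s_sq: "(\<Sum>\<theta>\<in>T. q \<theta> * (s \<theta>)\<^sup>2) = N"
    proof -
      have "(\<Sum>\<theta>\<in>T. q \<theta> * (s \<theta>)\<^sup>2) = (\<Sum>\<theta>\<in>T. \<Sum>l\<in>L. \<Sum>l'\<in>L. w l * w l' * (q \<theta> * (\<xi> \<theta> l * \<xi> \<theta> l')))"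
        unfolding s_def power2_eq_square sum_product by (simp add: sum_distrib_left mult_ac)
      also have "\<dots> = (\<Sum>l\<in>L. \<Sum>l'\<in>L. \<Sum>\<theta>\<in>T. w l * w l' * (q \<theta> * (\<xi> \<theta> l * \<xi> \<theta> l')))"
        by (subst sum.swap, intro sum.cong refl, subst sum.swap) simp
      also have "\<dots> = (\<Sum>l\<in>L. \<Sum>l'\<in>L. w l * w l' * (if l = l' then 1 else 0))"
        using cov by (simp add: sum_distrib_left[symmetric])
      also have "\<dots> = N" unfolding N_def using L
        by (intro sum.cong refl) (simp add: power2_eq_square if_distrib[of "\<lambda>x. _ * x"] cong: if_cong)
      finally show ?thesis .
    qed
    have r_mean: "(\<Sum>\<theta>\<in>T. q \<theta> * r \<theta>) = d"
    proof -
      have "(\<Sum>\<theta>\<in>T. q \<theta> * r \<theta>) = (\<Sum>l\<in>L. \<Sum>\<theta>\<in>T. q \<theta> * (\<xi> \<theta> l * \<xi> \<theta> l))"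
        unfolding r_def sum_distrib_left power2_eq_square by (rule sum.swap)
      then show ?thesis using cov by (simp add: d_def)
    qed
    \<comment> \<open>The first-order term dies with the mean and the second-order terms average to
      \<open>\<epsilon>\<^sup>2 * (N - d) / 2\<close> by isotropy; only multiples of
      \<open>\<epsilon> ^ 3\<close> survive.\<close>
    have expand: "(\<Sum>\<theta>\<in>T. q \<theta> * (1 + a \<theta> + (a \<theta>)\<^sup>2 / 2)) - (1 + \<epsilon>\<^sup>2 * (N - d) / 2)
      = \<epsilon> ^ 3 * (\<Sum>\<theta>\<in>T. q \<theta> * (\<epsilon> * (r \<theta>)\<^sup>2 / 8 - s \<theta> * r \<theta> / 2))"
    proof -
      have "(\<Sum>\<theta>\<in>T. q \<theta> * (1 + a \<theta> + (a \<theta>)\<^sup>2 / 2))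
        = (\<Sum>\<theta>\<in>T. q \<theta> + \<epsilon> * (q \<theta> * s \<theta>) - \<epsilon>\<^sup>2 / 2 * (q \<theta> * r \<theta>) + \<epsilon>\<^sup>2 / 2 * (q \<theta> * (s \<theta>)\<^sup>2)
           + \<epsilon> ^ 3 * (q \<theta> * (\<epsilon> * (r \<theta>)\<^sup>2 / 8 - s \<theta> * r \<theta> / 2)))"
        unfolding a_def by (intro sum.cong refl) (simp add: field_simps power2_eq_square power3_eq_cube)
      also have "\<dots> = 1 + \<epsilon> * 0 - \<epsilon>\<^sup>2 / 2 * d + \<epsilon>\<^sup>2 / 2 * N
          + \<epsilon> ^ 3 * (\<Sum>\<theta>\<in>T. q \<theta> * (\<epsilon> * (r \<theta>)\<^sup>2 / 8 - s \<theta> * r \<theta> / 2))"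
        unfolding sum.distrib sum_subtractf sum_distrib_left[symmetric] q1 s_mean s_sq r_mean ..
      finally show ?thesis by (simp add: algebra_simps diff_divide_distrib)
    qed
    have avg: "\<bar>\<Sum>\<theta>\<in>T. q \<theta> * g \<theta>\<bar> \<le> G" if "\<And>\<theta>. \<theta> \<in> T \<Longrightarrow> \<bar>g \<theta>\<bar> \<le> G" for g G
    proof -
      have "\<bar>\<Sum>\<theta>\<in>T. q \<theta> * g \<theta>\<bar> \<le> (\<Sum>\<theta>\<in>T. \<bar>q \<theta> * g \<theta>\<bar>)" by (rule sum_abs)
      also have "\<dots> \<le> (\<Sum>\<theta>\<in>T. q \<theta> * G)"
        using that q0 by (intro sum_mono) (simp add: abs_mult mult_left_mono)
      also have "\<dots> = G" using q1 by (simp add: sum_distrib_right[symmetric])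
      finally show ?thesis .
    qed
    have part2: "\<bar>(\<Sum>\<theta>\<in>T. q \<theta> * (1 + a \<theta> + (a \<theta>)\<^sup>2 / 2)) - (1 + \<epsilon>\<^sup>2 * (N - d) / 2)\<bar> \<le> \<epsilon> ^ 3 * (2 * exp (2 * \<kappa>))"
    proof -
      have "\<bar>\<epsilon> * (r \<theta>)\<^sup>2 / 8 - s \<theta> * r \<theta> / 2\<bar> \<le> 2 * exp (2 * \<kappa>)" if "\<theta> \<in> T" for \<theta>
      proof -
        have "\<bar>\<epsilon> * (r \<theta>)\<^sup>2 / 8 - s \<theta> * r \<theta> / 2\<bar> \<le> \<bar>\<epsilon> * (r \<theta>)\<^sup>2 / 8\<bar> + \<bar>s \<theta> * r \<theta> / 2\<bar>"
          by (rule abs_triangle_ineq4)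
        also have "\<dots> \<le> (d * R\<^sup>2)\<^sup>2 + (R * y) * (d * R\<^sup>2)"
        proof (intro add_mono)
          have "\<epsilon> * (r \<theta>)\<^sup>2 \<le> 1 * (d * R\<^sup>2)\<^sup>2" using e e1 r_le[OF that] by (intro mult_mono power_mono) auto
          moreover have "0 \<le> \<epsilon> * (r \<theta>)\<^sup>2" using e by simp
          ultimately show "\<bar>\<epsilon> * (r \<theta>)\<^sup>2 / 8\<bar> \<le> (d * R\<^sup>2)\<^sup>2" by linarith
          have "\<bar>s \<theta>\<bar> * r \<theta> \<le> (R * y) * (d * R\<^sup>2)" using s_le[OF that] r_le[OF that] R0 y0 by (intro mult_mono) auto
          moreover have "0 \<le> \<bar>s \<theta>\<bar> * r \<theta>" using r_le[OF that] by simp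
          moreover have "\<bar>s \<theta> * r \<theta> / 2\<bar> = \<bar>s \<theta>\<bar> * r \<theta> / 2" using r_le[OF that] unfolding abs_divide abs_mult by simp
          ultimately show "\<bar>s \<theta> * r \<theta> / 2\<bar> \<le> (R * y) * (d * R\<^sup>2)" by linarith
        qed
        also have "\<dots> = d * R\<^sup>2 * \<kappa>" by (simp add: \<kappa>_def algebra_simps power2_eq_square)
        also have "\<dots> \<le> \<kappa> * \<kappa>" using R0 y0 k0 by (intro mult_right_mono) (auto simp: \<kappa>_def)
        also have "\<dots> \<le> 2 * exp \<kappa>" using k2 by (simp add: power2_eq_square)
        also have "\<dots> \<le> 2 * exp (2 * \<kappa>)" using k0 by simp
        finally show ?thesis .
      qed
      then show ?thesis unfolding expand using e avg by (simp add: abs_mult)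
    qed
    have part1: "\<bar>(\<Sum>\<theta>\<in>T. q \<theta> * exp (a \<theta>)) - (\<Sum>\<theta>\<in>T. q \<theta> * (1 + a \<theta> + (a \<theta>)\<^sup>2 / 2))\<bar> \<le> \<epsilon> ^ 3 * exp (2 * \<kappa>)"
    proof -
      have "(\<Sum>\<theta>\<in>T. q \<theta> * exp (a \<theta>)) - (\<Sum>\<theta>\<in>T. q \<theta> * (1 + a \<theta> + (a \<theta>)\<^sup>2 / 2))
        = (\<Sum>\<theta>\<in>T. q \<theta> * (exp (a \<theta>) - 1 - a \<theta> - (a \<theta>)\<^sup>2 / 2))"
        by (simp add: sum_subtractf[symmetric] algebra_simps)
      then show ?thesis using avg[OF rem] by simp
    qed
    define \<delta> where "\<delta> = \<epsilon>\<^sup>2"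
    have \<delta>: "\<delta> > 0" "\<delta> \<le> 1 / 2" using e by (auto simp: \<delta>_def)
    define D where "D = N + d"
    have D0: "D \<ge> 0" using N0 d0 by (simp add: D_def)
    \<comment> \<open>Logarithm of the scaling ratio. To first order in \<delta> it is
      \<open>\<delta> * (N - d) / 2\<close>, which matches the averaged shift ratio.\<close>
    define b where "b = \<delta> * N / (2 * (1 + \<delta>)) - d * ln (1 + \<delta>) / 2"
    have lnb: "\<delta> - \<delta>\<^sup>2 \<le> ln (1 + \<delta>)" "ln (1 + \<delta>) \<le> \<delta>" "0 \<le> ln (1 + \<delta>)"
      using \<delta> ln_one_plus_pos_lower_bound[of \<delta>] ln_add_one_self_le_self[of \<delta>] by auto
    have half: "X / (2 * (1 + \<delta>)) \<le> X / 2" "0 \<le> X / (2 * (1 + \<delta>))" if "X \<ge> 0" for X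
      using that \<delta> by (intro divide_left_mono divide_nonneg_nonneg mult_pos_pos; simp)+
    have b1: "\<bar>b - \<delta> * (N - d) / 2\<bar> \<le> \<delta>\<^sup>2 * D / 2"
    proof -
      have "b - \<delta> * (N - d) / 2 = d * (\<delta> - ln (1 + \<delta>)) / 2 - N * \<delta>\<^sup>2 / (2 * (1 + \<delta>))"
        unfolding b_def using \<delta> by (simp add: field_simps power2_eq_square)
      moreover have "d * (\<delta> - ln (1 + \<delta>)) \<le> d * \<delta>\<^sup>2" "0 \<le> d * (\<delta> - ln (1 + \<delta>))"
        using lnb d0 by (auto intro!: mult_left_mono)
      moreover have "N * \<delta>\<^sup>2 / (2 * (1 + \<delta>)) \<le> N * \<delta>\<^sup>2 / 2" "0 \<le> N * \<delta>\<^sup>2 / (2 * (1 + \<delta>))"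
        using \<delta> N0 by (intro half mult_nonneg_nonneg; simp)+
      moreover have "\<delta>\<^sup>2 * D / 2 = d * \<delta>\<^sup>2 / 2 + N * \<delta>\<^sup>2 / 2" "0 \<le> d * \<delta>\<^sup>2" "0 \<le> N * \<delta>\<^sup>2"
        using d0 N0 by (simp_all add: D_def algebra_simps add_divide_distrib)
      ultimately show ?thesis by linarith
    qed
    have b2: "\<bar>b\<bar> \<le> \<delta> * D / 2"
    proof -
      have "\<delta> * N / (2 * (1 + \<delta>)) \<le> \<delta> * N / 2" "0 \<le> \<delta> * N / (2 * (1 + \<delta>))"
        using \<delta> N0 by (intro half mult_nonneg_nonneg; simp)+
      moreover have "d * ln (1 + \<delta>) \<le> d * \<delta>" "0 \<le> d * ln (1 + \<delta>)"
        using lnb d0 by (auto intro!: mult_left_mono)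
      moreover have "\<delta> * D / 2 = \<delta> * N / 2 + d * \<delta> / 2" by (simp add: D_def algebra_simps add_divide_distrib)
      ultimately show ?thesis unfolding b_def by linarith
    qed
    have part3: "\<bar>exp b - (1 + \<epsilon>\<^sup>2 * (N - d) / 2)\<bar> \<le> \<epsilon> ^ 3 * (20 * exp (3 / 8 * D))"
    proof -
      \<comment> \<open>With \<open>\<delta> \<le> 1 / 2\<close> the exponential of
        \<open>\<bar>b\<bar>\<close> costs \<open>D / 4\<close>, and another \<open>D / 8\<close>
        absorbs the factor \<open>D\<^sup>2\<close>. The total coefficient \<open>3 / 8\<close>
        stays below \<open>1 / 2\<close>, the limit of integrability against the Gaussian
        density.\<close>
      have dD: "\<delta> * D / 2 \<le> D / 4" using \<delta> D0 mult_right_mono[of \<delta> "1 / 2" D] by linarith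
      have b4: "\<bar>b\<bar> \<le> D / 4" using b2 dD by linarith
      have "b\<^sup>2 \<le> (\<delta> * D / 2)\<^sup>2" using b2 by (simp add: abs_le_square_iff[symmetric])
      with b4 have "exp \<bar>b\<bar> * b\<^sup>2 \<le> exp (D / 4) * (\<delta> * D / 2)\<^sup>2"
        by (intro mult_mono) auto
      also have "\<dots> = 2 * (\<delta>\<^sup>2 * exp (D / 4) * (D\<^sup>2 / 8))"
        by (simp add: power_mult_distrib power_divide)
      also have "\<dots> \<le> 2 * (\<delta>\<^sup>2 * exp (D / 4) * (16 * exp (D / 8)))"
      proof (intro mult_left_mono)
        have "(D / 8) ^ 2 / 2 \<le> exp (D / 8)"
          using power_over_fact_le_exp[of "D / 8" 2] D0 by (simp add: eval_nat_numeral)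
        then show "D\<^sup>2 / 8 \<le> 16 * exp (D / 8)" unfolding power_divide by simp
      qed auto
      also have "\<dots> = 2 * (\<delta>\<^sup>2 * (16 * exp (D / 4 + D / 8)))"
        unfolding exp_add by (simp only: mult_ac)
      also have "D / 4 + D / 8 = 3 / 8 * D" by simp
      finally have 1: "\<bar>exp b - 1 - b\<bar> \<le> \<delta>\<^sup>2 * (16 * exp (3 / 8 * D))"
        using exp_taylor2_bound[of b] by linarith
      have "D / 8 \<le> exp (D / 8)"
        using power_over_fact_le_exp[of "D / 8" 1] D0 by simp
      also have "\<dots> \<le> exp (3 / 8 * D)" using D0 by simp
      finally have "\<delta>\<^sup>2 * (D / 2) \<le> \<delta>\<^sup>2 * (4 * exp (3 / 8 * D))"
        by (intro mult_left_mono) auto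
      then have 2: "\<bar>b - \<delta> * (N - d) / 2\<bar> \<le> \<delta>\<^sup>2 * (4 * exp (3 / 8 * D))"
        using b1 by simp
      have "\<bar>exp b - (1 + \<delta> * (N - d) / 2)\<bar> \<le> \<delta>\<^sup>2 * (20 * exp (3 / 8 * D))"
        using 1 2 by linarith
      also have "\<dots> \<le> \<epsilon> ^ 3 * (20 * exp (3 / 8 * D))"
      proof (intro mult_right_mono)
        have "\<delta>\<^sup>2 = \<epsilon> ^ 3 * \<epsilon>" by (simp add: \<delta>_def eval_nat_numeral)
        also have "\<dots> \<le> \<epsilon> ^ 3 * 1" using e e1 by (intro mult_left_mono) auto
        finally show "\<delta>\<^sup>2 \<le> \<epsilon> ^ 3" by simp
      qed simp
      finally show ?thesis by (simp add: \<delta>_def)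
    qed
    have eqa: "(\<Sum>l\<in>L. \<epsilon> * w l * \<xi> \<theta> l - \<epsilon>\<^sup>2 * (\<xi> \<theta> l)\<^sup>2 / 2) = a \<theta>" for \<theta>
      unfolding a_def s_def r_def
      by (simp add: sum_subtractf sum_distrib_left sum_divide_distrib mult.assoc)
    have eqb: "(\<Sum>l\<in>L. \<epsilon>\<^sup>2 * (w l)\<^sup>2 / (2 * (1 + \<epsilon>\<^sup>2)) - ln (1 + \<epsilon>\<^sup>2) / 2) = b"
      unfolding b_def N_def \<delta>_def d_def
      by (simp add: sum_subtractf sum_distrib_left sum_divide_distrib)
    have eqN: "(\<Sum>l\<in>L. 3 / 8 * (w l)\<^sup>2) = 3 / 8 * N" by (simp add: N_def sum_distrib_left)
    \<comment> \<open>The cross term is split by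
      \<open>(2 * R - \<bar>w l\<bar> / 2)\<^sup>2 \<ge> 0\<close>, weighted so that only
      \<open>N / 4\<close> is charged to the exponent.\<close>
    have k_le: "2 * \<kappa> \<le> 6 * d * R\<^sup>2 + 3 / 8 * N"
    proof -
      have "2 * R * y = (\<Sum>l\<in>L. 2 * R * \<bar>w l\<bar>)" by (simp add: y_def sum_distrib_left)
      also have "\<dots> \<le> (\<Sum>l\<in>L. 4 * R\<^sup>2 + (w l)\<^sup>2 / 4)"
      proof (intro sum_mono)
        fix l show "2 * R * \<bar>w l\<bar> \<le> 4 * R\<^sup>2 + (w l)\<^sup>2 / 4"
          using zero_le_power2[of "2 * R - \<bar>w l\<bar> / 2"] by (simp add: power2_diff power_divide power_mult_distrib)
      qed
      also have "\<dots> = 4 * d * R\<^sup>2 + N / 4" by (simp add: sum.distrib d_def N_def sum_divide_distrib)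
      finally show ?thesis using N0 by (simp add: \<kappa>_def)
    qed
    have "\<bar>(\<Sum>\<theta>\<in>T. q \<theta> * exp (a \<theta>)) - exp b\<bar> \<le> \<epsilon> ^ 3 * (3 * exp (2 * \<kappa>) + 20 * exp (3 / 8 * D))"
    proof -
      have "\<epsilon> ^ 3 * (3 * exp (2 * \<kappa>) + 20 * exp (3 / 8 * D))
        = \<epsilon> ^ 3 * exp (2 * \<kappa>) + \<epsilon> ^ 3 * (2 * exp (2 * \<kappa>)) + \<epsilon> ^ 3 * (20 * exp (3 / 8 * D))"
        by (simp add: algebra_simps)
      then show ?thesis using part1 part2 part3 by linarith
    qed
    also have "\<dots> \<le> \<epsilon> ^ 3 * (3 * exp (6 * d * R\<^sup>2 + 3 / 8 * N) + 20 * exp (3 / 8 * d + 3 / 8 * N))"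
      using e k_le by (intro mult_left_mono add_mono) (auto simp: D_def)
    also have "\<dots> = K * \<epsilon> ^ 3 * exp (3 / 8 * N)"
      unfolding K_def exp_add by (simp add: algebra_simps)
    finally show ?thesis unfolding eqa eqb eqN .
  qed
  moreover have "K \<ge> 0" by (simp add: K_def)
  ultimately show ?thesis by blast
qed

section \<open>Gaussian likelihood-ratio kernels\<close>

text \<open>Since \<open>3 / 8 = 1 / 2 - 1 / 8\<close>, the product with the standard density is a
  multiple of \<open>exp (- x\<^sup>2 / 8)\<close>, the shape of the normal density with standard
  deviation 2.\<close>

lemma integrable_std_normal_exp_square:
  "integrable std_normal_distribution (\<lambda>x. exp (3 / 8 * x\<^sup>2))"
proof -
  have [simp]: "sqrt 8 = 2 * sqrt (2::real)"
    using real_sqrt_mult[of 4 2] by simp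
  have "integrable lborel (\<lambda>x. 2 * normal_density 0 2 x)"
    by (intro integrable_mult_right integrable_normal_density) auto
  also have "(\<lambda>x. 2 * normal_density 0 2 x) = (\<lambda>x. std_normal_density x * exp (3 / 8 * x\<^sup>2))"
    by (intro ext) (simp add: normal_density_def real_sqrt_mult mult.assoc exp_add[symmetric])
  finally show ?thesis
    by (subst integrable_density) auto
qed

lemma integrable_std_gaussian_exp_square:
  assumes "finite L"
  shows "integrable (std_gaussian L) (\<lambda>w. exp (\<Sum>l\<in>L. 3 / 8 * (w l)\<^sup>2))"
proof -
  have "integrable (std_gaussian L) (\<lambda>w. \<Prod>l\<in>L. exp (3 / 8 * (w l)\<^sup>2))"
    by (intro std_gaussian.product_integrable_prod assms integrable_std_normal_exp_square)
  then show ?thesis by (simp add: exp_sum[OF assms])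
qed

lemma abs_integral_le_integral:
  fixes f g :: "'a \<Rightarrow> real"
  assumes "integrable M f" "integrable M g" "\<And>x. x \<in> space M \<Longrightarrow> \<bar>f x\<bar> \<le> g x"
  shows "\<bar>\<integral>x. f x \<partial>M\<bar> \<le> (\<integral>x. g x \<partial>M)"
proof -
  have "\<bar>\<integral>x. f x \<partial>M\<bar> \<le> (\<integral>x. \<bar>f x\<bar> \<partial>M)" by (rule integral_abs_bound)
  also have "\<dots> \<le> (\<integral>x. g x \<partial>M)" using assms by (intro integral_mono integrable_abs)
  finally show ?thesis .
qed

text \<open>Rescaled by \<open>sqrt \<tau>\<close>, a Gaussian of variance \<tau> displaced by \<xi>
  and a Gaussian of variance \<open>\<tau> + 1\<close> have likelihood ratios with respect to the
  standard one whose averaged difference is \<open>O(\<epsilon> ^ 3)\<close> in L1, where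
  \<open>\<epsilon> = 1 / sqrt \<tau>\<close>. Hence the bound involves \<open>u\<close> through its
  supremum \<open>b\<close> alone. The condition \<open>\<tau> \<ge> 2\<close> is
  \<open>\<epsilon>\<^sup>2 \<le> 1 / 2\<close>.\<close>

lemma gaussian_kernel_bound:
  fixes q :: "'t \<Rightarrow> real" and \<xi> :: "'t \<Rightarrow> 'l \<Rightarrow> real"
  assumes L: "finite L" and T: "finite T"
    and q0: "\<And>\<theta>. \<theta> \<in> T \<Longrightarrow> q \<theta> \<ge> 0" and q1: "(\<Sum>\<theta>\<in>T. q \<theta>) = 1"
    and mean: "\<And>l. l \<in> L \<Longrightarrow> (\<Sum>\<theta>\<in>T. q \<theta> * \<xi> \<theta> l) = 0"
    and cov: "\<And>l l'. l \<in> L \<Longrightarrow> l' \<in> L \<Longrightarrow> (\<Sum>\<theta>\<in>T. q \<theta> * (\<xi> \<theta> l * \<xi> \<theta> l')) = (if l = l' then 1 else 0)"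
  shows "\<exists>C\<ge>0. \<forall>\<tau>\<ge>2. \<forall>u\<in>borel_measurable (std_gaussian L). \<forall>b. (\<forall>w. \<bar>u w\<bar> \<le> b) \<longrightarrow>
    \<bar>(\<Sum>\<theta>\<in>T. q \<theta> * (\<integral>w. u (\<lambda>l\<in>L. sqrt \<tau> * w l + \<xi> \<theta> l) \<partial>std_gaussian L))
      - (\<integral>w. u (\<lambda>l\<in>L. sqrt (\<tau> + 1) * w l) \<partial>std_gaussian L)\<bar> \<le> C * b / sqrt \<tau> ^ 3"
proof -
  obtain K where K: "K \<ge> 0" and ratio: "\<And>\<epsilon> w. \<epsilon> > 0 \<Longrightarrow> \<epsilon>\<^sup>2 \<le> 1 / 2 \<Longrightarrow>
    \<bar>(\<Sum>\<theta>\<in>T. q \<theta> * exp (\<Sum>l\<in>L. \<epsilon> * w l * \<xi> \<theta> l - \<epsilon>\<^sup>2 * (\<xi> \<theta> l)\<^sup>2 / 2))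
      - exp (\<Sum>l\<in>L. \<epsilon>\<^sup>2 * (w l)\<^sup>2 / (2 * (1 + \<epsilon>\<^sup>2)) - ln (1 + \<epsilon>\<^sup>2) / 2)\<bar>
    \<le> K * \<epsilon> ^ 3 * exp (\<Sum>l\<in>L. 3 / 8 * (w l)\<^sup>2)"
    using likelihood_ratio_difference_bound[OF L T q0 q1 mean cov] by blast
  interpret G: prob_space "std_gaussian L" by (rule prob_space_std_gaussian)
  define H where "H w = exp (\<Sum>l\<in>L. 3 / 8 * (w l)\<^sup>2)" for w :: "'l \<Rightarrow> real"
  have H: "integrable (std_gaussian L) H"
    unfolding H_def by (rule integrable_std_gaussian_exp_square[OF L])
  have H0: "H w \<ge> 0" for w by (simp add: H_def)
  define J where "J = (\<integral>w. H w \<partial>std_gaussian L)"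
  have J0: "J \<ge> 0" unfolding J_def by (intro integral_nonneg_AE) (simp add: H0)
  have "\<bar>(\<Sum>\<theta>\<in>T. q \<theta> * (\<integral>w. u (\<lambda>l\<in>L. sqrt \<tau> * w l + \<xi> \<theta> l) \<partial>std_gaussian L))
      - (\<integral>w. u (\<lambda>l\<in>L. sqrt (\<tau> + 1) * w l) \<partial>std_gaussian L)\<bar> \<le> (K * J) * b / sqrt \<tau> ^ 3"
    if \<tau>: "\<tau> \<ge> 2" and u[measurable]: "u \<in> borel_measurable (std_gaussian L)" and ub: "\<And>w. \<bar>u w\<bar> \<le> b"
    for \<tau> u b
  proof -
    define \<epsilon> where "\<epsilon> = 1 / sqrt \<tau>"
    have e: "\<epsilon> > 0" "\<epsilon>\<^sup>2 \<le> 1 / 2" "\<epsilon>\<^sup>2 = 1 / \<tau>"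
      using \<tau> by (auto simp: \<epsilon>_def power_divide field_simps)
    define f where "f w = u (\<lambda>l\<in>L. sqrt \<tau> * w l)" for w
    have [measurable]: "(\<lambda>w. \<lambda>l\<in>L. sqrt \<tau> * w l) \<in> measurable (std_gaussian L) (std_gaussian L)"
      by (intro measurable_restrict) measurable
    have f[measurable]: "f \<in> borel_measurable (std_gaussian L)"
      unfolding f_def by measurable
    have fb: "\<bar>f w\<bar> \<le> b" for w by (simp add: f_def ub)
    have b0: "b \<ge> 0" using ub[of undefined] by linarith
    define \<rho> where "\<rho> \<theta> w = exp (\<Sum>l\<in>L. \<epsilon> * w l * \<xi> \<theta> l - \<epsilon>\<^sup>2 * (\<xi> \<theta> l)\<^sup>2 / 2)" for \<theta> w
    define \<sigma> where "\<sigma> w = exp (\<Sum>l\<in>L. \<epsilon>\<^sup>2 * (w l)\<^sup>2 / (2 * (1 + \<epsilon>\<^sup>2)) - ln (1 + \<epsilon>\<^sup>2) / 2)" for w :: "'l \<Rightarrow> real"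
    have [measurable]: "\<rho> \<theta> \<in> borel_measurable (std_gaussian L)" for \<theta>
      unfolding \<rho>_def by measurable
    have [measurable]: "\<sigma> \<in> borel_measurable (std_gaussian L)"
      unfolding \<sigma>_def by measurable
    have shift: "(\<integral>w. u (\<lambda>l\<in>L. sqrt \<tau> * w l + \<xi> \<theta> l) \<partial>std_gaussian L) = (\<integral>w. \<rho> \<theta> w * f w \<partial>std_gaussian L)" for \<theta>
    proof -
      have "(\<integral>w. u (\<lambda>l\<in>L. sqrt \<tau> * w l + \<xi> \<theta> l) \<partial>std_gaussian L)
        = (\<integral>w. f (\<lambda>l\<in>L. 1 * w l + \<epsilon> * \<xi> \<theta> l) \<partial>std_gaussian L)"
        using \<tau> by (simp add: f_def \<epsilon>_def algebra_simps cong: restrict_cong)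
      also have "\<dots> = (\<integral>w. (\<Prod>l\<in>L. exp ((w l)\<^sup>2 / 2 - ((w l - \<epsilon> * \<xi> \<theta> l) / 1)\<^sup>2 / 2) / 1) * f w \<partial>std_gaussian L)"
        by (rule integral_std_gaussian_affine[OF L _ f]) simp
      finally have "(\<integral>w. u (\<lambda>l\<in>L. sqrt \<tau> * w l + \<xi> \<theta> l) \<partial>std_gaussian L) = \<dots>" .
      moreover have "(\<Prod>l\<in>L. exp ((w l)\<^sup>2 / 2 - ((w l - \<epsilon> * \<xi> \<theta> l) / 1)\<^sup>2 / 2) / 1) = \<rho> \<theta> w" for w
        unfolding \<rho>_def exp_sum[OF L]
        by (intro prod.cong refl) (simp add: power2_diff power_mult_distrib diff_divide_distrib add_divide_distrib mult.assoc mult.left_commute)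
      ultimately show ?thesis by (simp only:)
    qed
    have scale: "(\<integral>w. u (\<lambda>l\<in>L. sqrt (\<tau> + 1) * w l) \<partial>std_gaussian L) = (\<integral>w. \<sigma> w * f w \<partial>std_gaussian L)"
    proof -
      have "sqrt (\<tau> + 1) = sqrt \<tau> * sqrt (1 + \<epsilon>\<^sup>2)"
        using \<tau> by (simp add: e real_sqrt_mult[symmetric] field_simps)
      then have "(\<integral>w. u (\<lambda>l\<in>L. sqrt (\<tau> + 1) * w l) \<partial>std_gaussian L)
        = (\<integral>w. f (\<lambda>l\<in>L. sqrt (1 + \<epsilon>\<^sup>2) * w l + 0) \<partial>std_gaussian L)"
        by (simp add: f_def mult.assoc cong: restrict_cong)
      also have "\<dots> = (\<integral>w. (\<Prod>l\<in>L. exp ((w l)\<^sup>2 / 2 - ((w l - 0) / sqrt (1 + \<epsilon>\<^sup>2))\<^sup>2 / 2) / sqrt (1 + \<epsilon>\<^sup>2)) * f w \<partial>std_gaussian L)"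
        by (rule integral_std_gaussian_affine[OF L _ f]) (simp add: add_pos_nonneg)
      finally have "(\<integral>w. u (\<lambda>l\<in>L. sqrt (\<tau> + 1) * w l) \<partial>std_gaussian L) = \<dots>" .
      moreover have "(\<Prod>l\<in>L. exp ((w l)\<^sup>2 / 2 - ((w l - 0) / sqrt (1 + \<epsilon>\<^sup>2))\<^sup>2 / 2) / sqrt (1 + \<epsilon>\<^sup>2)) = \<sigma> w" for w
        unfolding \<sigma>_def exp_sum[OF L]
      proof (intro prod.cong refl)
        fix l
        have pos: "1 + \<epsilon>\<^sup>2 > 0" by (simp add: add_pos_nonneg)
        have "sqrt (1 + \<epsilon>\<^sup>2) = exp (ln (1 + \<epsilon>\<^sup>2) / 2)"
          using pos by (simp add: ln_sqrt[symmetric])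
        moreover have q: "(w l)\<^sup>2 / 2 - ((w l - 0) / sqrt (1 + \<epsilon>\<^sup>2))\<^sup>2 / 2 = \<epsilon>\<^sup>2 * (w l)\<^sup>2 / (2 * (1 + \<epsilon>\<^sup>2))"
          using pos by (simp add: power_divide field_simps)
        ultimately show "exp ((w l)\<^sup>2 / 2 - ((w l - 0) / sqrt (1 + \<epsilon>\<^sup>2))\<^sup>2 / 2) / sqrt (1 + \<epsilon>\<^sup>2)
          = exp (\<epsilon>\<^sup>2 * (w l)\<^sup>2 / (2 * (1 + \<epsilon>\<^sup>2)) - ln (1 + \<epsilon>\<^sup>2) / 2)"
          by (simp only: q exp_diff)
      qed
      ultimately show ?thesis by (simp only:)
    qed
    \<comment> \<open>Domination by a multiple of \<open>H\<close>: completing the square charges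
      \<open>1 / 4\<close> of \<open>(w l)\<^sup>2\<close>, below the available
      \<open>3 / 8\<close>.\<close>
    have int_\<rho>: "integrable (std_gaussian L) (\<lambda>w. \<rho> \<theta> w * f w)" for \<theta>
    proof (rule Bochner_Integration.integrable_bound)
      show "integrable (std_gaussian L) (\<lambda>w. exp (\<Sum>l\<in>L. \<epsilon>\<^sup>2 * (\<xi> \<theta> l)\<^sup>2 / 2) * b * H w)"
        using H by (intro integrable_mult_right)
      show "AE w in std_gaussian L. norm (\<rho> \<theta> w * f w) \<le> norm (exp (\<Sum>l\<in>L. \<epsilon>\<^sup>2 * (\<xi> \<theta> l)\<^sup>2 / 2) * b * H w)"
      proof (rule AE_I2)
        fix w
        have "\<rho> \<theta> w \<le> exp (\<Sum>l\<in>L. \<epsilon>\<^sup>2 * (\<xi> \<theta> l)\<^sup>2 / 2) * H w"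
          unfolding \<rho>_def H_def exp_add[symmetric] sum.distrib[symmetric] exp_le_cancel_iff
        proof (intro sum_mono)
          fix l
          show "\<epsilon> * w l * \<xi> \<theta> l - \<epsilon>\<^sup>2 * (\<xi> \<theta> l)\<^sup>2 / 2 \<le> \<epsilon>\<^sup>2 * (\<xi> \<theta> l)\<^sup>2 / 2 + 3 / 8 * (w l)\<^sup>2"
          proof -
            have "\<epsilon> * w l * \<xi> \<theta> l \<le> \<epsilon>\<^sup>2 * (\<xi> \<theta> l)\<^sup>2 + (w l)\<^sup>2 / 4"
              using zero_le_power2[of "\<epsilon> * \<xi> \<theta> l - w l / 2"]
              unfolding power2_diff power_mult_distrib power_divide by (simp add: mult_ac)
            then show ?thesis using zero_le_power2[of "w l"] by linarith
          qed
        qed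
        then have "\<rho> \<theta> w * \<bar>f w\<bar> \<le> (exp (\<Sum>l\<in>L. \<epsilon>\<^sup>2 * (\<xi> \<theta> l)\<^sup>2 / 2) * H w) * b"
          using fb H0 by (intro mult_mono) auto
        then show "norm (\<rho> \<theta> w * f w) \<le> norm (exp (\<Sum>l\<in>L. \<epsilon>\<^sup>2 * (\<xi> \<theta> l)\<^sup>2 / 2) * b * H w)"
          using b0 H0 by (simp add: abs_mult \<rho>_def mult_ac)
      qed
    qed measurable
    have int_\<sigma>: "integrable (std_gaussian L) (\<lambda>w. \<sigma> w * f w)"
    proof (rule Bochner_Integration.integrable_bound)
      show "integrable (std_gaussian L) (\<lambda>w. b * H w)"
        using H by (intro integrable_mult_right)
      show "AE w in std_gaussian L. norm (\<sigma> w * f w) \<le> norm (b * H w)"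
      proof (rule AE_I2)
        fix w
        have "\<sigma> w \<le> H w"
          unfolding \<sigma>_def H_def exp_le_cancel_iff
        proof (intro sum_mono)
          fix l
          have "\<epsilon>\<^sup>2 * (w l)\<^sup>2 / (2 * (1 + \<epsilon>\<^sup>2)) \<le> \<epsilon>\<^sup>2 * (w l)\<^sup>2 / 2"
            by (intro divide_left_mono) (auto simp: add_pos_nonneg)
          also have "\<dots> \<le> 3 / 8 * (w l)\<^sup>2"
            using mult_right_mono[OF e(2), of "(w l)\<^sup>2"] zero_le_power2[of "w l"] by linarith
          finally have "\<epsilon>\<^sup>2 * (w l)\<^sup>2 / (2 * (1 + \<epsilon>\<^sup>2)) \<le> 3 / 8 * (w l)\<^sup>2" .
          moreover have "0 \<le> ln (1 + \<epsilon>\<^sup>2)" by (intro ln_ge_zero) simp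
          ultimately show "\<epsilon>\<^sup>2 * (w l)\<^sup>2 / (2 * (1 + \<epsilon>\<^sup>2)) - ln (1 + \<epsilon>\<^sup>2) / 2 \<le> 3 / 8 * (w l)\<^sup>2"
            by linarith
        qed
        then have "\<sigma> w * \<bar>f w\<bar> \<le> H w * b"
          using fb H0 by (intro mult_mono) auto
        then show "norm (\<sigma> w * f w) \<le> norm (b * H w)"
          using b0 H0 by (simp add: abs_mult \<sigma>_def mult_ac)
      qed
    qed measurable
    have "(\<Sum>\<theta>\<in>T. q \<theta> * (\<integral>w. u (\<lambda>l\<in>L. sqrt \<tau> * w l + \<xi> \<theta> l) \<partial>std_gaussian L))
      - (\<integral>w. u (\<lambda>l\<in>L. sqrt (\<tau> + 1) * w l) \<partial>std_gaussian L)
      = (\<integral>w. (\<Sum>\<theta>\<in>T. q \<theta> * (\<rho> \<theta> w * f w)) - \<sigma> w * f w \<partial>std_gaussian L)"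
      unfolding shift scale using int_\<rho> int_\<sigma> by simp
    also have "\<bar>\<dots>\<bar> \<le> (\<integral>w. (K * \<epsilon> ^ 3 * b) * H w \<partial>std_gaussian L)"
    proof (rule abs_integral_le_integral)
      show "integrable (std_gaussian L) (\<lambda>w. (\<Sum>\<theta>\<in>T. q \<theta> * (\<rho> \<theta> w * f w)) - \<sigma> w * f w)"
        using int_\<rho> int_\<sigma> by (intro Bochner_Integration.integrable_diff Bochner_Integration.integrable_sum integrable_mult_right)
      show "integrable (std_gaussian L) (\<lambda>w. (K * \<epsilon> ^ 3 * b) * H w)"
        using H by (intro integrable_mult_right)
      fix w
      have "(\<Sum>\<theta>\<in>T. q \<theta> * (\<rho> \<theta> w * f w)) - \<sigma> w * f w = ((\<Sum>\<theta>\<in>T. q \<theta> * \<rho> \<theta> w) - \<sigma> w) * f w"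
        by (simp add: left_diff_distrib sum_distrib_right mult.assoc)
      also have "\<bar>\<dots>\<bar> \<le> (K * \<epsilon> ^ 3 * H w) * b"
        unfolding abs_mult using ratio[OF e(1,2), of w] fb K e H0
        by (intro mult_mono) (auto simp: \<rho>_def \<sigma>_def H_def)
      finally show "\<bar>(\<Sum>\<theta>\<in>T. q \<theta> * (\<rho> \<theta> w * f w)) - \<sigma> w * f w\<bar> \<le> K * \<epsilon> ^ 3 * b * H w"
        by (simp add: mult_ac)
    qed
    also have "\<dots> = (K * J) * b / sqrt \<tau> ^ 3"
      by (simp add: J_def \<epsilon>_def power_divide)
    finally show ?thesis .
  qed
  then show ?thesis using K J0 by (intro exI[of _ "K * J"]) auto
qed

section \<open>Uniqueness of orthant probabilities\<close>

text \<open>Levy's uniqueness theorem for the push-forwards under \<open>Y\<close> and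
  \<open>Y'\<close> of the measures weighted by \<open>q\<close> and \<open>q'\<close>. At
  \<open>s = 0\<close> the hypothesis equates the total masses, so one constant normalises both, and
  \<open>1 \<le> q\<close> keeps it positive. The weights will carry the other coordinates of a
  vector, so that the one-dimensional theorem suffices.\<close>

lemma weighted_tail_eq_of_char_eq:
  fixes q Y :: "'a \<Rightarrow> real" and q' Y' :: "'b \<Rightarrow> real"
  assumes "prob_space M" "prob_space M'"
    and meas [measurable]: "q \<in> borel_measurable M" "Y \<in> borel_measurable M"
      "q' \<in> borel_measurable M'" "Y' \<in> borel_measurable M'"
    and q: "\<And>x. 1 \<le> q x" "\<And>x. q x \<le> b" and q': "\<And>x. 1 \<le> q' x" "\<And>x. q' x \<le> b"
    and char_eq: "\<And>s. (CLINT x|M. of_real (q x) * iexp (s * Y x)) = (CLINT x|M'. of_real (q' x) * iexp (s * Y' x))"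
  shows "(\<integral>x. q x * indicator {a..} (Y x) \<partial>M) = (\<integral>x. q' x * indicator {a..} (Y' x) \<partial>M')"
proof -
  interpret M: prob_space M by fact
  interpret M': prob_space M' by fact
  define \<kappa> where "\<kappa> = (\<integral>x. q x \<partial>M)"
  define \<kappa>' where "\<kappa>' = (\<integral>x. q' x \<partial>M')"
  have pos: "q x > 0" "q' y > 0" for x y
    using q(1)[of x] q'(1)[of y] by linarith+
  have int_q: "integrable M q"
    using q by (intro M.integrable_const_bound[where B=b] AE_I2) (auto simp: abs_of_pos pos)
  have int_q': "integrable M' q'"
    using q' by (intro M'.integrable_const_bound[where B=b] AE_I2) (auto simp: abs_of_pos pos)
  have "complex_of_real \<kappa> = complex_of_real \<kappa>'"
    using char_eq[of 0] unfolding \<kappa>_def \<kappa>'_def by simp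
  then have \<kappa>_eq: "\<kappa>' = \<kappa>" by simp
  have \<kappa>: "\<kappa> \<ge> 1"
    unfolding \<kappa>_def using integral_mono[OF M.integrable_const int_q, of 1] q by (simp add: M.prob_space)
  define N where "N = distr (density M (\<lambda>x. ennreal (q x / \<kappa>))) borel Y"
  define N' where "N' = distr (density M' (\<lambda>x. ennreal (q' x / \<kappa>))) borel Y'"
  have "(\<integral>\<^sup>+x. ennreal (q x / \<kappa>) \<partial>M) = ennreal (\<integral>x. q x / \<kappa> \<partial>M)"
    using int_q pos \<kappa> by (intro nn_integral_eq_integral) (auto intro!: AE_I2 divide_nonneg_nonneg less_imp_le)
  then have "prob_space (density M (\<lambda>x. ennreal (q x / \<kappa>)))"
    using \<kappa> by (intro prob_spaceI) (simp add: emeasure_density \<kappa>_def[symmetric])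
  then have N: "real_distribution N"
    unfolding N_def by (intro prob_space.real_distribution_distr) auto
  have "(\<integral>\<^sup>+x. ennreal (q' x / \<kappa>) \<partial>M') = ennreal (\<integral>x. q' x / \<kappa> \<partial>M')"
    using int_q' pos \<kappa> by (intro nn_integral_eq_integral) (auto intro!: AE_I2 divide_nonneg_nonneg less_imp_le)
  then have "prob_space (density M' (\<lambda>x. ennreal (q' x / \<kappa>)))"
    using \<kappa> by (intro prob_spaceI) (simp add: emeasure_density \<kappa>'_def[symmetric] \<kappa>_eq)
  then have N': "real_distribution N'"
    unfolding N'_def by (intro prob_space.real_distribution_distr) auto
  have int_N: "(\<integral>y. f y \<partial>N) = (\<integral>x. (q x / \<kappa>) *\<^sub>R f (Y x) \<partial>M)"
    if [measurable]: "f \<in> borel_measurable borel" for f :: "real \<Rightarrow> 'c::{banach,second_countable_topology}"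
    unfolding N_def using pos \<kappa>
    by (subst integral_distr) (auto intro!: integral_density AE_I2 divide_nonneg_nonneg less_imp_le)
  have int_N': "(\<integral>y. f y \<partial>N') = (\<integral>x. (q' x / \<kappa>) *\<^sub>R f (Y' x) \<partial>M')"
    if [measurable]: "f \<in> borel_measurable borel" for f :: "real \<Rightarrow> 'c::{banach,second_countable_topology}"
    unfolding N'_def using pos \<kappa>
    by (subst integral_distr) (auto intro!: integral_density AE_I2 divide_nonneg_nonneg less_imp_le)
  have "char N = char N'"
  proof
    fix s
    have "char N s = (CLINT x|M. of_real (q x) * iexp (s * Y x)) / of_real \<kappa>"
      unfolding char_def by (subst int_N) (auto simp: scaleR_conv_of_real)
    also have "\<dots> = (CLINT x|M'. of_real (q' x) * iexp (s * Y' x)) / of_real \<kappa>"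
      unfolding char_eq ..
    also have "\<dots> = char N' s"
      unfolding char_def by (subst int_N') (auto simp: scaleR_conv_of_real)
    finally show "char N s = char N' s" .
  qed
  then have "N = N'" by (rule Levy_uniqueness[OF N N'])
  then have "(\<integral>y. indicator {a..} y \<partial>N) = (\<integral>y. indicator {a..} y \<partial>N' :: real)" by simp
  then have "(\<integral>x. (q x * indicator {a..} (Y x)) / \<kappa> \<partial>M) = (\<integral>x. (q' x * indicator {a..} (Y' x)) / \<kappa> \<partial>M')"
    by (subst (asm) int_N, simp, subst (asm) int_N', simp) (simp add: divide_inverse mult_ac)
  then show ?thesis using \<kappa> by simp
qed

text \<open>Half-lines are brought in one coordinate at a time: by induction on \<open>J\<close> the
  characteristic functions still agree after weighting by the indicators \<open>F J\<close>. To add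
  a coordinate through \<open>weighted_tail_eq_of_char_eq\<close> the weight must be positive, hence
  \<open>2 + F J x * cos (\<theta> t x + c)\<close>, which lies between 1 and 3 and is a combination
  of exponentials covered by the induction hypothesis. At \<open>J = I\<close> and
  \<open>t = 0\<close> the orthant probabilities remain.\<close>

lemma orthant_prob_eq_of_char_eq:
  fixes Z :: "'i \<Rightarrow> 'a \<Rightarrow> real" and Z' :: "'i \<Rightarrow> 'b \<Rightarrow> real"
  assumes M: "prob_space M" and M': "prob_space M'" and I: "finite I"
    and meas [measurable]: "\<And>i. Z i \<in> borel_measurable M" "\<And>i. Z' i \<in> borel_measurable M'"
    and char_eq: "\<And>t. (CLINT x|M. iexp (\<Sum>i\<in>I. t i * Z i x)) = (CLINT x|M'. iexp (\<Sum>i\<in>I. t i * Z' i x))"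
  shows "measure M {x \<in> space M. \<forall>i\<in>I. a i \<le> Z i x} = measure M' {x \<in> space M'. \<forall>i\<in>I. a i \<le> Z' i x}"
proof -
  interpret M: prob_space M by fact
  interpret M': prob_space M' by fact
  define F where "F J x = (\<Prod>i\<in>J. indicator {a i..} (Z i x) :: real)" for J x
  define F' where "F' J x = (\<Prod>i\<in>J. indicator {a i..} (Z' i x) :: real)" for J x
  define \<theta> where "\<theta> t x = (\<Sum>i\<in>I. t i * Z i x)" for t x
  define \<theta>' where "\<theta>' t x = (\<Sum>i\<in>I. t i * Z' i x)" for t x
  have [measurable]: "F J \<in> borel_measurable M" "F' J \<in> borel_measurable M'" for J
    unfolding F_def F'_def by measurable
  have [measurable]: "\<theta> t \<in> borel_measurable M" "\<theta>' t \<in> borel_measurable M'" for t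
    unfolding \<theta>_def \<theta>'_def by measurable
  have F: "0 \<le> F J x" "F J x \<le> 1" for J x
    unfolding F_def by (auto intro!: prod_nonneg prod_le_1 simp: indicator_def)
  have F': "0 \<le> F' J x" "F' J x \<le> 1" for J x
    unfolding F'_def by (auto intro!: prod_nonneg prod_le_1 simp: indicator_def)
  have int: "integrable M (\<lambda>x. complex_of_real (F J x) * iexp (\<theta> t x))" for J t
    using F by (intro M.integrable_const_bound[where B=1] AE_I2) (auto simp: norm_mult)
  have int': "integrable M' (\<lambda>x. complex_of_real (F' J x) * iexp (\<theta>' t x))" for J t
    using F' by (intro M'.integrable_const_bound[where B=1] AE_I2) (auto simp: norm_mult)
  have "J \<subseteq> I \<Longrightarrow> \<forall>t. (CLINT x|M. of_real (F J x) * iexp (\<theta> t x)) = (CLINT x|M'. of_real (F' J x) * iexp (\<theta>' t x))" for J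
  proof (induction J rule: infinite_finite_induct)
    case (infinite J)
    then show ?case using I finite_subset by blast
  next
    case empty
    show ?case using char_eq by (simp add: F_def F'_def \<theta>_def \<theta>'_def)
  next
    case (insert j J)
    then have IH: "(CLINT x|M. of_real (F J x) * iexp (\<theta> t x)) = (CLINT x|M'. of_real (F' J x) * iexp (\<theta>' t x))" for t
      by simp
    have j: "j \<in> I" using insert by simp
    have base: "(CLINT x|M. iexp (\<theta> t x)) = (CLINT x|M'. iexp (\<theta>' t x))" for t
      using char_eq by (simp add: \<theta>_def \<theta>'_def)
    define e where "e s i = (if i = j then s else 0 :: real)" for s i
    have \<theta>_e: "\<theta> (e s) x = s * Z j x" for s x
      unfolding \<theta>_def e_def using j I by (simp add: if_distrib[of "\<lambda>u. u * _"] cong: if_cong)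
    have \<theta>'_e: "\<theta>' (e s) x = s * Z' j x" for s x
      unfolding \<theta>'_def e_def using j I by (simp add: if_distrib[of "\<lambda>u. u * _"] cong: if_cong)
    have \<theta>_add: "\<theta> (\<lambda>i. t i + u i) x = \<theta> t x + \<theta> u x" "\<theta> (\<lambda>i. - t i) x = - \<theta> t x" for t u x
      by (simp_all add: \<theta>_def sum.distrib sum_negf ring_distribs)
    have \<theta>'_add: "\<theta>' (\<lambda>i. t i + u i) x = \<theta>' t x + \<theta>' u x" "\<theta>' (\<lambda>i. - t i) x = - \<theta>' t x" for t u x
      by (simp_all add: \<theta>'_def sum.distrib sum_negf ring_distribs)
    have F_insert: "F (insert j J) x = F J x * indicator {a j..} (Z j x)" for x
      using insert by (simp add: F_def mult.commute)
    have F'_insert: "F' (insert j J) x = F' J x * indicator {a j..} (Z' j x)" for x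
      using insert by (simp add: F'_def mult.commute)
    have cos_eq: "(\<integral>x. F (insert j J) x * cos (\<theta> t x + c) \<partial>M) = (\<integral>x. F' (insert j J) x * cos (\<theta>' t x + c) \<partial>M')" for t c
    proof -
      have exp_cos: "complex_of_real (2 + f * cos (p + c)) * iexp r
        = 2 * iexp r + iexp c / 2 * (of_real f * iexp (p + r)) + iexp (- c) / 2 * (of_real f * iexp (- p + r))" for f p r
      proof -
        have "complex_of_real (cos (p + c)) = (iexp (p + c) + iexp (- (p + c))) / 2"
          by (simp add: cos_of_real[symmetric] cos_exp_eq algebra_simps)
        then show ?thesis by (simp add: exp_add[symmetric] algebra_simps add_divide_distrib)
      qed
      have *: "(\<integral>x. (2 + F J x * cos (\<theta> t x + c)) * indicator {a j..} (Z j x) \<partial>M)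
        = (\<integral>x. (2 + F' J x * cos (\<theta>' t x + c)) * indicator {a j..} (Z' j x) \<partial>M')"
      proof (rule weighted_tail_eq_of_char_eq[OF M M', where b=3])
        have 1: "\<bar>F J x * cos (\<theta> t x + c)\<bar> \<le> 1" for x
          using F[of J x] by (simp add: abs_mult mult_le_one)
        have 2: "\<bar>F' J x * cos (\<theta>' t x + c)\<bar> \<le> 1" for x
          using F'[of J x] by (simp add: abs_mult mult_le_one)
        show "1 \<le> 2 + F J x * cos (\<theta> t x + c)" "2 + F J x * cos (\<theta> t x + c) \<le> 3" for x
          using 1[of x] by linarith+
        show "1 \<le> 2 + F' J x * cos (\<theta>' t x + c)" "2 + F' J x * cos (\<theta>' t x + c) \<le> 3" for x
          using 2[of x] by linarith+
        fix s
        have "(CLINT x|M. of_real (2 + F J x * cos (\<theta> t x + c)) * iexp (s * Z j x))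
          = (CLINT x|M. 2 * (of_real (F {} x) * iexp (\<theta> (e s) x)) + iexp c / 2 * (of_real (F J x) * iexp (\<theta> (\<lambda>i. t i + e s i) x))
              + iexp (- c) / 2 * (of_real (F J x) * iexp (\<theta> (\<lambda>i. - t i + e s i) x)))"
          unfolding exp_cos \<theta>_add \<theta>_e by (simp add: F_def)
        also have "\<dots> = 2 * (CLINT x|M. of_real (F {} x) * iexp (\<theta> (e s) x)) + iexp c / 2 * (CLINT x|M. of_real (F J x) * iexp (\<theta> (\<lambda>i. t i + e s i) x))
              + iexp (- c) / 2 * (CLINT x|M. of_real (F J x) * iexp (\<theta> (\<lambda>i. - t i + e s i) x))"
          by (subst Bochner_Integration.integral_add, (intro Bochner_Integration.integrable_add integrable_mult_right int)+)+
             (simp only: integral_mult_right_zero)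
        also have "\<dots> = 2 * (CLINT x|M'. of_real (F' {} x) * iexp (\<theta>' (e s) x)) + iexp c / 2 * (CLINT x|M'. of_real (F' J x) * iexp (\<theta>' (\<lambda>i. t i + e s i) x))
              + iexp (- c) / 2 * (CLINT x|M'. of_real (F' J x) * iexp (\<theta>' (\<lambda>i. - t i + e s i) x))"
          unfolding IH using base by (simp add: F_def F'_def)
        also have "\<dots> = (CLINT x|M'. 2 * (of_real (F' {} x) * iexp (\<theta>' (e s) x)) + iexp c / 2 * (of_real (F' J x) * iexp (\<theta>' (\<lambda>i. t i + e s i) x))
              + iexp (- c) / 2 * (of_real (F' J x) * iexp (\<theta>' (\<lambda>i. - t i + e s i) x)))"
          by (subst Bochner_Integration.integral_add, (intro Bochner_Integration.integrable_add integrable_mult_right int')+)+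
             (simp only: integral_mult_right_zero)
        also have "\<dots> = (CLINT x|M'. of_real (2 + F' J x * cos (\<theta>' t x + c)) * iexp (s * Z' j x))"
          unfolding exp_cos \<theta>'_add \<theta>'_e by (simp add: F'_def)
        finally show "(CLINT x|M. of_real (2 + F J x * cos (\<theta> t x + c)) * iexp (s * Z j x))
          = (CLINT x|M'. of_real (2 + F' J x * cos (\<theta>' t x + c)) * iexp (s * Z' j x))" .
      qed auto
      \<comment> \<open>The case of the constant weight 1; subtracting it twice from
        \<open>*\<close> isolates the cosine part.\<close>
      have **: "(\<integral>x. 1 * indicator {a j..} (Z j x) \<partial>M) = (\<integral>x. 1 * indicator {a j..} (Z' j x) \<partial>M' :: real)"
        using base[of "e _"] by (intro weighted_tail_eq_of_char_eq[OF M M', where b=1]) (auto simp: \<theta>_e \<theta>'_e)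
      have "integrable M (\<lambda>x. indicator {a j..} (Z j x) :: real)"
        by (intro M.integrable_const_bound[where B=1] AE_I2) (auto simp: indicator_def)
      moreover have "integrable M (\<lambda>x. F (insert j J) x * cos (\<theta> t x + c))"
        using F by (intro M.integrable_const_bound[where B=1] AE_I2) (auto simp: abs_mult mult_le_one)
      ultimately have "(\<integral>x. (2 + F J x * cos (\<theta> t x + c)) * indicator {a j..} (Z j x) \<partial>M)
        = 2 * (\<integral>x. 1 * indicator {a j..} (Z j x) \<partial>M) + (\<integral>x. F (insert j J) x * cos (\<theta> t x + c) \<partial>M)"
        by (subst Bochner_Integration.integral_mult_right_zero[symmetric], subst Bochner_Integration.integral_add[symmetric])
           (auto simp: F_insert algebra_simps)
      moreover have "integrable M' (\<lambda>x. indicator {a j..} (Z' j x) :: real)"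
        by (intro M'.integrable_const_bound[where B=1] AE_I2) (auto simp: indicator_def)
      moreover have "integrable M' (\<lambda>x. F' (insert j J) x * cos (\<theta>' t x + c))"
        using F' by (intro M'.integrable_const_bound[where B=1] AE_I2) (auto simp: abs_mult mult_le_one)
      ultimately have "(\<integral>x. (2 + F' J x * cos (\<theta>' t x + c)) * indicator {a j..} (Z' j x) \<partial>M')
        = 2 * (\<integral>x. 1 * indicator {a j..} (Z' j x) \<partial>M') + (\<integral>x. F' (insert j J) x * cos (\<theta>' t x + c) \<partial>M')"
        by (subst Bochner_Integration.integral_mult_right_zero[symmetric], subst Bochner_Integration.integral_add[symmetric])
           (auto simp: F'_insert algebra_simps)
      then show ?thesis using * ** \<open>_ = 2 * (\<integral>x. 1 * indicator {a j..} (Z j x) \<partial>M) + _\<close> by simp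
    qed
    \<comment> \<open>The phases \<open>c = 0\<close> and \<open>c = - pi / 2\<close> recover cosine
      and sine, hence the complex exponential.\<close>
    have iexp_cos: "complex_of_real f * iexp p = of_real (f * cos (p + 0)) + \<i> * of_real (f * cos (p + - pi / 2))" for f p
      by (simp add: exp_Euler cos_diff cos_of_real sin_of_real algebra_simps cos_add)
    show ?case
    proof
      fix t
      have "integrable M (\<lambda>x. complex_of_real (F (insert j J) x * cos (\<theta> t x + c)))" for c
        using F by (intro M.integrable_const_bound[where B=1] AE_I2) (auto simp: abs_mult norm_mult mult_le_one)
      then have "(CLINT x|M. of_real (F (insert j J) x) * iexp (\<theta> t x))
        = of_real (\<integral>x. F (insert j J) x * cos (\<theta> t x + 0) \<partial>M) + \<i> * of_real (\<integral>x. F (insert j J) x * cos (\<theta> t x + - pi / 2) \<partial>M)"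
        unfolding iexp_cos
        by (subst Bochner_Integration.integral_add) (simp_all only: integrable_mult_right integral_complex_of_real integral_mult_right_zero)
      also have "\<dots> = of_real (\<integral>x. F' (insert j J) x * cos (\<theta>' t x + 0) \<partial>M') + \<i> * of_real (\<integral>x. F' (insert j J) x * cos (\<theta>' t x + - pi / 2) \<partial>M')"
        unfolding cos_eq ..
      also have "integrable M' (\<lambda>x. complex_of_real (F' (insert j J) x * cos (\<theta>' t x + c)))" for c
        using F' by (intro M'.integrable_const_bound[where B=1] AE_I2) (auto simp: abs_mult norm_mult mult_le_one)
      then have "of_real (\<integral>x. F' (insert j J) x * cos (\<theta>' t x + 0) \<partial>M') + \<i> * of_real (\<integral>x. F' (insert j J) x * cos (\<theta>' t x + - pi / 2) \<partial>M')
        = (CLINT x|M'. of_real (F' (insert j J) x) * iexp (\<theta>' t x))"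
        unfolding iexp_cos
        by (subst Bochner_Integration.integral_add) (simp_all only: integrable_mult_right integral_complex_of_real integral_mult_right_zero)
      finally show "(CLINT x|M. of_real (F (insert j J) x) * iexp (\<theta> t x)) = (CLINT x|M'. of_real (F' (insert j J) x) * iexp (\<theta>' t x))" .
    qed
  qed
  from this[of I] have "(CLINT x|M. of_real (F I x) * iexp (\<theta> (\<lambda>_. 0) x)) = (CLINT x|M'. of_real (F' I x) * iexp (\<theta>' (\<lambda>_. 0) x))"
    by simp
  then have "complex_of_real (\<integral>x. F I x \<partial>M) = of_real (\<integral>x. F' I x \<partial>M')"
    by (simp add: \<theta>_def \<theta>'_def)
  then have eq: "(\<integral>x. F I x \<partial>M) = (\<integral>x. F' I x \<partial>M')"
    by simp
  have "(\<integral>x. F I x \<partial>M) = (\<integral>x. indicator {x \<in> space M. \<forall>i\<in>I. a i \<le> Z i x} x \<partial>M)"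
    using I by (intro Bochner_Integration.integral_cong refl) (auto simp: F_def indicator_def prod_zero_iff)
  moreover have "(\<integral>x. F' I x \<partial>M') = (\<integral>x. indicator {x \<in> space M'. \<forall>i\<in>I. a i \<le> Z' i x} x \<partial>M')"
    using I by (intro Bochner_Integration.integral_cong refl) (auto simp: F'_def indicator_def prod_zero_iff)
  ultimately show ?thesis using eq by (simp add: Int_def conj_commute)
qed

lemma char_std_gaussian:
  assumes "finite L"
  shows "(CLINT w|std_gaussian L. iexp (\<Sum>l\<in>L. c l * w l)) = of_real (exp (- (\<Sum>l\<in>L. (c l)\<^sup>2) / 2))"
proof -
  have "(CLINT w|std_gaussian L. iexp (\<Sum>l\<in>L. c l * w l)) = (CLINT w|std_gaussian L. \<Prod>l\<in>L. iexp (c l * w l))"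
    by (intro Bochner_Integration.integral_cong refl) (simp add: exp_sum[OF assms, symmetric] sum_distrib_left)
  also have "\<dots> = (\<Prod>l\<in>L. CLINT x|std_normal_distribution. iexp (c l * x))"
  proof (intro std_gaussian.product_integral_prod assms)
    show "integrable std_normal_distribution (\<lambda>x. iexp (c l * x))" for l
      by (intro std_normal.integrable_const_bound[where B=1] AE_I2) auto
  qed
  also have "\<dots> = (\<Prod>l\<in>L. of_real (exp (- (c l)\<^sup>2 / 2)))"
    using fun_cong[OF char_std_normal_distribution] by (simp add: char_def)
  also have "\<dots> = of_real (exp (\<Sum>l\<in>L. - (c l)\<^sup>2 / 2))"
    by (simp only: of_real_prod exp_sum[OF assms])
  finally show ?thesis by (simp add: sum_negf sum_divide_distrib)
qed

lemma sum_linear_form: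
  fixes t :: "'i \<Rightarrow> real"
  shows "(\<Sum>i\<in>I. t i * (\<Sum>l\<in>L. A i l * w l)) = (\<Sum>l\<in>L. (\<Sum>i\<in>I. t i * A i l) * w l)"
  unfolding sum_distrib_left sum_distrib_right by (subst sum.swap) (simp add: mult.assoc)

lemma sum_square_linear_form:
  fixes t :: "'i \<Rightarrow> real"
  shows "(\<Sum>l\<in>L. (\<Sum>i\<in>I. t i * A i l)\<^sup>2) = (\<Sum>i\<in>I. \<Sum>j\<in>I. t i * t j * (\<Sum>l\<in>L. A i l * A j l))"
proof -
  have "(\<Sum>l\<in>L. (\<Sum>i\<in>I. t i * A i l)\<^sup>2) = (\<Sum>l\<in>L. \<Sum>i\<in>I. \<Sum>j\<in>I. t i * t j * (A i l * A j l))"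
    unfolding power2_eq_square sum_product by (simp add: mult_ac)
  also have "\<dots> = (\<Sum>i\<in>I. \<Sum>j\<in>I. \<Sum>l\<in>L. t i * t j * (A i l * A j l))"
    by (subst sum.swap, intro sum.cong refl, subst sum.swap) simp
  finally show ?thesis by (simp add: sum_distrib_left)
qed

text \<open>\<open>L\<close> and \<open>L'\<close> may differ in type and size: one factor will be
  indexed by symbols, the other by the unknown representation behind
  \<open>gaussian_law\<close>.\<close>

lemma gaussian_orthant_prob_eq_of_gram_eq:
  fixes A :: "'i \<Rightarrow> 'l \<Rightarrow> real" and A' :: "'i \<Rightarrow> 'm \<Rightarrow> real"
  assumes fin: "finite L" "finite L'" "finite I"
    and gram: "\<And>i j. i \<in> I \<Longrightarrow> j \<in> I \<Longrightarrow> (\<Sum>l\<in>L. A i l * A j l) = (\<Sum>l\<in>L'. A' i l * A' j l)"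
  shows "measure (std_gaussian L) {w \<in> space (std_gaussian L). \<forall>i\<in>I. x i \<le> (\<Sum>l\<in>L. A i l * w l)}
    = measure (std_gaussian L') {w \<in> space (std_gaussian L'). \<forall>i\<in>I. x i \<le> (\<Sum>l\<in>L'. A' i l * w l)}"
proof (rule orthant_prob_eq_of_char_eq)
  fix t
  have "(\<Sum>i\<in>I. \<Sum>j\<in>I. t i * t j * (\<Sum>l\<in>L. A i l * A j l)) = (\<Sum>i\<in>I. \<Sum>j\<in>I. t i * t j * (\<Sum>l\<in>L'. A' i l * A' j l))"
    using gram by simp
  then show "(CLINT w|std_gaussian L. iexp (\<Sum>i\<in>I. t i * (\<Sum>l\<in>L. A i l * w l)))
    = (CLINT w|std_gaussian L'. iexp (\<Sum>i\<in>I. t i * (\<Sum>l\<in>L'. A' i l * w l)))"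
    unfolding sum_linear_form char_std_gaussian[OF fin(1)] char_std_gaussian[OF fin(2)] sum_square_linear_form
    by simp
qed (auto intro!: prob_space_std_gaussian fin)

section \<open>Gaussian orthant probabilities: semigroup property and modulus of continuity\<close>

text \<open>The parameter \<open>t\<close> is the variance, equal to the number of summands in
  comparisons with a walk. At \<open>t = 0\<close> the law is the point mass at 0 and the value is
  the indicator of \<open>x \<le> 0\<close> on \<open>I\<close>. Working with a factor
  \<open>A\<close> admits singular covariances.\<close>

definition gaussian_orthant :: "'l set \<Rightarrow> 'i set \<Rightarrow> ('i \<Rightarrow> 'l \<Rightarrow> real) \<Rightarrow> real \<Rightarrow> ('i \<Rightarrow> real) \<Rightarrow> real" where
  "gaussian_orthant L I A t x = measure (std_gaussian L)
     {w \<in> space (std_gaussian L). \<forall>i\<in>I. x i \<le> sqrt t * (\<Sum>l\<in>L. A i l * w l)}"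

lemma gaussian_orthant_bounds: "0 \<le> gaussian_orthant L I A t x" "gaussian_orthant L I A t x \<le> 1"
  unfolding gaussian_orthant_def using prob_space.prob_le_1[OF prob_space_std_gaussian] by auto

lemma gaussian_orthant_cong:
  "(\<And>i. i \<in> I \<Longrightarrow> x i = y i) \<Longrightarrow> gaussian_orthant L I A t x = gaussian_orthant L I A t y"
  unfolding gaussian_orthant_def by (intro arg_cong[where f="measure _"]) auto

lemma gaussian_orthant_antimono:
  assumes "finite I" and le: "\<And>i. i \<in> I \<Longrightarrow> x i \<le> y i"
  shows "gaussian_orthant L I A t y \<le> gaussian_orthant L I A t x"
proof -
  interpret prob_space "std_gaussian L" by (rule prob_space_std_gaussian)
  have [measurable]: "finite I" by fact
  show ?thesis
    unfolding gaussian_orthant_def by (intro finite_measure_mono) (auto intro: order_trans[OF le])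
qed

text \<open>Written as an integral of indicators, the measure of the moving orthant becomes a
  parametrised integral, and such integrals are measurable in the parameter.\<close>

lemma measurable_gaussian_orthant [measurable]:
  assumes [measurable]: "\<And>i. f i \<in> borel_measurable N" and I: "finite I"
  shows "(\<lambda>w. gaussian_orthant L I A t (\<lambda>i. f i w)) \<in> borel_measurable N"
proof -
  interpret prob_space "std_gaussian L" by (rule prob_space_std_gaussian)
  have "gaussian_orthant L I A t x = (\<integral>w. (\<Prod>i\<in>I. indicator {x i..} (sqrt t * (\<Sum>l\<in>L. A i l * w l))) \<partial>std_gaussian L)" for x
  proof -
    have "gaussian_orthant L I A t x = (\<integral>w. indicator {w \<in> space (std_gaussian L). \<forall>i\<in>I. x i \<le> sqrt t * (\<Sum>l\<in>L. A i l * w l)} w \<partial>std_gaussian L)"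
      unfolding gaussian_orthant_def by (simp add: Int_def conj_commute)
    also have "\<dots> = (\<integral>w. (\<Prod>i\<in>I. indicator {x i..} (sqrt t * (\<Sum>l\<in>L. A i l * w l))) \<partial>std_gaussian L)"
      using I by (intro Bochner_Integration.integral_cong refl) (auto simp: indicator_def prod_zero_iff)
    finally show ?thesis .
  qed
  moreover have "(\<lambda>w. \<integral>v. (\<Prod>i\<in>I. if f i w \<le> sqrt t * (\<Sum>l\<in>L. A i l * v l) then 1 else 0 :: real) \<partial>std_gaussian L) \<in> borel_measurable N"
    by measurable
  ultimately show ?thesis by (simp add: indicator_def of_bool_def cong: if_cong)
qed

text \<open>Independent Gaussian vectors of variances \<open>t\<close> and \<open>s\<close> add up
  to one of variance \<open>s + t\<close>: the characteristic functions agree, and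
  \<open>orthant_prob_eq_of_char_eq\<close> transfers this to orthants.\<close>

lemma gaussian_orthant_semigroup:
  assumes fin: "finite L" "finite I" and st: "s \<ge> 0" "t \<ge> 0"
  shows "(\<integral>w. gaussian_orthant L I A s (\<lambda>i. x i - sqrt t * (\<Sum>l\<in>L. A i l * w l)) \<partial>std_gaussian L)
    = gaussian_orthant L I A (s + t) x"
proof -
  let ?G = "std_gaussian L"
  interpret G: prob_space ?G by (rule prob_space_std_gaussian)
  interpret GG: pair_prob_space ?G ?G ..
  have [measurable]: "finite I" by fact
  define Z where "Z i p = sqrt t * (\<Sum>l\<in>L. A i l * fst p l) + sqrt s * (\<Sum>l\<in>L. A i l * snd p l)" for i p
  have [measurable]: "Z i \<in> borel_measurable (?G \<Otimes>\<^sub>M ?G)" for i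
    unfolding Z_def by measurable
  define E where "E = {p \<in> space (?G \<Otimes>\<^sub>M ?G). \<forall>i\<in>I. x i \<le> Z i p}"
  have E[measurable]: "E \<in> sets (?G \<Otimes>\<^sub>M ?G)"
    unfolding E_def by measurable
  have "(\<integral>w. gaussian_orthant L I A s (\<lambda>i. x i - sqrt t * (\<Sum>l\<in>L. A i l * w l)) \<partial>?G)
    = (\<integral>w. \<integral>v. indicator E (w, v) \<partial>?G \<partial>?G)"
  proof (intro Bochner_Integration.integral_cong refl)
    fix w assume w: "w \<in> space ?G"
    have "(\<integral>v. indicator E (w, v) \<partial>?G)
      = (\<integral>v. indicator {v \<in> space ?G. \<forall>i\<in>I. x i - sqrt t * (\<Sum>l\<in>L. A i l * w l) \<le> sqrt s * (\<Sum>l\<in>L. A i l * v l)} v \<partial>?G :: real)"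
      using w by (intro Bochner_Integration.integral_cong refl)
        (auto simp: E_def Z_def indicator_def space_pair_measure algebra_simps)
    then show "gaussian_orthant L I A s (\<lambda>i. x i - sqrt t * (\<Sum>l\<in>L. A i l * w l)) = (\<integral>v. indicator E (w, v) \<partial>?G)"
      unfolding gaussian_orthant_def by (simp add: Int_def conj_commute)
  qed
  also have "\<dots> = (\<integral>p. indicator E p \<partial>(?G \<Otimes>\<^sub>M ?G))"
    by (rule GG.integral_fst') (intro GG.integrable_const_bound[where B=1] AE_I2, auto simp: indicator_def)
  also have "\<dots> = measure (?G \<Otimes>\<^sub>M ?G) {p \<in> space (?G \<Otimes>\<^sub>M ?G). \<forall>i\<in>I. x i \<le> Z i p}"
  proof -
    have "E \<inter> space (?G \<Otimes>\<^sub>M ?G) = E" by (auto simp: E_def)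
    then show ?thesis unfolding E_def[symmetric] by simp
  qed
  also have "\<dots> = measure ?G {w \<in> space ?G. \<forall>i\<in>I. x i \<le> (\<Sum>l\<in>L. (sqrt (s + t) * A i l) * w l)}"
  proof (rule orthant_prob_eq_of_char_eq)
    fix u
    define c where "c l = (\<Sum>i\<in>I. u i * A i l)" for l
    have Zc: "(\<Sum>i\<in>I. u i * Z i p) = (\<Sum>l\<in>L. (sqrt t * c l) * fst p l) + (\<Sum>l\<in>L. (sqrt s * c l) * snd p l)" for p
    proof -
      have "(\<Sum>i\<in>I. u i * Z i p) = sqrt t * (\<Sum>i\<in>I. u i * (\<Sum>l\<in>L. A i l * fst p l)) + sqrt s * (\<Sum>i\<in>I. u i * (\<Sum>l\<in>L. A i l * snd p l))"
        unfolding Z_def ring_distribs sum.distrib by (simp add: sum_distrib_left mult_ac)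
      then show ?thesis
        unfolding sum_linear_form c_def[symmetric] by (simp add: sum_distrib_left mult.assoc)
    qed
    have "(CLINT p|?G \<Otimes>\<^sub>M ?G. iexp (\<Sum>i\<in>I. u i * Z i p))
      = (CLINT w|?G. CLINT v|?G. iexp (\<Sum>i\<in>I. u i * Z i (w, v)))"
      by (rule GG.integral_fst'[symmetric]) (intro GG.integrable_const_bound[where B=1] AE_I2, auto)
    also have "\<dots> = (CLINT w|?G. CLINT v|?G. iexp (\<Sum>l\<in>L. (sqrt t * c l) * w l) * iexp (\<Sum>l\<in>L. (sqrt s * c l) * v l))"
      unfolding Zc by (simp add: exp_add[symmetric] distrib_left)
    also have "\<dots> = of_real (exp (- (\<Sum>l\<in>L. (sqrt t * c l)\<^sup>2) / 2)) * of_real (exp (- (\<Sum>l\<in>L. (sqrt s * c l)\<^sup>2) / 2))"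
      by (simp only: integral_mult_right_zero integral_mult_left_zero char_std_gaussian[OF fin(1)])
    also have "\<dots> = of_real (exp (- (\<Sum>l\<in>L. (sqrt (s + t) * c l)\<^sup>2) / 2))"
      using st unfolding of_real_mult[symmetric] exp_add[symmetric]
      by (simp add: power_mult_distrib sum_distrib_left[symmetric] algebra_simps add_divide_distrib sum.distrib)
    also have "\<dots> = (CLINT w|?G. iexp (\<Sum>l\<in>L. (sqrt (s + t) * c l) * w l))"
      by (rule char_std_gaussian[OF fin(1), symmetric])
    also have "\<dots> = (CLINT w|?G. iexp (\<Sum>i\<in>I. u i * (\<Sum>l\<in>L. (sqrt (s + t) * A i l) * w l)))"
      unfolding sum_linear_form c_def by (simp add: sum_distrib_left mult_ac)
    finally show "(CLINT p|?G \<Otimes>\<^sub>M ?G. iexp (\<Sum>i\<in>I. u i * Z i p)) = \<dots>" .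
  qed (auto intro!: prob_space_std_gaussian fin GG.prob_space_axioms)
  also have "\<dots> = gaussian_orthant L I A (s + t) x"
    unfolding gaussian_orthant_def by (simp add: sum_distrib_left mult.assoc)
  finally show ?thesis .
qed

lemma std_normal_interval_le:
  assumes "a \<le> b"
  shows "measure std_normal_distribution {a..<b} \<le> b - a"
proof -
  have "emeasure std_normal_distribution {a..<b} = (\<integral>\<^sup>+x. ennreal (std_normal_density x) * indicator {a..<b} x \<partial>lborel)"
    by (rule emeasure_density) auto
  also have "\<dots> \<le> (\<integral>\<^sup>+x. indicator {a..<b} x \<partial>lborel)"
  proof (intro nn_integral_mono)
    fix x :: real
    have "1 \<le> sqrt (2 * pi)" using pi_gt3 by (intro real_le_rsqrt) simp
    moreover have "exp (- x\<^sup>2 / 2) \<le> 1" by simp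
    ultimately have "exp (- x\<^sup>2 / 2) \<le> sqrt (2 * pi)" by linarith
    then have "std_normal_density x \<le> 1"
      by (simp add: std_normal_density_def)
    then show "ennreal (std_normal_density x) * indicator {a..<b} x \<le> indicator {a..<b} x"
      by (simp add: indicator_def ennreal_le_1)
  qed
  also have "\<dots> = ennreal (b - a)" using assms by simp
  finally show ?thesis
    using assms by (simp add: std_normal.emeasure_eq_measure)
qed

text \<open>The linear form is normal with standard deviation \<sigma>;
  \<open>orthant_prob_eq_of_char_eq\<close> with the one-point index set \<open>{()}\<close>
  identifies its tails. The slab is a difference of two tails, and the standard normal density is at
  most 1.\<close>

lemma gaussian_marginal_interval_le:
  fixes c :: "'l \<Rightarrow> real"
  assumes L: "finite L" and \<sigma>: "\<sigma> > 0" "\<sigma>\<^sup>2 = (\<Sum>l\<in>L. (c l)\<^sup>2)" and b: "b \<ge> 0"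
  shows "measure (std_gaussian L) {w \<in> space (std_gaussian L). y - b \<le> (\<Sum>l\<in>L. c l * w l) \<and> \<not> y \<le> (\<Sum>l\<in>L. c l * w l)} \<le> b / \<sigma>"
proof -
  let ?G = "std_gaussian L" and ?Z = "\<lambda>w. \<Sum>l\<in>L. c l * w l"
  interpret G: prob_space ?G by (rule prob_space_std_gaussian)
  have tail: "measure ?G {w \<in> space ?G. z \<le> ?Z w} = measure std_normal_distribution {z / \<sigma>..}" for z
  proof -
    have "measure ?G {w \<in> space ?G. \<forall>i\<in>{()}. z \<le> ?Z w}
      = measure std_normal_distribution {u \<in> space std_normal_distribution. \<forall>i\<in>{()}. z \<le> \<sigma> * u}"
    proof (rule orthant_prob_eq_of_char_eq)
      fix t :: "unit \<Rightarrow> real"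
      have "(CLINT w|?G. iexp (\<Sum>l\<in>L. (t () * c l) * w l)) = of_real (exp (- (\<Sum>l\<in>L. (t () * c l)\<^sup>2) / 2))"
        by (rule char_std_gaussian[OF L])
      also have "(\<Sum>l\<in>L. (t () * c l)\<^sup>2) = (t () * \<sigma>)\<^sup>2"
        by (simp add: power_mult_distrib \<sigma> sum_distrib_left)
      also have "of_real (exp (- (t () * \<sigma>)\<^sup>2 / 2)) = (CLINT u|std_normal_distribution. iexp ((t () * \<sigma>) * u))"
        using fun_cong[OF char_std_normal_distribution, of "t () * \<sigma>"] by (simp add: char_def)
      finally show "(CLINT w|?G. iexp (\<Sum>i\<in>{()}. t i * ?Z w)) = (CLINT u|std_normal_distribution. iexp (\<Sum>i\<in>{()}. t i * (\<sigma> * u)))"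
        by (simp add: sum_distrib_left mult.assoc)
    qed (auto intro!: prob_space_std_gaussian std_normal.prob_space_axioms)
    moreover have "{u. z \<le> \<sigma> * u} = {z / \<sigma>..}" using \<sigma> by (auto simp: field_simps)
    ultimately show ?thesis by simp
  qed
  have "measure ?G {w \<in> space ?G. y - b \<le> ?Z w \<and> \<not> y \<le> ?Z w}
    = measure ?G ({w \<in> space ?G. y - b \<le> ?Z w} - {w \<in> space ?G. y \<le> ?Z w})"
    by (intro arg_cong[where f="measure _"]) auto
  also have "\<dots> = measure ?G {w \<in> space ?G. y - b \<le> ?Z w} - measure ?G {w \<in> space ?G. y \<le> ?Z w}"
    using b by (intro G.finite_measure_Diff) auto
  also have "\<dots> = measure std_normal_distribution ({(y - b) / \<sigma>..} - {y / \<sigma>..})"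
    unfolding tail using b \<sigma> by (intro std_normal.finite_measure_Diff[symmetric]) (auto simp: divide_right_mono)
  also have "{(y - b) / \<sigma>..} - {y / \<sigma>..} = {(y - b) / \<sigma>..<y / \<sigma>}" by auto
  also have "measure std_normal_distribution \<dots> \<le> y / \<sigma> - (y - b) / \<sigma>"
    using b \<sigma> by (intro std_normal_interval_le) (auto simp: divide_right_mono)
  finally show ?thesis by (simp add: diff_divide_distrib)
qed

text \<open>Union bound over the slabs that the shift adds in each coordinate. Only marginals enter:
  each row has to be nonzero, but the rows may be linearly dependent.\<close>

lemma gaussian_orthant_shift_le:
  fixes A :: "'i \<Rightarrow> 'l \<Rightarrow> real"
  assumes fin: "finite L" "finite I" and pos: "\<And>i. i \<in> I \<Longrightarrow> (\<Sum>l\<in>L. (A i l)\<^sup>2) > 0"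
  shows "\<exists>D\<ge>0. \<forall>t>0. \<forall>b\<ge>0. \<forall>x. gaussian_orthant L I A t (\<lambda>i. x i - b) \<le> gaussian_orthant L I A t x + D * b / sqrt t"
proof -
  define D where "D = (\<Sum>i\<in>I. 1 / sqrt (\<Sum>l\<in>L. (A i l)\<^sup>2))"
  have D0: "D \<ge> 0" unfolding D_def by (intro sum_nonneg) (auto intro!: sum_nonneg)
  moreover have "gaussian_orthant L I A t (\<lambda>i. x i - b) \<le> gaussian_orthant L I A t x + D * b / sqrt t"
    if t: "t > 0" and b: "b \<ge> 0" for t b x
  proof -
    let ?G = "std_gaussian L" and ?Z = "\<lambda>i w. sqrt t * (\<Sum>l\<in>L. A i l * w l)"
    interpret G: prob_space ?G by (rule prob_space_std_gaussian)
    have [measurable]: "finite I" by fact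
    define S where "S i = {w \<in> space ?G. x i - b \<le> ?Z i w \<and> \<not> x i \<le> ?Z i w}" for i
    define O1 where "O1 = {w \<in> space ?G. \<forall>i\<in>I. x i \<le> ?Z i w}"
    have [measurable]: "S i \<in> sets ?G" for i unfolding S_def by measurable
    have [measurable]: "O1 \<in> sets ?G" unfolding O1_def by measurable
    have "gaussian_orthant L I A t (\<lambda>i. x i - b) \<le> measure ?G (O1 \<union> (\<Union>i\<in>I. S i))"
      unfolding gaussian_orthant_def
    proof (intro G.finite_measure_mono)
      show "O1 \<union> (\<Union>i\<in>I. S i) \<in> sets ?G" using fin by (intro sets.Un sets.finite_UN) auto
    qed (auto simp: O1_def S_def)
    also have "\<dots> \<le> measure ?G O1 + measure ?G (\<Union>i\<in>I. S i)"
      using fin by (intro measure_Un_le sets.finite_UN) auto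
    also have "measure ?G (\<Union>i\<in>I. S i) \<le> (\<Sum>i\<in>I. measure ?G (S i))"
      using fin by (intro measure_UNION_le) auto
    also have "\<dots> \<le> (\<Sum>i\<in>I. b / (sqrt t * sqrt (\<Sum>l\<in>L. (A i l)\<^sup>2)))"
    proof (intro sum_mono)
      fix i assume i: "i \<in> I"
      have "measure ?G {w \<in> space ?G. x i - b \<le> (\<Sum>l\<in>L. (sqrt t * A i l) * w l) \<and> \<not> x i \<le> (\<Sum>l\<in>L. (sqrt t * A i l) * w l)}
        \<le> b / (sqrt t * sqrt (\<Sum>l\<in>L. (A i l)\<^sup>2))"
        using t b pos[OF i] by (intro gaussian_marginal_interval_le fin)
          (auto simp: power_mult_distrib sum_distrib_left less_imp_le)
      then show "measure ?G (S i) \<le> b / (sqrt t * sqrt (\<Sum>l\<in>L. (A i l)\<^sup>2))"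
        by (simp add: S_def sum_distrib_left mult.assoc)
    qed
    also have "\<dots> = D * b / sqrt t"
      by (simp add: D_def sum_distrib_right sum_divide_distrib mult.commute[of "sqrt t"])
    finally show ?thesis by (simp add: O1_def gaussian_orthant_def)
  qed
  ultimately show ?thesis by blast
qed

text \<open>Continuity from below along boxes of integer size, which exhaust the space.\<close>

lemma gaussian_concentrates_on_box:
  fixes A :: "'i \<Rightarrow> 'l \<Rightarrow> real"
  assumes I: "finite I" and "\<eta> < 1"
  shows "\<exists>b\<ge>0. \<eta> \<le> measure (std_gaussian L) {w \<in> space (std_gaussian L). \<forall>i\<in>I. \<bar>s * (\<Sum>l\<in>L. A i l * w l)\<bar> \<le> b}"
proof -
  let ?G = "std_gaussian L" and ?Z = "\<lambda>i w. s * (\<Sum>l\<in>L. A i l * w l)"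
  interpret G: prob_space ?G by (rule prob_space_std_gaussian)
  have [measurable]: "finite I" by fact
  define E where "E n = {w \<in> space ?G. \<forall>i\<in>I. \<bar>?Z i w\<bar> \<le> real n}" for n
  have [measurable]: "E n \<in> sets ?G" for n unfolding E_def by measurable
  have "(\<lambda>n. measure ?G (E n)) \<longlonglongrightarrow> measure ?G (\<Union>n. E n)"
    by (intro G.finite_Lim_measure_incseq) (auto simp: incseq_def E_def intro: order_trans)
  moreover have "(\<Union>n. E n) = space ?G"
  proof (intro equalityI subsetI)
    fix w assume w: "w \<in> space ?G"
    obtain n where n: "(\<Sum>i\<in>I. \<bar>?Z i w\<bar>) \<le> real n" using real_arch_simple by blast
    have "\<bar>?Z i w\<bar> \<le> real n" if "i \<in> I" for i
      using member_le_sum[of i I "\<lambda>i. \<bar>?Z i w\<bar>"] that I n by force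
    then show "w \<in> (\<Union>n. E n)" using w by (auto simp: E_def)
  qed (auto simp: E_def)
  ultimately have "(\<lambda>n. measure ?G (E n)) \<longlonglongrightarrow> 1" by (simp add: G.prob_space)
  then have "eventually (\<lambda>n. measure ?G (E n) > \<eta>) sequentially"
    using assms by (intro order_tendstoD)
  then obtain n where "measure ?G (E n) > \<eta>" by (meson eventually_happens trivial_limit_sequentially)
  then show ?thesis by (intro exI[of _ "real n"]) (auto simp: E_def)
qed

section \<open>Berry-Esseen bound on orthants\<close>

text \<open>A step is a symbol \<open>l\<close> of probability \<open>p l\<close>, and
  \<open>X i l\<close> is coordinate \<open>i\<close> of its displacement. Strict positivity of
  \<open>p\<close> permits division by \<open>sqrt (p l)\<close> in the lifted step.\<close>

locale centered_walk =
  fixes L :: "'l set" and I :: "'i set" and p :: "'l \<Rightarrow> real" and X :: "'i \<Rightarrow> 'l \<Rightarrow> real"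
  assumes finite_L: "finite L" and finite_I: "finite I"
    and p_pos: "\<And>l. l \<in> L \<Longrightarrow> p l > 0" and p_sum: "(\<Sum>l\<in>L. p l) = 1"
    and centered: "\<And>i. i \<in> I \<Longrightarrow> (\<Sum>l\<in>L. p l * X i l) = 0"
begin

text \<open>The probability that the walk after \<open>n\<close> steps is at least \<open>x\<close>
  in every coordinate, obtained by conditioning on one step. The Gaussian comparison works with this
  recursion; the probability space appears only in \<open>walk_orthant_eq_prob\<close>.\<close>

primrec walk_orthant :: "nat \<Rightarrow> ('i \<Rightarrow> real) \<Rightarrow> real" where
  "walk_orthant 0 x = (if \<forall>i\<in>I. x i \<le> 0 then 1 else 0)"
| "walk_orthant (Suc n) x = (\<Sum>l\<in>L. p l * walk_orthant n (\<lambda>i. x i - X i l))"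

text \<open>A square root of the step covariance with one column per symbol: by centring,
  \<open>\<Sum>l\<in>L. A i l * A j l\<close> is the covariance of coordinates \<open>i\<close> and
  \<open>j\<close>.\<close>

definition A :: "'i \<Rightarrow> 'l \<Rightarrow> real" where
  "A i l = sqrt (p l) * X i l"

definition proj :: "'i \<Rightarrow> ('l \<Rightarrow> real) \<Rightarrow> real" where
  "proj i w = (\<Sum>l\<in>L. A i l * w l)"

abbreviation G :: "('l \<Rightarrow> real) measure" where "G \<equiv> std_gaussian L"

abbreviation V :: "real \<Rightarrow> ('i \<Rightarrow> real) \<Rightarrow> real" where "V \<equiv> gaussian_orthant L I A"

lemma p_nonneg: "l \<in> L \<Longrightarrow> p l \<ge> 0"
  using p_pos by (simp add: less_imp_le)

lemma measurable_proj [measurable]: "proj i \<in> borel_measurable G"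
  unfolding proj_def by measurable

lemma average_bounds:
  assumes "\<And>l. l \<in> L \<Longrightarrow> c \<le> f l" "\<And>l. l \<in> L \<Longrightarrow> f l \<le> d"
  shows "c \<le> (\<Sum>l\<in>L. p l * f l)" "(\<Sum>l\<in>L. p l * f l) \<le> d"
proof -
  have "(\<Sum>l\<in>L. p l * c) \<le> (\<Sum>l\<in>L. p l * f l)"
    using assms p_nonneg by (intro sum_mono mult_left_mono) auto
  then show "c \<le> (\<Sum>l\<in>L. p l * f l)" by (simp add: sum_distrib_right[symmetric] p_sum)
  have "(\<Sum>l\<in>L. p l * f l) \<le> (\<Sum>l\<in>L. p l * d)"
    using assms p_nonneg by (intro sum_mono mult_left_mono) auto
  then show "(\<Sum>l\<in>L. p l * f l) \<le> d" by (simp add: sum_distrib_right[symmetric] p_sum)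
qed

lemma walk_orthant_bounds: "0 \<le> walk_orthant n x" "walk_orthant n x \<le> 1"
proof -
  have "0 \<le> walk_orthant n x \<and> walk_orthant n x \<le> 1"
    by (induction n arbitrary: x) (auto intro!: average_bounds)
  then show "0 \<le> walk_orthant n x" "walk_orthant n x \<le> 1" by auto
qed

lemma walk_orthant_antimono:
  "(\<And>i. i \<in> I \<Longrightarrow> x i \<le> y i) \<Longrightarrow> walk_orthant n y \<le> walk_orthant n x"
proof (induction n arbitrary: x y)
  case 0
  then show ?case by (auto intro: order_trans)
next
  case (Suc n)
  then show ?case
    using p_nonneg by (auto intro!: sum_mono mult_left_mono)
qed

lemma measurable_walk_orthant [measurable]:
  assumes [measurable]: "\<And>i. f i \<in> borel_measurable N"
  shows "(\<lambda>w. walk_orthant n (\<lambda>i. f i w)) \<in> borel_measurable N"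
  using assms
proof (induction n arbitrary: f)
  case 0
  note 0[measurable]
  have [measurable]: "finite I" by (rule finite_I)
  show ?case unfolding walk_orthant.simps by measurable
next
  case (Suc n)
  have "(\<lambda>w. walk_orthant n (\<lambda>i. f i w - X i l)) \<in> borel_measurable N" for l
    using Suc.prems by (intro Suc.IH borel_measurable_diff borel_measurable_const)
  then show ?case by simp
qed

text \<open>The vector \<open>e\<^sub>l / sqrt (p l)\<close>, taken with probability \<open>p l\<close>, has identity second moments and is mapped to
  \<open>X l\<close> by \<open>A\<close>. Its mean \<open>sqrt \<circ> p\<close> lies in the kernel of \<open>A\<close>; subtracting twice this mean on a fair coin
  makes the vector centred and isotropic without changing its image.\<close>

definition \<xi> :: "'l \<times> bool \<Rightarrow> 'l \<Rightarrow> real" where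
  "\<xi> \<theta> l = (if l = fst \<theta> then 1 / sqrt (p l) else 0) - (if snd \<theta> then 2 * sqrt (p l) else 0)"

lemma sum_coin: "(\<Sum>\<theta>\<in>L \<times> (UNIV :: bool set). p (fst \<theta>) / 2 * f \<theta>) = (\<Sum>l\<in>L. p l * ((f (l, True) + f (l, False)) / 2))"
  unfolding sum.cartesian_product' UNIV_bool
  by (simp add: sum.cartesian_product'[symmetric] algebra_simps add_divide_distrib)

lemma sum_coordinate:
  assumes "l \<in> L"
  shows "(\<Sum>k\<in>L. p k * (if l = k then f k else 0)) = p l * f l"
  using assms finite_L by (simp add: if_distrib[of "\<lambda>x. _ * x"] cong: if_cong)

lemma sqrt_p: "l \<in> L \<Longrightarrow> sqrt (p l) * sqrt (p l) = p l" "l \<in> L \<Longrightarrow> sqrt (p l) > 0"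
  using p_pos[of l] by auto

lemma \<xi>_mean:
  assumes "l \<in> L"
  shows "(\<Sum>\<theta>\<in>L \<times> UNIV. p (fst \<theta>) / 2 * \<xi> \<theta> l) = 0"
proof -
  have half: "c * (((a - 2 * b) + (a - 0)) / 2) = c * a - c * b" for a b c :: real
    by (simp add: field_simps)
  have "(\<Sum>\<theta>\<in>L \<times> UNIV. p (fst \<theta>) / 2 * \<xi> \<theta> l)
    = (\<Sum>k\<in>L. p k * (if l = k then 1 / sqrt (p l) else 0)) - (\<Sum>k\<in>L. p k) * sqrt (p l)"
    unfolding sum_coin \<xi>_def fst_conv snd_conv if_True if_False half sum_subtractf sum_distrib_right ..
  then show ?thesis
    using p_pos[OF assms] by (simp add: sum_coordinate[OF assms] p_sum real_div_sqrt)
qed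

text \<open>The uncorrected vector has mean \<open>m l = sqrt (p l)\<close>. Subtracting
  \<open>2 * m\<close> half of the time changes the second moment by \<open>- 2 * m l * m l'\<close>
  from the cross terms and by \<open>2 * m l * m l'\<close> from the square, so the identity
  survives; the same factor 2 makes the mean vanish.\<close>

lemma \<xi>_cov:
  assumes l: "l \<in> L" and l': "l' \<in> L"
  shows "(\<Sum>\<theta>\<in>L \<times> UNIV. p (fst \<theta>) / 2 * (\<xi> \<theta> l * \<xi> \<theta> l')) = (if l = l' then 1 else 0)"
proof -
  define e where "e l k = (if l = k then 1 / sqrt (p l) else 0)" for l k
  have "(\<Sum>\<theta>\<in>L \<times> UNIV. p (fst \<theta>) / 2 * (\<xi> \<theta> l * \<xi> \<theta> l'))
    = (\<Sum>k\<in>L. p k * (e l k * e l' k) - sqrt (p l') * (p k * e l k) - sqrt (p l) * (p k * e l' k)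
        + 2 * sqrt (p l) * sqrt (p l') * p k)"
    unfolding sum_coin by (intro sum.cong refl) (simp add: \<xi>_def e_def field_simps)
  also have "\<dots> = (\<Sum>k\<in>L. p k * (e l k * e l' k)) - sqrt (p l') * (\<Sum>k\<in>L. p k * e l k) - sqrt (p l) * (\<Sum>k\<in>L. p k * e l' k)
        + 2 * sqrt (p l) * sqrt (p l')"
    unfolding sum.distrib sum_subtractf sum_distrib_left[symmetric] p_sum by simp
  also have "(\<Sum>k\<in>L. p k * e m k) = sqrt (p m)" if "m \<in> L" for m
    unfolding e_def sum_coordinate[OF that] using p_pos[OF that] by (simp add: real_div_sqrt)
  then have "sqrt (p l') * (\<Sum>k\<in>L. p k * e l k) = sqrt (p l) * sqrt (p l')" "sqrt (p l) * (\<Sum>k\<in>L. p k * e l' k) = sqrt (p l) * sqrt (p l')"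
    using l l' by simp_all
  moreover have "(\<Sum>k\<in>L. p k * (e l k * e l' k)) = (if l = l' then 1 else 0)"
  proof (cases "l = l'")
    case True
    have "(\<Sum>k\<in>L. p k * (e l k * e l' k)) = (\<Sum>k\<in>L. p k * (if l = k then 1 / p l else 0))"
      using True p_nonneg by (intro sum.cong refl) (simp add: e_def)
    also have "\<dots> = p l * (1 / p l)" by (rule sum_coordinate[OF l])
    finally show ?thesis using True p_pos[OF l] by simp
  next
    case False
    then have "(\<Sum>k\<in>L. p k * (e l k * e l' k)) = 0" by (intro sum.neutral) (auto simp: e_def)
    then show ?thesis using False by simp
  qed
  ultimately show ?thesis by simp
qed

lemma proj_\<xi>:
  assumes k: "k \<in> L" and i: "i \<in> I"
  shows "proj i (\<lambda>l\<in>L. a * w l + \<xi> (k, r) l) = a * proj i w + X i k"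
proof -
  have "proj i (\<lambda>l\<in>L. a * w l + \<xi> (k, r) l)
    = a * proj i w + (\<Sum>l\<in>L. if l = k then X i l else 0) - (if r then 2 else 0) * (\<Sum>l\<in>L. p l * X i l)"
    unfolding proj_def sum_distrib_left sum.distrib[symmetric] sum_subtractf[symmetric]
  proof (intro sum.cong refl)
    fix l assume "l \<in> L"
    define s where "s = sqrt (p l)"
    have s: "s > 0" "p l = s * s"
      using sqrt_p[OF \<open>l \<in> L\<close>] by (simp_all add: s_def)
    show "A i l * (\<lambda>l\<in>L. a * w l + \<xi> (k, r) l) l
      = a * (A i l * w l) + (if l = k then X i l else 0) - (if r then 2 else 0) * (p l * X i l)"
      using \<open>l \<in> L\<close> s by (cases "k = l") (auto simp: A_def \<xi>_def field_simps)
  qed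
  then show ?thesis using k finite_L centered[OF i] by simp
qed

lemma proj_scale: "proj i (\<lambda>l\<in>L. a * w l) = a * proj i w"
  unfolding proj_def by (simp add: sum_distrib_left mult_ac)

lemma V_semigroup:
  assumes "s \<ge> 0" "t \<ge> 0"
  shows "(\<integral>w. V s (\<lambda>i. x i - sqrt t * proj i w) \<partial>G) = V (s + t) x"
  unfolding proj_def by (rule gaussian_orthant_semigroup[OF finite_L finite_I assms])

lemma walk_orthant_cong: "(\<And>i. i \<in> I \<Longrightarrow> x i = y i) \<Longrightarrow> walk_orthant n x = walk_orthant n y"
  using walk_orthant_antimono[of x y n] walk_orthant_antimono[of y x n] by auto

text \<open>Orthant probability of the walk plus independent Gaussian noise whose covariance is
  \<tau> times that of a step.\<close>

definition smoothed :: "nat \<Rightarrow> real \<Rightarrow> ('i \<Rightarrow> real) \<Rightarrow> real" where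
  "smoothed k \<tau> x = (\<integral>w. walk_orthant k (\<lambda>i. x i - sqrt \<tau> * proj i w) \<partial>G)"

text \<open>The effect on a test function \<open>u\<close> of the lifted space when, in the presence
  of Gaussian noise of variance \<tau>, one lifted step is replaced by one more unit of Gaussian
  variance.\<close>

definition kernel_diff :: "real \<Rightarrow> (('l \<Rightarrow> real) \<Rightarrow> real) \<Rightarrow> real" where
  "kernel_diff \<tau> u = (\<Sum>\<theta>\<in>L \<times> UNIV. p (fst \<theta>) / 2 * (\<integral>w. u (\<lambda>l\<in>L. sqrt \<tau> * w l + \<xi> \<theta> l) \<partial>G))
     - (\<integral>w. u (\<lambda>l\<in>L. sqrt (\<tau> + 1) * w l) \<partial>G)"

text \<open>For a function of the projection, the lifted step acts as the true step \<open>X\<close>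
  by \<open>proj_\<xi>\<close>, and the coin disappears.\<close>

lemma kernel_diff_proj:
  assumes u: "\<And>v w. (\<And>i. i \<in> I \<Longrightarrow> v i = w i) \<Longrightarrow> u v = u w"
  shows "kernel_diff \<tau> (\<lambda>w. u (\<lambda>i. x i - proj i w))
    = (\<Sum>l\<in>L. p l * (\<integral>w. u (\<lambda>i. x i - X i l - sqrt \<tau> * proj i w) \<partial>G)) - (\<integral>w. u (\<lambda>i. x i - sqrt (\<tau> + 1) * proj i w) \<partial>G)"
proof -
  have "(\<integral>w. u (\<lambda>i. x i - proj i (\<lambda>l\<in>L. sqrt \<tau> * w l + \<xi> (k, r) l)) \<partial>G)
    = (\<integral>w. u (\<lambda>i. x i - X i k - sqrt \<tau> * proj i w) \<partial>G)" if "k \<in> L" for k r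
    by (intro Bochner_Integration.integral_cong refl u) (simp add: proj_\<xi>[OF that])
  then show ?thesis
    unfolding kernel_diff_def sum_coin proj_scale by simp
qed

lemma smoothed_step:
  "smoothed (Suc k) \<tau> x - smoothed k (\<tau> + 1) x = kernel_diff \<tau> (\<lambda>w. walk_orthant k (\<lambda>i. x i - proj i w))"
proof -
  interpret G: prob_space G by (rule prob_space_std_gaussian)
  have "smoothed (Suc k) \<tau> x = (\<Sum>l\<in>L. p l * (\<integral>w. walk_orthant k (\<lambda>i. x i - X i l - sqrt \<tau> * proj i w) \<partial>G))"
  proof -
    have "integrable G (\<lambda>w. walk_orthant k (\<lambda>i. x i - sqrt \<tau> * proj i w - X i l))" for l
      using walk_orthant_bounds by (intro G.integrable_const_bound[where B=1] AE_I2) auto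
    then show ?thesis
      unfolding smoothed_def walk_orthant.simps by (simp add: algebra_simps)
  qed
  moreover have "kernel_diff \<tau> (\<lambda>w. walk_orthant k (\<lambda>i. x i - proj i w))
    = (\<Sum>l\<in>L. p l * (\<integral>w. walk_orthant k (\<lambda>i. x i - X i l - sqrt \<tau> * proj i w) \<partial>G))
      - (\<integral>w. walk_orthant k (\<lambda>i. x i - sqrt (\<tau> + 1) * proj i w) \<partial>G)"
    by (rule kernel_diff_proj[of "walk_orthant k"]) (rule walk_orthant_cong)
  ultimately show ?thesis by (simp add: smoothed_def)
qed

text \<open>By the semigroup property the Gaussian contained in \<open>V k\<close> can be moved into
  the kernel. The replacement error of a Gaussian profile is thus governed by the larger variance
  \<open>\<tau> + k\<close>.\<close>

lemma V_step:
  assumes "\<tau> \<ge> 0"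
  shows "kernel_diff \<tau> (\<lambda>w. V (real k) (\<lambda>i. x i - proj i w)) = kernel_diff (\<tau> + k) (\<lambda>w. V 0 (\<lambda>i. x i - proj i w))"
proof -
  have "kernel_diff \<tau> (\<lambda>w. V s (\<lambda>i. x i - proj i w)) = (\<Sum>l\<in>L. p l * V (s + \<tau>) (\<lambda>i. x i - X i l)) - V (s + (\<tau> + 1)) x"
    if "s \<ge> 0" "\<tau> \<ge> 0" for s \<tau>
  proof -
    have "kernel_diff \<tau> (\<lambda>w. V s (\<lambda>i. x i - proj i w))
      = (\<Sum>l\<in>L. p l * (\<integral>w. V s (\<lambda>i. x i - X i l - sqrt \<tau> * proj i w) \<partial>G)) - (\<integral>w. V s (\<lambda>i. x i - sqrt (\<tau> + 1) * proj i w) \<partial>G)"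
      by (rule kernel_diff_proj[of "V s"]) (rule gaussian_orthant_cong)
    then show ?thesis using that by (simp add: V_semigroup)
  qed
  from this[of "real k" \<tau>] this[of 0 "\<tau> + k"] assms show ?thesis by (simp add: algebra_simps)
qed

lemma kernel_diff_bound:
  "\<exists>C\<ge>0. \<forall>\<tau>\<ge>2. \<forall>u\<in>borel_measurable G. \<forall>b. (\<forall>w. \<bar>u w\<bar> \<le> b) \<longrightarrow> \<bar>kernel_diff \<tau> u\<bar> \<le> C * b / sqrt \<tau> ^ 3"
  unfolding kernel_diff_def
proof (rule gaussian_kernel_bound[where q="\<lambda>\<theta>. p (fst \<theta>) / 2"])
  show "(\<Sum>\<theta>\<in>L \<times> (UNIV :: bool set). p (fst \<theta>) / 2) = 1"
    using sum_coin[of "\<lambda>_. 1"] by (simp add: p_sum)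
qed (use finite_L p_nonneg \<xi>_mean \<xi>_cov in auto)

lemma walk_orthant_0: "walk_orthant 0 x = V 0 x"
proof -
  interpret G: prob_space G by (rule prob_space_std_gaussian)
  have "{w \<in> space G. \<forall>i\<in>I. x i \<le> 0} = (if \<forall>i\<in>I. x i \<le> 0 then space G else {})" by auto
  then show ?thesis by (simp add: gaussian_orthant_def G.prob_space)
qed

lemma smoothed_0: "t \<ge> 0 \<Longrightarrow> smoothed 0 t x = V t x"
  using V_semigroup[of 0 t x] by (simp add: smoothed_def walk_orthant_0 del: walk_orthant.simps)

lemma kernel_diff_diff:
  assumes [measurable]: "u \<in> borel_measurable G" "v \<in> borel_measurable G" and "\<And>w. \<bar>u w\<bar> \<le> b" "\<And>w. \<bar>v w\<bar> \<le> b"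
  shows "kernel_diff \<tau> (\<lambda>w. u w - v w) = kernel_diff \<tau> u - kernel_diff \<tau> v"
proof -
  interpret G: prob_space G by (rule prob_space_std_gaussian)
  have [measurable]: "(\<lambda>w. \<lambda>l\<in>L. a * w l + c l) \<in> measurable G G" for a c
    by (intro measurable_restrict) measurable
  have [measurable]: "(\<lambda>w. \<lambda>l\<in>L. a * w l) \<in> measurable G G" for a
    by (intro measurable_restrict) measurable
  have 1: "integrable G (\<lambda>w. f (\<lambda>l\<in>L. a * w l + c l))" "integrable G (\<lambda>w. f (\<lambda>l\<in>L. a * w l))"
    if [measurable]: "f \<in> borel_measurable G" and "\<And>w. \<bar>f w\<bar> \<le> b" for f :: "_ \<Rightarrow> real" and a c
    using that by (intro G.integrable_const_bound[where B=b] AE_I2; simp)+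
  have "(\<integral>w. u (\<lambda>l\<in>L. sqrt \<tau> * w l + \<xi> \<theta> l) - v (\<lambda>l\<in>L. sqrt \<tau> * w l + \<xi> \<theta> l) \<partial>G)
    = (\<integral>w. u (\<lambda>l\<in>L. sqrt \<tau> * w l + \<xi> \<theta> l) \<partial>G) - (\<integral>w. v (\<lambda>l\<in>L. sqrt \<tau> * w l + \<xi> \<theta> l) \<partial>G)" for \<theta>
    by (intro Bochner_Integration.integral_diff 1 assms)
  moreover have "(\<integral>w. u (\<lambda>l\<in>L. sqrt (\<tau> + 1) * w l) - v (\<lambda>l\<in>L. sqrt (\<tau> + 1) * w l) \<partial>G)
    = (\<integral>w. u (\<lambda>l\<in>L. sqrt (\<tau> + 1) * w l) \<partial>G) - (\<integral>w. v (\<lambda>l\<in>L. sqrt (\<tau> + 1) * w l) \<partial>G)"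
    by (intro Bochner_Integration.integral_diff 1 assms)
  ultimately show ?thesis
    unfolding kernel_diff_def by (simp only: right_diff_distrib sum_subtractf)
qed

text \<open>Telescoping along \<open>smoothed k (s + n - k)\<close>, from the pure Gaussian at
  \<open>k = 0\<close> to the smoothed walk at \<open>k = n\<close>. In each step
  \<open>walk_orthant k\<close> is split into \<open>V k\<close> and an error of size
  \<open>d k\<close>. The error is multiplied by the power \<open>- 3 / 2\<close> of the current
  variance \<open>s + n - 1 - k\<close>; for \<open>V k\<close> that variance improves to
  \<open>s + n - 1\<close> by \<open>V_step\<close>.\<close>

lemma smoothed_error:
  "\<exists>C\<ge>0. \<forall>s n x d. s \<ge> 2 \<longrightarrow> (\<forall>k<n. \<forall>y. \<bar>walk_orthant k y - V k y\<bar> \<le> d k) \<longrightarrow>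
    \<bar>smoothed n (real s) x - V (n + s) x\<bar> \<le> C * ((\<Sum>k<n. d k / sqrt (real (s + n - 1 - k)) ^ 3) + real n / sqrt (real (s + n - 1)) ^ 3)"
proof -
  obtain C where C: "C \<ge> 0" and K: "\<And>\<tau> u b. \<tau> \<ge> 2 \<Longrightarrow> u \<in> borel_measurable G \<Longrightarrow> (\<And>w. \<bar>u w\<bar> \<le> b) \<Longrightarrow> \<bar>kernel_diff \<tau> u\<bar> \<le> C * b / sqrt \<tau> ^ 3"
    using kernel_diff_bound by blast
  have step: "\<bar>smoothed (Suc k) \<tau> x - smoothed k (\<tau> + 1) x\<bar> \<le> C * (b / sqrt \<tau> ^ 3 + 1 / sqrt (\<tau> + k) ^ 3)"
    if \<tau>: "\<tau> \<ge> 2" and b: "\<And>y. \<bar>walk_orthant k y - V k y\<bar> \<le> b" for k \<tau> x b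
  proof -
    define u where "u w = walk_orthant k (\<lambda>i. x i - proj i w)" for w
    define v where "v w = V k (\<lambda>i. x i - proj i w)" for w
    note finite_I[measurable]
    have [measurable]: "u \<in> borel_measurable G" "v \<in> borel_measurable G"
      unfolding u_def v_def using finite_I by measurable
    have "(\<lambda>w. V 0 (\<lambda>i. x i - proj i w)) \<in> borel_measurable G"
      using finite_I by measurable
    then have 2: "\<bar>kernel_diff (\<tau> + k) (\<lambda>w. V 0 (\<lambda>i. x i - proj i w))\<bar> \<le> C * 1 / sqrt (\<tau> + k) ^ 3"
      using \<tau> by (intro K) (auto simp: abs_of_nonneg gaussian_orthant_bounds)
    have 1: "\<bar>kernel_diff \<tau> (\<lambda>w. u w - v w)\<bar> \<le> C * b / sqrt \<tau> ^ 3"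
      using \<tau> b by (intro K) (auto simp: u_def v_def)
    have "kernel_diff \<tau> (\<lambda>w. u w - v w) = kernel_diff \<tau> u - kernel_diff \<tau> v"
      by (rule kernel_diff_diff[where b=1]) (auto simp: u_def v_def walk_orthant_bounds gaussian_orthant_bounds)
    moreover have "kernel_diff \<tau> v = kernel_diff (\<tau> + k) (\<lambda>w. V 0 (\<lambda>i. x i - proj i w))"
      unfolding v_def using \<tau> by (intro V_step) simp
    moreover have "smoothed (Suc k) \<tau> x - smoothed k (\<tau> + 1) x = kernel_diff \<tau> u"
      unfolding u_def by (rule smoothed_step)
    ultimately show ?thesis using 1 2 by (simp add: distrib_left)
  qed
  have "\<bar>smoothed n (real s) x - V (n + s) x\<bar> \<le> C * ((\<Sum>k<n. d k / sqrt (real (s + n - 1 - k)) ^ 3) + real n / sqrt (real (s + n - 1)) ^ 3)"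
    if s: "s \<ge> 2" and d: "\<And>k y. k < n \<Longrightarrow> \<bar>walk_orthant k y - V k y\<bar> \<le> d k" for s n :: nat and x and d :: "nat \<Rightarrow> real"
  proof -
    define a where "a k = smoothed k (real (s + n - k)) x" for k
    have "\<bar>a (Suc k) - a k\<bar> \<le> C * (d k / sqrt (real (s + n - 1 - k)) ^ 3 + 1 / sqrt (real (s + n - 1)) ^ 3)" if "k < n" for k
    proof -
      have e: "real (s + n - 1 - k) + 1 = real (s + n - k)" "real (s + n - 1 - k) + real k = real (s + n - 1)"
        using that s by (simp_all add: of_nat_diff)
      have "s + n - Suc k = s + n - 1 - k" by simp
      moreover have "\<bar>smoothed (Suc k) (real (s + n - 1 - k)) x - smoothed k (real (s + n - 1 - k) + 1) x\<bar>
        \<le> C * (d k / sqrt (real (s + n - 1 - k)) ^ 3 + 1 / sqrt (real (s + n - 1 - k) + k) ^ 3)"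
        by (rule step) (use that s d in auto)
      ultimately show ?thesis unfolding a_def e by (simp only:)
    qed
    then have "(\<Sum>k<n. \<bar>a (Suc k) - a k\<bar>) \<le> (\<Sum>k<n. C * (d k / sqrt (real (s + n - 1 - k)) ^ 3 + 1 / sqrt (real (s + n - 1)) ^ 3))"
      by (intro sum_mono) auto
    also have "\<dots> = C * ((\<Sum>k<n. d k / sqrt (real (s + n - 1 - k)) ^ 3) + real n / sqrt (real (s + n - 1)) ^ 3)"
      by (simp only: sum_distrib_left[symmetric] sum.distrib sum_constant card_lessThan times_divide_eq_right mult_1_right)
    finally have "\<bar>\<Sum>k<n. a (Suc k) - a k\<bar> \<le> C * ((\<Sum>k<n. d k / sqrt (real (s + n - 1 - k)) ^ 3) + real n / sqrt (real (s + n - 1)) ^ 3)"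
      using sum_abs[of "\<lambda>k. a (Suc k) - a k" "{..<n}"] by linarith
    moreover have "(\<Sum>k<n. a (Suc k) - a k) = a n - a 0" by (rule sum_lessThan_telescope)
    moreover have "a n = smoothed n (real s) x" "a 0 = V (n + s) x"
      by (simp_all add: a_def smoothed_0 add.commute)
    ultimately show ?thesis by simp
  qed
  then show ?thesis using C by blast
qed

end

text \<open>A discrete comparison of \<open>t powr (- 3 / 2)\<close> with its integral over the
  preceding unit interval; the right-hand side telescopes.\<close>

lemma inverse_sqrt_cube_le:
  fixes t :: real
  assumes "t > 1"
  shows "1 / sqrt t ^ 3 \<le> 2 / sqrt (t - 1) - 2 / sqrt t"
proof -
  define u v where "u = sqrt (t - 1)" and "v = sqrt t"
  have uv: "0 < u" "u \<le> v" "v\<^sup>2 - u\<^sup>2 = 1"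
    using assms by (auto simp: u_def v_def)
  have "2 / u - 2 / v = 2 * (v - u) / (u * v)"
    using uv by (simp add: field_simps)
  also have "\<dots> = 2 * ((v - u) * (v + u)) / (u * v * (v + u))"
    using uv by simp
  also have "(v - u) * (v + u) = 1"
    using uv by (simp add: algebra_simps power2_eq_square)
  finally have eq: "2 / u - 2 / v = 2 / (u * v * (v + u))" by simp
  have "u * v * (v + u) \<le> v * v * (v + v)"
    using uv by (intro mult_mono) auto
  also have "\<dots> = 2 * v ^ 3" by (simp add: power3_eq_cube algebra_simps)
  finally have "2 / (2 * v ^ 3) \<le> 2 / (u * v * (v + u))"
    using uv by (intro divide_left_mono) auto
  then show ?thesis unfolding eq[symmetric] by (simp add: u_def v_def)
qed

context centered_walk
begin

text \<open>With probability at least \<open>3 / 4\<close> the noise stays within \<open>a\<close>.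
  After moving \<open>x\<close> by \<open>a\<close> in the suitable direction, monotonicity compares
  the noisy difference with the one at \<open>x\<close>, up to the variation \<delta> of
  \<open>V n\<close> over \<open>2 * a\<close>; elsewhere the difference is at most its supremum
  \<open>d\<close>. As the average is bounded by \<open>e\<close>, this gives
  \<open>d * \<pi> \<le> e + \<delta> + d * (1 - \<pi>)\<close>, and
  \<open>2 * \<pi> - 1 \<ge> 1 / 2\<close> produces the factor 2.\<close>

lemma smoothing_inequality:
  assumes D: "D \<ge> 0" "\<And>b x. b \<ge> 0 \<Longrightarrow> V n (\<lambda>i. x i - b) \<le> V n x + D * b"
    and a: "a \<ge> 0" "3 / 4 \<le> measure G {w \<in> space G. \<forall>i\<in>I. \<bar>sqrt s * proj i w\<bar> \<le> a}"
    and s: "s \<ge> 0"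
    and e: "\<And>x. \<bar>smoothed n s x - V (n + s) x\<bar> \<le> e"
  shows "\<bar>walk_orthant n x - V n x\<bar> \<le> 2 * e + 4 * D * a"
proof -
  interpret G: prob_space G by (rule prob_space_std_gaussian)
  note finite_I[measurable]
  define \<Delta> where "\<Delta> x = walk_orthant n x - V n x" for x
  define E where "E = {w \<in> space G. \<forall>i\<in>I. \<bar>sqrt s * proj i w\<bar> \<le> a}"
  define \<pi> where "\<pi> = measure G E"
  define \<delta> where "\<delta> = 2 * D * a"
  define d where "d = (SUP x. \<bar>\<Delta> x\<bar>)"
  have E [measurable]: "E \<in> sets G" unfolding E_def by measurable
  have \<pi>: "3 / 4 \<le> \<pi>" "\<pi> \<le> 1" using a(2) by (auto simp: \<pi>_def E_def)
  \<comment> \<open>This makes the supremum \<open>d\<close> finite, so that the later inequality,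
    which bounds \<open>d\<close> by a multiple of itself, can be solved for it.\<close>
  have \<Delta>1: "\<bar>\<Delta> x\<bar> \<le> 1" for x
    unfolding \<Delta>_def using walk_orthant_bounds[of n x] gaussian_orthant_bounds[of L I A n x] by linarith
  have bdd: "bdd_above (range (\<lambda>x. \<bar>\<Delta> x\<bar>))" using \<Delta>1 by (intro bdd_aboveI[of _ 1]) auto
  have d: "\<bar>\<Delta> x\<bar> \<le> d" for x unfolding d_def by (rule cSUP_upper[OF _ bdd]) simp
  have d0: "d \<ge> 0" using d[of undefined] by linarith
  have meas [measurable]: "(\<lambda>w. \<Delta> (\<lambda>i. y i - sqrt s * proj i w)) \<in> borel_measurable G" for y
    unfolding \<Delta>_def using finite_I by measurable
  have int: "integrable G (\<lambda>w. \<Delta> (\<lambda>i. y i - sqrt s * proj i w))" for y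
    using \<Delta>1 by (intro G.integrable_const_bound[where B=1] AE_I2) auto
  have avg: "\<bar>\<integral>w. \<Delta> (\<lambda>i. y i - sqrt s * proj i w) \<partial>G\<bar> \<le> e" for y
  proof -
    have "(\<integral>w. \<Delta> (\<lambda>i. y i - sqrt s * proj i w) \<partial>G) = smoothed n s y - V (n + s) y"
      unfolding \<Delta>_def smoothed_def V_semigroup[OF of_nat_0_le_iff s, symmetric]
      using finite_I
      by (intro Bochner_Integration.integral_diff G.integrable_const_bound[where B=1] AE_I2)
         (auto simp: abs_of_nonneg walk_orthant_bounds gaussian_orthant_bounds)
    then show ?thesis using e[of y] by simp
  qed
  have split: "(\<integral>w. c * indicator E w + c' * indicator (space G - E) w \<partial>G) = c * \<pi> + c' * (1 - \<pi>)" for c c'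
  proof -
    have "(\<integral>w. c * indicator E w + c' * indicator (space G - E) w \<partial>G)
      = c * measure G E + c' * measure G (space G - E)"
      by (subst Bochner_Integration.integral_add) (auto simp: Int_absorb2[OF sets.sets_into_space[OF E]] G.emeasure_eq_measure)
    then show ?thesis by (simp add: \<pi>_def G.prob_compl)
  qed
  have int_split: "integrable G (\<lambda>w. c * indicator E w + c' * indicator (space G - E) w)" for c c' :: real
    by (intro Bochner_Integration.integrable_add integrable_mult_right integrable_real_indicator) (auto simp: G.emeasure_eq_measure)
  have shift: "V n (\<lambda>i. x i - 2 * a) \<le> V n x + \<delta>" for x
    using D(2)[of "2 * a" x] a by (simp add: \<delta>_def)
  have key: "\<bar>\<Delta> x\<bar> * \<pi> \<le> e + \<delta> + d * (1 - \<pi>)" for x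
  proof -
    have "(\<Delta> x - \<delta>) * \<pi> + (- d) * (1 - \<pi>) \<le> (\<integral>w. \<Delta> (\<lambda>i. (x i - a) - sqrt s * proj i w) \<partial>G)"
      unfolding split[symmetric]
    proof (intro integral_mono int int_split)
      fix w assume w: "w \<in> space G"
      show "(\<Delta> x - \<delta>) * indicator E w + (- d) * indicator (space G - E) w \<le> \<Delta> (\<lambda>i. (x i - a) - sqrt s * proj i w)"
      proof (cases "w \<in> E")
        case True
        then have "\<bar>sqrt s * proj i w\<bar> \<le> a" if "i \<in> I" for i using that by (simp add: E_def)
        then have b: "x i - 2 * a \<le> (x i - a) - sqrt s * proj i w" "(x i - a) - sqrt s * proj i w \<le> x i" if "i \<in> I" for i
          using that by (force simp: abs_le_iff)+
        have "walk_orthant n x \<le> walk_orthant n (\<lambda>i. (x i - a) - sqrt s * proj i w)"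
          by (rule walk_orthant_antimono) (rule b)
        moreover have "V n (\<lambda>i. (x i - a) - sqrt s * proj i w) \<le> V n (\<lambda>i. x i - 2 * a)"
          by (rule gaussian_orthant_antimono[OF finite_I]) (rule b)
        ultimately show ?thesis using True shift[of x] by (simp add: \<Delta>_def)
      next
        case False
        then show ?thesis using w d[of "\<lambda>i. (x i - a) - sqrt s * proj i w"] by (simp add: abs_le_iff)
      qed
    qed
    then have 1: "(\<Delta> x - \<delta>) * \<pi> \<le> e + d * (1 - \<pi>)" using avg[of "\<lambda>i. x i - a"] by linarith
    have "(\<integral>w. \<Delta> (\<lambda>i. (x i + a) - sqrt s * proj i w) \<partial>G) \<le> (\<Delta> x + \<delta>) * \<pi> + d * (1 - \<pi>)"
      unfolding split[symmetric]
    proof (intro integral_mono int int_split)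
      fix w assume w: "w \<in> space G"
      show "\<Delta> (\<lambda>i. (x i + a) - sqrt s * proj i w) \<le> (\<Delta> x + \<delta>) * indicator E w + d * indicator (space G - E) w"
      proof (cases "w \<in> E")
        case True
        then have "\<bar>sqrt s * proj i w\<bar> \<le> a" if "i \<in> I" for i using that by (simp add: E_def)
        then have b: "x i \<le> (x i + a) - sqrt s * proj i w" "(x i + a) - sqrt s * proj i w \<le> x i + 2 * a" if "i \<in> I" for i
          using that by (force simp: abs_le_iff)+
        have "walk_orthant n (\<lambda>i. (x i + a) - sqrt s * proj i w) \<le> walk_orthant n x"
          by (rule walk_orthant_antimono) (rule b)
        moreover have "V n (\<lambda>i. x i + 2 * a) \<le> V n (\<lambda>i. (x i + a) - sqrt s * proj i w)"
          by (rule gaussian_orthant_antimono[OF finite_I]) (rule b)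
        ultimately show ?thesis using True shift[of "\<lambda>i. x i + 2 * a"] by (simp add: \<Delta>_def)
      next
        case False
        then show ?thesis using w d[of "\<lambda>i. (x i + a) - sqrt s * proj i w"] by (simp add: abs_le_iff)
      qed
    qed
    then have 2: "- ((\<Delta> x + \<delta>) * \<pi>) \<le> e + d * (1 - \<pi>)" using avg[of "\<lambda>i. x i + a"] by linarith
    have "\<delta> * \<pi> \<le> \<delta> * 1" using \<pi> D a by (intro mult_left_mono) (auto simp: \<delta>_def)
    then show ?thesis using 1 2 by (auto simp: abs_if algebra_simps)
  qed
  have "d \<le> (e + \<delta> + d * (1 - \<pi>)) / \<pi>"
    unfolding d_def
  proof (rule cSUP_least)
    show "\<bar>\<Delta> x\<bar> \<le> (e + \<delta> + (SUP x. \<bar>\<Delta> x\<bar>) * (1 - \<pi>)) / \<pi>" for x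
      using key[of x] \<pi> by (simp add: pos_le_divide_eq d_def)
  qed simp
  then have "d * (2 * \<pi> - 1) \<le> e + \<delta>" using \<pi> by (simp add: pos_le_divide_eq algebra_simps)
  moreover have "d * (1 / 2) \<le> d * (2 * \<pi> - 1)" using \<pi> d0 by (intro mult_left_mono) auto
  ultimately have "d \<le> 2 * e + 2 * \<delta>" by simp
  then show ?thesis using d[of x] by (simp add: \<Delta>_def \<delta>_def)
qed

text \<open>The two halves are small for different reasons. For \<open>2 * k < n\<close> the
  distance is bounded trivially by 1, but the variance is at least \<open>n / 2\<close>: at most
  \<open>n\<close> terms of order \<open>n powr (- 3 / 2)\<close>. For the others the distance is at
  most \<open>K * sqrt 2 / sqrt n\<close>, and the variance factors telescope to at most
  \<open>2 / sqrt (s - 1)\<close>. This last factor lets a large \<open>s\<close> tame the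
  dependence on \<open>K\<close>. The number 3 rounds up \<open>2 * sqrt 2\<close>.\<close>

lemma bergstroem_sum_le:
  fixes K :: real
  assumes n: "n \<ge> 1" and s: "s \<ge> 2" and K: "K \<ge> 0"
  shows "(\<Sum>k<n. (if 2 * k < n then 1 else K / sqrt (real k)) / sqrt (real (s + n - 1 - k)) ^ 3)
    \<le> (3 + 3 * K / sqrt (real s - 1)) / sqrt (real n)"
proof -
  have sqrt2: "2 * sqrt 2 \<le> (3::real)"
  proof -
    have "sqrt 2 \<le> (3 / 2 :: real)" by (rule real_le_lsqrt) (auto simp: power2_eq_square)
    then show ?thesis by simp
  qed
  define b where "b k = 2 / sqrt (real (s + n - 1 - k))" for k
  have "(if 2 * k < n then 1 else K / sqrt (real k)) / sqrt (real (s + n - 1 - k)) ^ 3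
    \<le> 2 * sqrt 2 / sqrt (real n) ^ 3 + K * sqrt 2 / sqrt (real n) * (b (Suc k) - b k)" if k: "k < n" for k
  proof -
    define t where "t = real (s + n - 1 - k)"
    have t: "t > 1" "t \<ge> real n - real k + 1" using k s by (auto simp: t_def of_nat_diff)
    have b: "b k = 2 / sqrt t" "b (Suc k) = 2 / sqrt (t - 1)"
      using k s by (simp_all add: b_def t_def of_nat_diff algebra_simps)
    have b': "1 / sqrt t ^ 3 \<le> b (Suc k) - b k"
      using inverse_sqrt_cube_le[OF t(1)] by (simp add: b)
    have b0: "0 \<le> b (Suc k) - b k" using b' t by (intro order_trans[OF _ b']) simp
    show ?thesis
    proof (cases "2 * k < n")
      case True
      then have "real n / 2 \<le> t" using t by linarith
      then have "sqrt (real n / 2) ^ 3 \<le> sqrt t ^ 3" by (intro power_mono) auto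
      then have "1 / sqrt t ^ 3 \<le> 1 / sqrt (real n / 2) ^ 3"
        using n t by (intro divide_left_mono) auto
      also have "\<dots> = 2 * sqrt 2 / sqrt (real n) ^ 3"
        by (simp add: real_sqrt_divide power_divide power3_eq_cube)
      finally have "1 / sqrt t ^ 3 \<le> 2 * sqrt 2 / sqrt (real n) ^ 3" .
      moreover have "0 \<le> K * sqrt 2 / sqrt (real n) * (b (Suc k) - b k)" using K b0 by simp
      ultimately show ?thesis using True by (simp add: t_def)
    next
      case False
      then have "real n / 2 \<le> real k" by linarith
      then have "sqrt (real n / 2) \<le> sqrt (real k)" by simp
      then have "K / sqrt (real k) \<le> K / sqrt (real n / 2)"
        using n K False by (intro divide_left_mono) auto
      also have "\<dots> = K * sqrt 2 / sqrt (real n)" by (simp add: real_sqrt_divide)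
      finally have "K / sqrt (real k) * (1 / sqrt t ^ 3) \<le> K * sqrt 2 / sqrt (real n) * (b (Suc k) - b k)"
        using b' K t by (intro mult_mono) auto
      moreover have "0 \<le> 2 * sqrt 2 / sqrt (real n) ^ 3" by simp
      moreover have "(if 2 * k < n then 1 else K / sqrt (real k)) / sqrt (real (s + n - 1 - k)) ^ 3
        = K / sqrt (real k) * (1 / sqrt t ^ 3)"
        using False by (simp add: t_def)
      ultimately show ?thesis by linarith
    qed
  qed
  then have "(\<Sum>k<n. (if 2 * k < n then 1 else K / sqrt (real k)) / sqrt (real (s + n - 1 - k)) ^ 3)
    \<le> (\<Sum>k<n. 2 * sqrt 2 / sqrt (real n) ^ 3 + K * sqrt 2 / sqrt (real n) * (b (Suc k) - b k))"
    by (intro sum_mono) auto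
  also have "\<dots> = real n * (2 * sqrt 2 / sqrt (real n) ^ 3) + K * sqrt 2 / sqrt (real n) * (b n - b 0)"
    by (simp only: sum.distrib sum_distrib_left[symmetric] sum_lessThan_telescope sum_constant card_lessThan)
  also have "real n * (2 * sqrt 2 / sqrt (real n) ^ 3) = 2 * sqrt 2 / sqrt (real n)"
  proof -
    have "sqrt (real n) ^ 3 = real n * sqrt (real n)" by (simp add: power3_eq_cube)
    then show ?thesis using n by simp
  qed
  also have "2 * sqrt 2 / sqrt (real n) + K * sqrt 2 / sqrt (real n) * (b n - b 0)
    \<le> 3 / sqrt (real n) + K * sqrt 2 / sqrt (real n) * (2 / sqrt (real s - 1))"
  proof (intro add_mono mult_left_mono)
    show "2 * sqrt 2 / sqrt (real n) \<le> 3 / sqrt (real n)" using sqrt2 by (intro divide_right_mono) auto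
    have "b n = 2 / sqrt (real s - 1)" using s by (simp add: b_def of_nat_diff)
    moreover have "b 0 \<ge> 0" by (simp add: b_def)
    ultimately show "b n - b 0 \<le> 2 / sqrt (real s - 1)" by simp
  qed (use K in auto)
  also have "\<dots> = (3 + (2 * sqrt 2) * K / sqrt (real s - 1)) / sqrt (real n)"
    by (simp add: add_divide_distrib mult_ac)
  also have "\<dots> \<le> (3 + 3 * K / sqrt (real s - 1)) / sqrt (real n)"
    using sqrt2 K s by (intro divide_right_mono add_left_mono mult_right_mono) auto
  finally show ?thesis .
qed

text \<open>Strong induction on \<open>n\<close> with all constants fixed beforehand. The order of
  choice matters: \<open>s\<close> depends on \<open>C\<close> alone, \<open>a\<close> on
  \<open>s\<close>, and \<open>K\<close> on \<open>C\<close>, \<open>D\<close> and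
  \<open>a\<close>.\<close>

lemma berry_esseen_nondegenerate:
  assumes nondeg: "\<And>i. i \<in> I \<Longrightarrow> \<exists>l\<in>L. X i l \<noteq> 0"
  shows "\<exists>K\<ge>0. \<forall>n\<ge>1. \<forall>x. \<bar>walk_orthant n x - V n x\<bar> \<le> K / sqrt (real n)"
proof -
  have pos: "(\<Sum>l\<in>L. (A i l)\<^sup>2) > 0" if i: "i \<in> I" for i
  proof -
    obtain l where l: "l \<in> L" "X i l \<noteq> 0" using nondeg[OF i] by blast
    then have "0 < (A i l)\<^sup>2" using p_pos[of l] by (simp add: A_def)
    also have "\<dots> \<le> (\<Sum>l\<in>L. (A i l)\<^sup>2)" using l finite_L by (intro member_le_sum) auto
    finally show ?thesis .
  qed
  have "\<exists>D\<ge>0. \<forall>t>0. \<forall>b\<ge>0. \<forall>x. V t (\<lambda>i. x i - b) \<le> V t x + D * b / sqrt t"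
    by (rule gaussian_orthant_shift_le[OF finite_L finite_I pos])
  then obtain D where D: "D \<ge> 0"
    and "\<forall>t>0. \<forall>b\<ge>0. \<forall>x. V t (\<lambda>i. x i - b) \<le> V t x + D * b / sqrt t"
    by auto
  then have shift: "V t (\<lambda>i. x i - b) \<le> V t x + D * b / sqrt t" if "t > 0" "b \<ge> 0" for t b x
    using that by simp
  obtain C where C: "C \<ge> 0" and err: "\<And>s n x d. s \<ge> 2 \<Longrightarrow> (\<And>k y. k < n \<Longrightarrow> \<bar>walk_orthant k y - V k y\<bar> \<le> d k) \<Longrightarrow>
    \<bar>smoothed n (real s) x - V (n + s) x\<bar> \<le> C * ((\<Sum>k<n. d k / sqrt (real (s + n - 1 - k)) ^ 3) + real n / sqrt (real (s + n - 1)) ^ 3)"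
    using smoothed_error by blast
  \<comment> \<open>Large enough for \<open>12 * C \<le> sqrt (s - 1)\<close>, so that the inductive
    contribution \<open>6 * C * K / sqrt (s - 1)\<close> is at most \<open>K / 2\<close>.\<close>
  define s where "s = 2 + nat \<lceil>144 * C\<^sup>2\<rceil>"
  have s: "s \<ge> 2" by (simp add: s_def)
  have "(12 * C)\<^sup>2 \<le> real s - 1"
    unfolding s_def by (simp add: power_mult_distrib) linarith
  then have sC: "12 * C \<le> sqrt (real s - 1)" by (rule real_le_rsqrt)
  obtain a where a: "a \<ge> 0" "3 / 4 \<le> measure G {w \<in> space G. \<forall>i\<in>I. \<bar>sqrt (real s) * proj i w\<bar> \<le> a}"
    using gaussian_concentrates_on_box[OF finite_I, of "3 / 4" L "sqrt (real s)" A] by (auto simp: proj_def)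
  \<comment> \<open>Twice the remaining contribution \<open>8 * C + 4 * D * a\<close>, which fills
    the other half of \<open>K\<close>.\<close>
  define K where "K = 16 * C + 8 * D * a"
  have K: "K \<ge> 0" using C D a by (simp add: K_def)
  have "\<forall>x. \<bar>walk_orthant n x - V n x\<bar> \<le> K / sqrt (real n)" if "n \<ge> 1" for n
    using that
  proof (induction n rule: less_induct)
    case (less n)
    \<comment> \<open>For \<open>2 * k < n\<close>, in particular for \<open>k = 0\<close>, the
      trivial bound takes the place of the induction hypothesis.\<close>
    define d where "d k = (if 2 * k < n then 1 else K / sqrt (real k))" for k
    have d: "\<bar>walk_orthant k y - V k y\<bar> \<le> d k" if "k < n" for k y
    proof (cases "2 * k < n")
      case True
      then show ?thesis
        using walk_orthant_bounds[of k y] gaussian_orthant_bounds[of L I A k y] by (simp add: d_def)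
    next
      case False
      then have "k \<ge> 1" using less.prems by linarith
      then show ?thesis using less.IH[OF that] False by (simp add: d_def)
    qed
    define e where "e = C * ((3 + 3 * K / sqrt (real s - 1)) / sqrt (real n) + 1 / sqrt (real n))"
    have e: "\<bar>smoothed n (real s) x - V (n + s) x\<bar> \<le> e" for x
    proof -
      have "real n / sqrt (real (s + n - 1)) ^ 3 \<le> real n / sqrt (real n) ^ 3"
        using less.prems s by (intro divide_left_mono power_mono mult_pos_pos zero_less_power) auto
      also have "\<dots> = 1 / sqrt (real n)"
        using less.prems by (simp add: power3_eq_cube)
      finally have 1: "real n / sqrt (real (s + n - 1)) ^ 3 \<le> 1 / sqrt (real n)" .
      have "\<bar>smoothed n (real s) x - V (n + s) x\<bar> \<le> C * ((\<Sum>k<n. d k / sqrt (real (s + n - 1 - k)) ^ 3) + real n / sqrt (real (s + n - 1)) ^ 3)"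
        by (rule err[OF s d])
      also have "\<dots> \<le> e"
        unfolding e_def d_def using C less.prems s K 1
        by (intro mult_left_mono add_mono bergstroem_sum_le) auto
      finally show ?thesis .
    qed
    show ?case
    proof
      fix x
      have sh: "V n (\<lambda>i. x i - b) \<le> V n x + D / sqrt (real n) * b" if "b \<ge> 0" for b x
        using shift[of "real n" b x] less.prems that by simp
      have "\<bar>walk_orthant n x - V n x\<bar> \<le> 2 * e + 4 * (D / sqrt (real n)) * a"
        using D by (intro smoothing_inequality[where s="real s"] sh a) (use e in simp_all)
      also have "\<dots> = (8 * C + 6 * C * (K / sqrt (real s - 1)) + 4 * D * a) / sqrt (real n)"
        by (simp add: e_def add_divide_distrib algebra_simps)
      also have "\<dots> \<le> K / sqrt (real n)"
      proof (intro divide_right_mono)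
        have "12 * C * (K / sqrt (real s - 1)) \<le> sqrt (real s - 1) * (K / sqrt (real s - 1))"
          using sC K s by (intro mult_right_mono) auto
        also have "\<dots> = K" using s by simp
        finally show "8 * C + 6 * C * (K / sqrt (real s - 1)) + 4 * D * a \<le> K"
          unfolding K_def by simp
      qed simp
      finally show "\<bar>walk_orthant n x - V n x\<bar> \<le> K / sqrt (real n)" .
    qed
  qed
  then show ?thesis using K by blast
qed

text \<open>A zero row is a coordinate that never leaves 0, so its constraint is the deterministic
  condition \<open>x i \<le> 0\<close>.\<close>

lemma walk_orthant_drop_null_rows:
  assumes J: "J \<subseteq> I" and null: "\<And>i l. i \<in> I - J \<Longrightarrow> l \<in> L \<Longrightarrow> X i l = 0"
  shows "walk_orthant n x = (if \<forall>i\<in>I - J. x i \<le> 0 then centered_walk.walk_orthant L J p X n x else 0)"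
proof -
  interpret J: centered_walk L J p X
    using J finite_subset[OF J finite_I] by unfold_locales (auto simp: finite_L p_pos p_sum centered)
  show ?thesis
  proof (induction n arbitrary: x)
    case 0
    then show ?case using J by auto
  next
    case (Suc n)
    have "walk_orthant n (\<lambda>i. x i - X i l) = (if \<forall>i\<in>I - J. x i \<le> 0 then J.walk_orthant n (\<lambda>i. x i - X i l) else 0)"
      if "l \<in> L" for l
    proof -
      have "(\<forall>i\<in>I - J. x i - X i l \<le> 0) \<longleftrightarrow> (\<forall>i\<in>I - J. x i \<le> 0)" using null that by auto
      then show ?thesis by (simp only: Suc.IH)
    qed
    then have h: "walk_orthant (Suc n) x = (\<Sum>l\<in>L. p l * (if \<forall>i\<in>I - J. x i \<le> 0 then J.walk_orthant n (\<lambda>i. x i - X i l) else 0))"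
      unfolding walk_orthant.simps by (intro sum.cong refl) (simp only:)
    show ?case
    proof (cases "\<forall>i\<in>I - J. x i \<le> 0")
      case True
      show ?thesis unfolding h if_P[OF True] J.walk_orthant.simps ..
    next
      case False
      show ?thesis unfolding h if_not_P[OF False] by simp
    qed
  qed
qed

theorem berry_esseen_upper:
  "\<exists>K\<ge>0. \<forall>n\<ge>1. \<forall>x. walk_orthant n x \<le> V n x + K / sqrt (real n)"
proof -
  define J where "J = {i \<in> I. \<exists>l\<in>L. X i l \<noteq> 0}"
  have J: "J \<subseteq> I" by (auto simp: J_def)
  interpret J: centered_walk L J p X
    using J finite_subset[OF J finite_I] by unfold_locales (auto simp: finite_L p_pos p_sum centered)
  have "\<exists>K\<ge>0. \<forall>n\<ge>1. \<forall>x. \<bar>J.walk_orthant n x - J.V n x\<bar> \<le> K / sqrt (real n)"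
    by (rule J.berry_esseen_nondegenerate) (simp add: J_def)
  then obtain K where K: "K \<ge> 0" and "\<forall>n\<ge>1. \<forall>x. \<bar>J.walk_orthant n x - J.V n x\<bar> \<le> K / sqrt (real n)"
    by auto
  then have be: "\<bar>J.walk_orthant n x - J.V n x\<bar> \<le> K / sqrt (real n)" if "n \<ge> 1" for n x
    using that by simp
  have drop: "walk_orthant n x = (if \<forall>i\<in>I - J. x i \<le> 0 then J.walk_orthant n x else 0)" for n x
    by (rule walk_orthant_drop_null_rows[OF J]) (simp add: J_def)
  have "walk_orthant n x \<le> V n x + K / sqrt (real n)" if "n \<ge> 1" for n x
  proof (cases "\<forall>i\<in>I - J. x i \<le> 0")
    case True
    have z: "x i \<le> sqrt (real n) * (\<Sum>l\<in>L. A i l * w l)" if i: "i \<in> I - J" for i w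
    proof -
      have "A i l = 0" if "l \<in> L" for l
        using i that by (simp add: J_def A_def)
      then show ?thesis using True i by simp
    qed
    have "(\<forall>i\<in>J. x i \<le> sqrt (real n) * (\<Sum>l\<in>L. A i l * w l)) \<longleftrightarrow> (\<forall>i\<in>I. x i \<le> sqrt (real n) * (\<Sum>l\<in>L. A i l * w l))" for w
      using z[of _ w] J by (metis DiffI subsetD)
    then have "J.V n x = V n x"
      unfolding gaussian_orthant_def by (simp only:)
    moreover have "walk_orthant n x = J.walk_orthant n x"
      unfolding drop using True by (rule if_P)
    ultimately show ?thesis using be[OF that, of x] by linarith
  next
    case False
    then have "walk_orthant n x = 0"
      unfolding drop by (rule if_not_P)
    moreover have "0 \<le> K / sqrt n" using K by simp
    ultimately show ?thesis using gaussian_orthant_bounds[of L I A n x] by linarith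
  qed
  then show ?thesis using K by blast
qed

end

section \<open>The observation law\<close>

text \<open>Observations are independent rows, one per sequence, whereas the walk needs i.i.d.
  columns, one per time. Each \<open>z\<close> in the support has exactly one preimage
  \<open>y\<close> in the support, of equal mass with the product taken in the other order. The
  default \<open>d\<close> of the rows turns into that of the columns.\<close>

lemma Pi_pmf_transpose:
  fixes q :: "'i \<Rightarrow> 'x pmf"
  assumes fin: "finite I" "finite T"
  shows "map_pmf (\<lambda>y t. if t \<in> T then (\<lambda>i. if i \<in> I then y i t else d) else d') (Pi_pmf I e (\<lambda>i. Pi_pmf T d (\<lambda>_. q i)))
    = Pi_pmf T d' (\<lambda>_. Pi_pmf I d q)" (is "map_pmf ?f ?P = ?Q")
proof (rule pmf_eqI)
  fix z
  define y where "y i = (if i \<in> I then (\<lambda>t. if t \<in> T then z t i else d) else e)" for i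
  have pmf_y: "pmf ?P y = (\<Prod>i\<in>I. \<Prod>t\<in>T. pmf (q i) (z t i))"
    using fin by (simp add: pmf_Pi y_def cong: prod.cong)
  have z_set: "z \<in> set_pmf ?Q \<Longrightarrow> ?f y = z"
    using fin by (auto simp: set_Pi_pmf PiE_dflt_def y_def fun_eq_iff split: if_splits)
  have inj: "w = y" if "w \<in> set_pmf ?P" "?f w = z" for w
  proof
    fix i
    show "w i = y i"
    proof (cases "i \<in> I")
      case False
      then show ?thesis using that(1) fin by (auto simp: set_Pi_pmf PiE_dflt_def y_def)
    next
      case True
      then have "w i \<in> set_pmf (Pi_pmf T d (\<lambda>_. q i))"
        using that(1) fin by (auto simp: set_Pi_pmf PiE_dflt_def)
      then have out: "w i t = d" if "t \<notin> T" for t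
        using that fin by (auto simp: set_Pi_pmf PiE_dflt_def)
      show ?thesis
      proof
        fix t
        show "w i t = y i t"
        proof (cases "t \<in> T")
          case t: True
          have "w i t = z t i" using fun_cong[OF fun_cong[OF that(2), of t], of i] True t by simp
          then show ?thesis using True t by (simp add: y_def)
        next
          case False
          then show ?thesis using True out by (simp add: y_def)
        qed
      qed
    qed
  qed
  have "pmf (map_pmf ?f ?P) z = measure ?P (?f -` {z})"
    by (rule pmf_map)
  also have "\<dots> = (if ?f y = z then pmf ?P y else 0)"
  proof (cases "?f y = z")
    case True
    have "measure ?P (?f -` {z}) = measure ?P {y}"
      using True inj by (intro measure_prob_cong_0) (auto simp: set_pmf_eq)
    then show ?thesis using True by (simp add: measure_pmf_single)
  next
    case False
    have "measure ?P (?f -` {z}) = 0"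
      using False inj by (auto simp: measure_pmf_zero_iff)
    then show ?thesis unfolding if_not_P[OF False] .
  qed
  also have "\<dots> = pmf ?Q z"
  proof (cases "?f y = z")
    case True
    have z: "z t = (if t \<in> T then (\<lambda>i. if i \<in> I then y i t else d) else d')" for t
      using fun_cong[OF True, of t] by simp
    have "pmf ?Q z = (\<Prod>t\<in>T. \<Prod>i\<in>I. pmf (q i) (z t i))"
      using fin z by (simp add: pmf_Pi)
    also have "\<dots> = pmf ?P y" unfolding pmf_y by (rule prod.swap)
    finally show ?thesis using True by simp
  next
    case False
    then have "pmf ?Q z = 0" using z_set by (auto simp: set_pmf_eq)
    then show ?thesis using False by simp
  qed
  finally show "pmf (map_pmf ?f ?P) z = pmf ?Q z" .
qed

text \<open>Conditioning on the last coordinate \<open>Suc n\<close> reproduces the recursion of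
  \<open>walk_orthant\<close>.\<close>

lemma walk_orthant_eq_prob:
  fixes c :: "'l pmf"
  assumes "centered_walk (set_pmf c) I (pmf c) X"
  shows "measure_pmf.prob (Pi_pmf {1..n} d (\<lambda>_. c)) {z. \<forall>i\<in>I. x i \<le> (\<Sum>t\<in>{1..n}. X i (z t))}
    = centered_walk.walk_orthant (set_pmf c) I (pmf c) X n x"
proof -
  interpret centered_walk "set_pmf c" I "pmf c" X by fact
  show ?thesis
  proof (induction n arbitrary: x)
    case 0
    then show ?case by simp
  next
    case (Suc n)
    define Q where "Q = Pi_pmf {1..n} d (\<lambda>_. c)"
    define E where "E x = {z. \<forall>i\<in>I. x i \<le> (\<Sum>t\<in>{1..n}. X i (z t))}" for x
    define E' where "E' = {z. \<forall>i\<in>I. x i \<le> (\<Sum>t\<in>{1..Suc n}. X i (z t))}"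
    have "Pi_pmf {1..Suc n} d (\<lambda>_. c) = bind_pmf c (\<lambda>y. map_pmf (\<lambda>f. f(Suc n := y)) Q)"
    proof -
      have "{1..Suc n} = insert (Suc n) {1..n}" by auto
      then show ?thesis
        unfolding Q_def by (simp add: Pi_pmf_insert' map_pmf_def)
    qed
    then have "measure_pmf.prob (Pi_pmf {1..Suc n} d (\<lambda>_. c)) E'
      = (\<integral>z. indicator E' z \<partial>measure_pmf (bind_pmf c (\<lambda>y. map_pmf (\<lambda>f. f(Suc n := y)) Q)))"
      by simp
    also have "\<dots> = (\<integral>y. \<integral>z. indicator E' z \<partial>measure_pmf (map_pmf (\<lambda>f. f(Suc n := y)) Q) \<partial>measure_pmf c)"
      unfolding measure_pmf_bind
      by (rule integral_bind[where K="count_space UNIV" and B'=1 and B=1])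
         (auto simp: indicator_def measure_pmf.emeasure_space_1 intro!: measurable_measure_pmf measure_pmf_in_subprob_algebra)
    also have "\<dots> = (\<integral>y. measure_pmf.prob Q (E (\<lambda>i. x i - X i y)) \<partial>measure_pmf c)"
    proof (intro Bochner_Integration.integral_cong refl)
      fix y
      have "(\<lambda>f. f(Suc n := y)) -` E' = E (\<lambda>i. x i - X i y)"
      proof -
        have "(\<Sum>t\<in>{1..Suc n}. X i ((f(Suc n := y)) t)) = (\<Sum>t\<in>{1..n}. X i (f t)) + X i y" for f i
          by simp
        then show ?thesis by (auto simp: E'_def E_def algebra_simps)
      qed
      then show "(\<integral>z. indicator E' z \<partial>measure_pmf (map_pmf (\<lambda>f. f(Suc n := y)) Q)) = measure_pmf.prob Q (E (\<lambda>i. x i - X i y))"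
        by simp
    qed
    also have "\<dots> = (\<Sum>y\<in>set_pmf c. pmf c y * walk_orthant n (\<lambda>i. x i - X i y))"
      using Suc.IH finite_L by (subst integral_measure_pmf[of "set_pmf c"]) (auto simp: Q_def E_def)
    finally show ?case by (simp add: E'_def)
  qed
qed

section \<open>Outlier sets and moments of the information densities\<close>

lemma finite_outlier_sets: "finite (outlier_sets M)"
  by (rule finite_subset[of _ "Pow {1..M}"]) (auto simp: outlier_sets_def)

lemma outlier_setD:
  assumes "B \<in> outlier_sets M"
  shows "B \<subseteq> {1..M}" "1 \<le> card B" "card B \<le> max_outliers M" "finite B"
  using assms finite_subset[of B "{1..M}"] by (auto simp: outlier_sets_def)

lemma outlier_pos_range:
  assumes "B \<in> outlier_sets M" "i \<in> B"
  shows "outlier_pos B i \<in> {1..max_outliers M}"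
proof -
  note B = outlier_setD[OF assms(1)]
  have "card {k \<in> B. k \<le> i} \<le> card B" using B by (intro card_mono) auto
  moreover have "card {k \<in> B. k \<le> i} > 0" using B assms(2) by (subst card_gt_0_iff) auto
  ultimately show ?thesis using B by (simp add: outlier_pos_def)
qed

text \<open>A larger element of \<open>B\<close> has strictly more elements of \<open>B\<close> up
  to it. Injectivity allows each outlier of an alternative hypothesis to receive its own anomalous
  law.\<close>

lemma inj_on_outlier_pos:
  assumes "finite B"
  shows "inj_on (outlier_pos B) B"
proof (rule linorder_inj_onI')
  fix i j assume ij: "i \<in> B" "j \<in> B" "i < j"
  have "j \<in> {k \<in> B. k \<le> j}" "j \<notin> {k \<in> B. k \<le> i}" "{k \<in> B. k \<le> i} \<subseteq> {k \<in> B. k \<le> j}"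
    using ij by auto
  then have "{k \<in> B. k \<le> i} \<subset> {k \<in> B. k \<le> j}" by blast
  then have "outlier_pos B i < outlier_pos B j"
    unfolding outlier_pos_def using assms by (intro psubset_card_mono) auto
  then show "outlier_pos B i \<noteq> outlier_pos B j" by simp
qed

lemma set_source:
  assumes "distribution_tuple M PN PA" "B \<in> outlier_sets M"
  shows "set_pmf (source B PN PA i) = set_pmf PN"
proof (cases "i \<in> B")
  case True
  then show ?thesis
    using assms(1) outlier_pos_range[OF assms(2) True] by (auto simp: source_def distribution_tuple_def)
qed (simp add: source_def)

text \<open>\<open>info1\<close> and \<open>info2\<close> in one formula: the log-likelihood ratio
  of the true law of sequence \<open>i\<close> against the mixture. It removes the split into
  outliers and nominal sequences from the sums.\<close>

definition llr :: "nat \<Rightarrow> nat set \<Rightarrow> nat set \<Rightarrow> 'x pmf \<Rightarrow> (nat \<Rightarrow> 'x pmf) \<Rightarrow> nat \<Rightarrow> 'x \<Rightarrow> real" where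
  "llr M B C PN PA i v = ln (pmf (source B PN PA i) v / pmf (mix M B C PN PA) v)"

lemma sum_outside:
  fixes f g :: "nat \<Rightarrow> real"
  assumes "B \<subseteq> {1..M}"
  shows "(\<Sum>i\<in>B \<inter> ({1..M} - C). f i) + (\<Sum>i\<in>({1..M} - B) \<inter> ({1..M} - C). g i)
    = (\<Sum>i\<in>{1..M} - C. if i \<in> B then f i else g i)"
proof -
  have 1: "{i \<in> {1..M} - C. i \<in> B} = B \<inter> ({1..M} - C)" and 2: "{i \<in> {1..M} - C. i \<notin> B} = ({1..M} - B) \<inter> ({1..M} - C)"
    using assms by auto
  have "(\<Sum>i\<in>{1..M} - C. if i \<in> B then f i else g i)
    = (\<Sum>i\<in>{i \<in> {1..M} - C. i \<in> B}. f i) + (\<Sum>i\<in>{i \<in> {1..M} - C. i \<notin> B}. g i)"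
    using sum.inter_filter[of "{1..M} - C" f "\<lambda>i. i \<in> B"] sum.inter_filter[of "{1..M} - C" g "\<lambda>i. i \<notin> B"]
    by (simp add: sum.If_cases Int_def)
  then show ?thesis unfolding 1 2 by simp
qed

lemma info_sum_eq:
  assumes "B \<subseteq> {1..M}"
  shows "info_sum M B C PN PA xs = (\<Sum>i\<in>{1..M} - C. llr M B C PN PA i (xs i))"
  unfolding info_sum_def sum_outside[OF assms]
  by (intro sum.cong refl) (simp add: llr_def info1_def info2_def source_def)

lemma GD_eq:
  assumes "B \<subseteq> {1..M}"
  shows "GD M B C PN PA = (\<Sum>i\<in>{1..M} - C. KL (source B PN PA i) (mix M B C PN PA))"
  unfolding GD_def sum_outside[OF assms]
  by (intro sum.cong refl) (simp add: source_def)

lemma dispersion_eq: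
  assumes "B \<subseteq> {1..M}"
  shows "dispersion M B C PN PA
    = (\<Sum>i\<in>{1..M} - C. measure_pmf.variance (source B PN PA i) (llr M B C PN PA i))"
  unfolding dispersion_def sum_outside[OF assms]
  by (intro sum.cong refl) (simp add: source_def llr_def[abs_def] info1_def[abs_def] info2_def[abs_def])

text \<open>The mixture averages the sources outside \<open>C\<close>, a nonempty set, and they all
  have the support of \<open>PN\<close>. It can therefore serve as a nominal distribution, and no
  log-ratio degenerates on the support.\<close>

lemma set_mix:
  fixes PN :: "'x::finite pmf"
  assumes tup: "distribution_tuple M PN PA" and B: "B \<in> outlier_sets M" and C: "C \<in> outlier_sets M"
  shows "set_pmf (mix M B C PN PA) = set_pmf PN"
proof -
  have pos: "real M - real (card C) > 0" using card_outlier_set_less[OF C] by simp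
  have pm: "pmf (mix M B C PN PA) x = 1 / (real M - real (card C)) * (\<Sum>i\<in>{1..M} - C. pmf (source B PN PA i) x)" for x
    unfolding pmf_mix[OF outlier_setD(1)[OF B] C] sum_outside[OF outlier_setD(1)[OF B]]
    by (intro arg_cong[where f="\<lambda>s. _ * s"] sum.cong refl) (simp add: source_def)
  have "{1..M} - C \<noteq> {}"
  proof
    assume "{1..M} - C = {}"
    then have "card {1..M} \<le> card C" using outlier_setD[OF C] by (intro card_mono) auto
    then show False using pos by simp
  qed
  then obtain i0 where i0: "i0 \<in> {1..M} - C" by blast
  have "pmf (mix M B C PN PA) x = 0 \<longleftrightarrow> pmf PN x = 0" for x
  proof -
    have src: "pmf (source B PN PA i) x = 0 \<longleftrightarrow> pmf PN x = 0" for i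
      using set_source[OF tup B, of i] by (simp add: set_pmf_eq set_eq_iff)
    have "pmf (mix M B C PN PA) x = 0 \<longleftrightarrow> (\<forall>i\<in>{1..M} - C. pmf (source B PN PA i) x = 0)"
      unfolding pm using pos by (simp add: sum_nonneg_eq_0_iff)
    then show ?thesis using src i0 by auto
  qed
  then show ?thesis by (simp add: set_pmf_eq)
qed

lemma expectation_Pi_pmf_component:
  fixes f :: "'b \<Rightarrow> real"
  assumes "finite I" "i \<in> I"
  shows "measure_pmf.expectation (Pi_pmf I d q) (\<lambda>y. f (y i)) = measure_pmf.expectation (q i) f"
proof -
  have "measure_pmf.expectation (Pi_pmf I d q) (\<lambda>y. f (y i)) = measure_pmf.expectation (map_pmf (\<lambda>y. y i) (Pi_pmf I d q)) f"
    by simp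
  then show ?thesis using assms by (simp only: Pi_pmf_component if_True)
qed

lemma expectation_Pi_pmf_two_components:
  fixes f g :: "'b \<Rightarrow> real"
  assumes I: "finite I" "i \<in> I" "j \<in> I" "i \<noteq> j" and fin: "finite (set_pmf (q i))" "finite (set_pmf (q j))"
  shows "measure_pmf.expectation (Pi_pmf I d q) (\<lambda>y. f (y i) * g (y j))
    = measure_pmf.expectation (q i) f * measure_pmf.expectation (q j) g"
proof -
  let ?P = "Pi_pmf I d q"
  have ind: "prob_space.indep_vars (measure_pmf ?P) (\<lambda>_. count_space UNIV) (\<lambda>x f. f x) I"
    by (rule indep_vars_Pi_pmf[OF I(1)])
  define h where "h k = (if k = i then f else g)" for k
  have "prob_space.indep_vars (measure_pmf ?P) (\<lambda>_. borel) (\<lambda>k y. h k (y k)) {i, j}"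
    using prob_space.indep_vars_subset[OF prob_space_measure_pmf ind, of "{i, j}"] I
    by (intro prob_space.indep_vars_compose2[OF prob_space_measure_pmf, where M'="\<lambda>_. count_space UNIV" and X="\<lambda>k y. y k" and Y=h]) auto
  moreover have int: "integrable (measure_pmf ?P) (\<lambda>y. f (y i))" "integrable (measure_pmf ?P) (\<lambda>y. g (y j))"
  proof -
    have "integrable (measure_pmf (map_pmf (\<lambda>y. y i) ?P)) f" "integrable (measure_pmf (map_pmf (\<lambda>y. y j) ?P)) g"
      using I fin by (simp_all add: Pi_pmf_component integrable_measure_pmf_finite)
    then show "integrable (measure_pmf ?P) (\<lambda>y. f (y i))" "integrable (measure_pmf ?P) (\<lambda>y. g (y j))"
      by simp_all
  qed
  then have "integrable (measure_pmf ?P) (\<lambda>y. h k (y k))" if "k \<in> {i, j}" for k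
    using that I by (auto simp: h_def)
  ultimately have "measure_pmf.expectation ?P (\<lambda>y. \<Prod>k\<in>{i, j}. h k (y k)) = (\<Prod>k\<in>{i, j}. measure_pmf.expectation ?P (\<lambda>y. h k (y k)))"
    by (intro prob_space.indep_vars_lebesgue_integral[OF prob_space_measure_pmf]) auto
  then have "measure_pmf.expectation ?P (\<lambda>y. f (y i) * g (y j))
    = measure_pmf.expectation ?P (\<lambda>y. f (y i)) * measure_pmf.expectation ?P (\<lambda>y. g (y j))"
    using I by (simp add: h_def)
  then show ?thesis using I by (simp add: expectation_Pi_pmf_component)
qed

lemma finite_set_Pi_pmf:
  fixes q :: "'i \<Rightarrow> 'x::finite pmf"
  assumes "finite I"
  shows "finite (set_pmf (Pi_pmf I d q))"
  by (rule finite_subset[OF set_Pi_pmf_subset'[OF assms]]) (auto intro!: assms)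

text \<open>Cross terms vanish because the centred components are independent.\<close>

lemma variance_sum_Pi_pmf:
  fixes q :: "'i \<Rightarrow> 'x::finite pmf" and f :: "'i \<Rightarrow> 'x \<Rightarrow> real"
  assumes I: "finite I" and J: "J \<subseteq> I"
  shows "measure_pmf.expectation (Pi_pmf I d q) (\<lambda>y. (\<Sum>i\<in>J. f i (y i) - measure_pmf.expectation (q i) (f i))\<^sup>2)
    = (\<Sum>i\<in>J. measure_pmf.variance (q i) (f i))"
proof -
  let ?P = "Pi_pmf I d q"
  define g where "g i v = f i v - measure_pmf.expectation (q i) (f i)" for i v
  have int: "integrable (measure_pmf (q i)) h" for i and h :: "'x \<Rightarrow> real"
    by (intro integrable_measure_pmf_finite) simp
  have intP: "integrable (measure_pmf ?P) h" for h :: "_ \<Rightarrow> real"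
    by (intro integrable_measure_pmf_finite finite_set_Pi_pmf I)
  have g0: "measure_pmf.expectation (q i) (g i) = 0" for i
    unfolding g_def using int by simp
  have fJ: "finite J" using finite_subset[OF J I] .
  have "measure_pmf.expectation ?P (\<lambda>y. (\<Sum>i\<in>J. g i (y i))\<^sup>2)
    = (\<Sum>i\<in>J. \<Sum>j\<in>J. measure_pmf.expectation ?P (\<lambda>y. g i (y i) * g j (y j)))"
    unfolding power2_eq_square sum_product using intP by simp
  also have "\<dots> = (\<Sum>i\<in>J. \<Sum>j\<in>J. if i = j then measure_pmf.expectation (q i) (\<lambda>v. (g i v)\<^sup>2) else 0)"
  proof (intro sum.cong refl)
    fix i j assume ij: "i \<in> J" "j \<in> J"
    show "measure_pmf.expectation ?P (\<lambda>y. g i (y i) * g j (y j)) = (if i = j then measure_pmf.expectation (q i) (\<lambda>v. (g i v)\<^sup>2) else 0)"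
    proof (cases "i = j")
      case True
      then show ?thesis
        using expectation_Pi_pmf_component[OF I, of i d q "\<lambda>v. (g i v)\<^sup>2"] ij J by (auto simp: power2_eq_square)
    next
      case False
      then show ?thesis
        using expectation_Pi_pmf_two_components[OF I, of i j q d "g i" "g j"] ij J g0 by auto
    qed
  qed
  also have "\<dots> = (\<Sum>i\<in>J. measure_pmf.expectation (q i) (\<lambda>v. (g i v)\<^sup>2))"
    using fJ by simp
  finally show ?thesis by (simp add: g_def)
qed

lemma expectation_info_sum:
  fixes PN :: "'x::finite pmf"
  assumes tup: "distribution_tuple M PN PA" and B: "B \<in> outlier_sets M" and C: "C \<in> outlier_sets M"
  shows "measure_pmf.expectation (source B PN PA i) (llr M B C PN PA i) = KL (source B PN PA i) (mix M B C PN PA)"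
    and "measure_pmf.expectation (Pi_pmf {1..M} undefined (source B PN PA)) (info_sum M B C PN PA) = GD M B C PN PA"
proof -
  show *: "measure_pmf.expectation (source B PN PA i) (llr M B C PN PA i) = KL (source B PN PA i) (mix M B C PN PA)" for i
    using set_source[OF tup B] set_mix[OF tup B C]
    by (subst KL_eq_sum) (auto simp: llr_def integral_measure_pmf[of UNIV])
  have "measure_pmf.expectation (Pi_pmf {1..M} undefined (source B PN PA)) (info_sum M B C PN PA)
    = (\<Sum>i\<in>{1..M} - C. measure_pmf.expectation (Pi_pmf {1..M} undefined (source B PN PA)) (\<lambda>xs. llr M B C PN PA i (xs i)))"
    unfolding info_sum_eq[OF outlier_setD(1)[OF B]]
    by (intro Bochner_Integration.integral_sum integrable_measure_pmf_finite finite_set_Pi_pmf) simp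
  also have "\<dots> = GD M B C PN PA"
    unfolding GD_eq[OF outlier_setD(1)[OF B]] *[symmetric]
    by (intro sum.cong refl expectation_Pi_pmf_component) auto
  finally show "measure_pmf.expectation (Pi_pmf {1..M} undefined (source B PN PA)) (info_sum M B C PN PA) = GD M B C PN PA" .
qed

text \<open>The diagonal is defined separately through \<open>dispersion\<close>; independence of
  the sequences makes it the variance of \<open>info_sum\<close>. The whole matrix is then a single
  covariance matrix and has a Gram factorisation.\<close>

lemma dispersion_matrix_eq_covariance:
  fixes PN :: "'x::finite pmf"
  assumes tup: "distribution_tuple M PN PA" and B: "B \<in> outlier_sets M"
    and C: "C i \<in> outlier_sets M" "C j \<in> outlier_sets M"
  shows "dispersion_matrix M B C PN PA i j = measure_pmf.expectation (Pi_pmf {1..M} undefined (source B PN PA))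
    (\<lambda>xs. (info_sum M B (C i) PN PA xs - GD M B (C i) PN PA) * (info_sum M B (C j) PN PA xs - GD M B (C j) PN PA))"
proof (cases "i = j")
  case False
  then show ?thesis
    by (simp only: dispersion_matrix_def False if_False covariance_def
        expectation_info_sum(2)[OF tup B C(1)] expectation_info_sum(2)[OF tup B C(2)])
next
  case True
  note sB = outlier_setD(1)[OF B]
  have "info_sum M B (C i) PN PA xs - GD M B (C i) PN PA
    = (\<Sum>k\<in>{1..M} - C i. llr M B (C i) PN PA k (xs k) - measure_pmf.expectation (source B PN PA k) (llr M B (C i) PN PA k))" for xs
    unfolding expectation_info_sum(1)[OF tup B C(1)] info_sum_eq[OF sB] GD_eq[OF sB] by (simp add: sum_subtractf)
  then show ?thesis
    using True variance_sum_Pi_pmf[of "{1..M}" "{1..M} - C i" undefined "source B PN PA" "llr M B (C i) PN PA"]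
    by (simp add: dispersion_matrix_def dispersion_eq[OF sB] power2_eq_square)
qed

section \<open>Converse by change of measure\<close>

text \<open>Restricted to \<open>observations\<close>, because a function with other values outside
  the index sets has mass 0 while the product may be positive.\<close>

lemma pmf_observation_law:
  assumes "y \<in> observations M n"
  shows "pmf (observation_law M n B PN PA) y = (\<Prod>i\<in>{1..M}. \<Prod>t\<in>{1..n}. pmf (source B PN PA i) (y i t))"
proof -
  have out: "y i = undefined" if "i \<notin> {1..M}" for i
    using that assms unfolding observations_def by (rule PiE_arb[rotated])
  have row: "y i \<in> {1..n} \<rightarrow>\<^sub>E UNIV" if "i \<in> {1..M}" for i
    using assms that unfolding observations_def by (rule PiE_mem)
  have out2: "y i t = undefined" if "i \<in> {1..M}" "t \<notin> {1..n}" for i t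
    using PiE_arb[OF row[OF that(1)] that(2)] .
  have "pmf (observation_law M n B PN PA) y
    = (\<Prod>i\<in>{1..M}. pmf (Pi_pmf {1..n} undefined (\<lambda>_. source B PN PA i)) (y i))"
    unfolding observation_law_def using out by (intro pmf_Pi') auto
  also have "\<dots> = (\<Prod>i\<in>{1..M}. \<Prod>t\<in>{1..n}. pmf (source B PN PA i) (y i t))"
    using out2 by (intro prod.cong refl pmf_Pi') auto
  finally show ?thesis .
qed

lemma finite_observations: "finite (observations M n :: (nat \<Rightarrow> nat \<Rightarrow> 'x::finite) set)"
  unfolding observations_def by (intro finite_PiE) auto

lemma prob_observation_law:
  fixes PN :: "'x::finite pmf"
  shows "measure_pmf.prob (observation_law M n B PN PA) E = (\<Sum>y\<in>observations M n \<inter> E. pmf (observation_law M n B PN PA) y)"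
proof -
  have "measure_pmf.prob (observation_law M n B PN PA) E = measure_pmf.prob (observation_law M n B PN PA) (observations M n \<inter> E)"
    using set_observation_law[of M n B PN PA] by (intro measure_prob_cong_0) (auto simp: set_pmf_eq)
  also have "\<dots> = (\<Sum>y\<in>observations M n \<inter> E. pmf (observation_law M n B PN PA) y)"
    by (intro measure_measure_pmf_finite finite_Int disjI1 finite_observations)
  finally show ?thesis .
qed

text \<open>The alternative must satisfy \<open>P\<^sub>A \<noteq> P\<^sub>N\<close>. Where the natural choice violates this, it is perturbed by a
  fraction \<open>e\<close> of another distribution with the same support.\<close>

lemma perturbed_distribution:
  fixes P Q R :: "'x pmf"
  assumes e: "0 < e" "e < 1" and supp: "set_pmf P = set_pmf Q" "set_pmf R = set_pmf Q" and R: "R \<noteq> Q"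
  shows "\<exists>P'. set_pmf P' = set_pmf Q \<and> P' \<noteq> Q \<and> (\<forall>x. (1 - e) * pmf P x \<le> pmf P' x)"
proof (cases "P = Q")
  case False
  have "(1 - e) * pmf P x \<le> 1 * pmf P x" for x using e by (intro mult_right_mono) auto
  then have "set_pmf P = set_pmf Q \<and> P \<noteq> Q \<and> (\<forall>x. (1 - e) * pmf P x \<le> pmf P x)"
    using False supp(1) by simp
  then show ?thesis by blast
next
  case True
  define P' where "P' = bind_pmf (bernoulli_pmf e) (\<lambda>b. if b then R else P)"
  have pmf_P': "pmf P' x = e * pmf R x + (1 - e) * pmf P x" for x
    unfolding P'_def pmf_bind using e by (simp add: integral_measure_pmf[of UNIV] UNIV_bool)
  have "set_pmf P' = set_pmf R \<union> set_pmf P"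
    unfolding P'_def set_bind_pmf using e by (simp add: set_pmf_bernoulli UNIV_bool Un_commute)
  then have "set_pmf P' = set_pmf Q" unfolding supp by simp
  moreover have "P' \<noteq> Q"
  proof
    assume "P' = Q"
    have "pmf R x = pmf Q x" for x
    proof -
      have "e * pmf Q x = e * pmf R x"
        using pmf_P'[of x] unfolding \<open>P' = Q\<close> True by (simp add: algebra_simps)
      then show ?thesis using e by simp
    qed
    then show False using R by (auto intro: pmf_eqI)
  qed
  moreover have "(1 - e) * pmf P x \<le> pmf P' x" for x using e by (simp add: pmf_P')
  ultimately show ?thesis by blast
qed

text \<open>Position \<open>j\<close> receives the true law of the element of \<open>C\<close> at
  that position, corrected by \<open>perturbed_distribution\<close> where it coincides with the
  mixture.\<close>

lemma alternative_tuple: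
  fixes PN :: "'x::finite pmf"
  assumes tup: "distribution_tuple M PN PA" and B: "B \<in> outlier_sets M" and C: "C \<in> outlier_sets M"
    and e: "0 < e" "e < 1"
  shows "\<exists>PA'. distribution_tuple M (mix M B C PN PA) PA' \<and>
    (\<forall>i x. (1 - e) * pmf (if i \<in> C then source B PN PA i else mix M B C PN PA) x
       \<le> pmf (source C (mix M B C PN PA) PA' i) x)"
proof -
  define Q where "Q = mix M B C PN PA"
  have setQ: "set_pmf Q = set_pmf PN" unfolding Q_def by (rule set_mix[OF tup B C])
  have T: "1 \<le> max_outliers M" using outlier_setD[OF B] by linarith
  then have PA1: "set_pmf (PA 1) = set_pmf PN" "PA 1 \<noteq> PN"
    using tup unfolding distribution_tuple_def by simp_all
  \<comment> \<open>\<open>PN\<close> and \<open>PA 1\<close> have the right support and differ from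
    each other, so at least one of them differs from \<open>Q\<close>.\<close>
  define R where "R = (if PN = Q then PA 1 else PN)"
  have R: "set_pmf R = set_pmf Q" "R \<noteq> Q"
    unfolding setQ R_def using PA1 by (simp_all only: split: if_split) auto
  \<comment> \<open>For positions beyond \<open>card C\<close> the inverse is unspecified, but
    \<open>source\<close> has the support of \<open>PN\<close> at every index, so the tuple is
    admissible there too.\<close>
  define S where "S j = source B PN PA (inv_into C (outlier_pos C) j)" for j
  have "\<forall>j. \<exists>P'. set_pmf P' = set_pmf Q \<and> P' \<noteq> Q \<and> (\<forall>x. (1 - e) * pmf (S j) x \<le> pmf P' x)"
  proof
    fix j
    have "set_pmf (S j) = set_pmf Q" unfolding S_def set_source[OF tup B] setQ ..
    then show "\<exists>P'. set_pmf P' = set_pmf Q \<and> P' \<noteq> Q \<and> (\<forall>x. (1 - e) * pmf (S j) x \<le> pmf P' x)"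
      by (rule perturbed_distribution[OF e _ R])
  qed
  from choice[OF this] obtain PA' where
    "\<forall>j. set_pmf (PA' j) = set_pmf Q \<and> PA' j \<noteq> Q \<and> (\<forall>x. (1 - e) * pmf (S j) x \<le> pmf (PA' j) x)"
    by (rule exE)
  then have PA': "set_pmf (PA' j) = set_pmf Q" "PA' j \<noteq> Q" "(1 - e) * pmf (S j) x \<le> pmf (PA' j) x" for j x
    by simp_all
  have "distribution_tuple M Q PA'" using PA' by (simp add: distribution_tuple_def)
  moreover have "(1 - e) * pmf (if i \<in> C then source B PN PA i else Q) x \<le> pmf (source C Q PA' i) x" for i x
  proof (cases "i \<in> C")
    case True
    then have "S (outlier_pos C i) = source B PN PA i"
      unfolding S_def using inv_into_f_f[OF inj_on_outlier_pos[OF outlier_setD(4)[OF C]] True] by simp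
    then show ?thesis using PA'(3)[of "outlier_pos C i" x] True by (simp add: source_def)
  next
    case False
    have "(1 - e) * pmf Q x \<le> 1 * pmf Q x" using e by (intro mult_right_mono) auto
    then show ?thesis using False by (simp add: source_def)
  qed
  ultimately show ?thesis unfolding Q_def by blast
qed

definition total_info :: "nat \<Rightarrow> nat \<Rightarrow> nat set \<Rightarrow> nat set \<Rightarrow> 'x pmf \<Rightarrow> (nat \<Rightarrow> 'x pmf) \<Rightarrow> (nat \<Rightarrow> nat \<Rightarrow> 'x) \<Rightarrow> real" where
  "total_info M n B C PN PA y = (\<Sum>t\<in>{1..n}. info_sum M B C PN PA (\<lambda>i. y i t))"

text \<open>Equality holds where the left side is positive; the case distinction keeps
  \<open>ln\<close> away from 0. For \<open>i \<in> C\<close> the two laws coincide, so the exponent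
  collects only the sequences outside \<open>C\<close>.\<close>

lemma pmf_observation_law_change_of_measure:
  fixes PN :: "'x::finite pmf"
  assumes tup: "distribution_tuple M PN PA" and B: "B \<in> outlier_sets M" and C: "C \<in> outlier_sets M"
    and y: "y \<in> observations M n"
  shows "pmf (observation_law M n B PN PA) y \<le> exp (total_info M n B C PN PA y)
    * (\<Prod>i\<in>{1..M}. \<Prod>t\<in>{1..n}. pmf (if i \<in> C then source B PN PA i else mix M B C PN PA) (y i t))"
    (is "_ \<le> _ * ?R")
proof (cases "pmf (observation_law M n B PN PA) y = 0")
  case True
  have "0 \<le> ?R" by (intro prod_nonneg) auto
  then show ?thesis using True by simp
next
  case False
  have pos: "pmf (source B PN PA i) (y i t) > 0" if "i \<in> {1..M}" "t \<in> {1..n}" for i t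
  proof -
    have "pmf (source B PN PA i) (y i t) \<noteq> 0"
      using False that unfolding pmf_observation_law[OF y] by (auto simp: prod_zero_iff)
    then show ?thesis using pmf_nonneg[of "source B PN PA i" "y i t"] by linarith
  qed
  have "pmf (source B PN PA i) (y i t)
    = (if i \<in> C then 1 else exp (llr M B C PN PA i (y i t))) * pmf (if i \<in> C then source B PN PA i else mix M B C PN PA) (y i t)"
    if it: "i \<in> {1..M}" "t \<in> {1..n}" for i t
  proof (cases "i \<in> C")
    case False
    have "y i t \<in> set_pmf (source B PN PA i)" using pos[OF it] by (auto simp: set_pmf_eq)
    then have "y i t \<in> set_pmf (mix M B C PN PA)" unfolding set_mix[OF tup B C] set_source[OF tup B] .
    then have "pmf (mix M B C PN PA) (y i t) > 0" by (rule pmf_positive)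
    then show ?thesis using False pos[OF it] by (simp add: llr_def)
  qed simp
  then have "pmf (observation_law M n B PN PA) y
    = (\<Prod>i\<in>{1..M}. \<Prod>t\<in>{1..n}. (if i \<in> C then 1 else exp (llr M B C PN PA i (y i t)))
        * pmf (if i \<in> C then source B PN PA i else mix M B C PN PA) (y i t))"
    unfolding pmf_observation_law[OF y] by (intro prod.cong refl)
  also have "\<dots> = (\<Prod>i\<in>{1..M}. \<Prod>t\<in>{1..n}. (if i \<in> C then 1 else exp (llr M B C PN PA i (y i t)))) * ?R"
    by (simp only: prod.distrib)
  also have "(\<Prod>i\<in>{1..M}. \<Prod>t\<in>{1..n}. (if i \<in> C then 1 else exp (llr M B C PN PA i (y i t))))
    = (\<Prod>i\<in>{1..M}. if i \<notin> C then exp (\<Sum>t\<in>{1..n}. llr M B C PN PA i (y i t)) else 1)"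
    by (intro prod.cong refl) (simp add: exp_sum)
  also have "\<dots> = (\<Prod>i\<in>{i \<in> {1..M}. i \<notin> C}. exp (\<Sum>t\<in>{1..n}. llr M B C PN PA i (y i t)))"
    by (rule prod.inter_filter[symmetric]) simp
  also have "{i \<in> {1..M}. i \<notin> C} = {1..M} - C" by auto
  also have "(\<Prod>i\<in>{1..M} - C. exp (\<Sum>t\<in>{1..n}. llr M B C PN PA i (y i t))) = exp (total_info M n B C PN PA y)"
  proof -
    have "(\<Prod>i\<in>{1..M} - C. exp (\<Sum>t\<in>{1..n}. llr M B C PN PA i (y i t)))
      = exp (\<Sum>i\<in>{1..M} - C. \<Sum>t\<in>{1..n}. llr M B C PN PA i (y i t))"
      by (rule exp_sum[symmetric]) simp
    also have "(\<Sum>i\<in>{1..M} - C. \<Sum>t\<in>{1..n}. llr M B C PN PA i (y i t)) = total_info M n B C PN PA y"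
      unfolding total_info_def info_sum_eq[OF outlier_setD(1)[OF B]] by (rule sum.swap)
    finally show ?thesis .
  qed
  finally show ?thesis by simp
qed

lemma correct_decision_with_small_info:
  fixes PN :: "'x::finite pmf"
  assumes tup: "distribution_tuple M PN PA" and B: "B \<in> outlier_sets M" and C: "C \<in> outlier_sets M" and CB: "C \<noteq> B"
    and error: "\<And>(PN' :: 'x pmf) PA'. distribution_tuple M PN' PA' \<Longrightarrow> misclassification_prob M n \<phi> C PN' PA' \<le> \<beta>"
  shows "measure_pmf.prob (observation_law M n B PN PA) {y. \<phi> y = Hyp B \<and> total_info M n B C PN PA y < a} \<le> 2 * exp a * \<beta>"
proof -
  define N where "N = real (n * M)"
  have N: "N \<ge> 0" unfolding N_def by (rule of_nat_0_le_iff)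
  \<comment> \<open>Over \<open>n * M\<close> symbols the perturbation costs the factor
    \<open>(1 - e) ^ (n * M)\<close>, which Bernoulli's inequality keeps at least
    \<open>1 / 2\<close> for this \<open>e\<close>; hence the 2 in the bound. The \<open>+ 1\<close>
    covers \<open>n * M = 0\<close>.\<close>
  define e where "e = 1 / (2 * (N + 1))"
  have e: "0 < e" "e < 1" "N * e \<le> 1 / 2" using N by (simp_all add: e_def field_simps)
  have half: "1 / 2 \<le> (1 - e) ^ (n * M)"
  proof -
    have "1 / 2 \<le> 1 + N * (- e)" using e by simp
    also have "\<dots> \<le> (1 + (- e)) ^ (n * M)"
      unfolding N_def by (rule Bernoulli_inequality) (use e in simp)
    finally show ?thesis by simp
  qed
  define Q where "Q = mix M B C PN PA"
  define S where "S i = (if i \<in> C then source B PN PA i else Q)" for i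
  obtain PA' where tup': "distribution_tuple M Q PA'"
    and ge: "\<And>i x. (1 - e) * pmf (S i) x \<le> pmf (source C Q PA' i) x"
    using alternative_tuple[OF tup B C e(1,2)] unfolding Q_def S_def by blast
  define E where "E = {y. \<phi> y = Hyp B \<and> total_info M n B C PN PA y < a}"
  have bound: "pmf (observation_law M n B PN PA) y \<le> 2 * exp a * pmf (observation_law M n C Q PA') y"
    if y: "y \<in> observations M n \<inter> E" for y
  proof -
    have yo: "y \<in> observations M n" and "exp (total_info M n B C PN PA y) \<le> exp a" using y by (auto simp: E_def)
    define r where "r = (\<Prod>i\<in>{1..M}. \<Prod>t\<in>{1..n}. pmf (S i) (y i t))"
    have r0: "r \<ge> 0" unfolding r_def by (intro prod_nonneg) auto
    have "pmf (observation_law M n B PN PA) y \<le> exp (total_info M n B C PN PA y) * r"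
      unfolding r_def S_def Q_def by (rule pmf_observation_law_change_of_measure[OF tup B C yo])
    also have "\<dots> \<le> exp a * r" using r0 \<open>exp _ \<le> exp a\<close> by (rule mult_right_mono[rotated])
    also have "r \<le> 2 * pmf (observation_law M n C Q PA') y"
    proof -
      have "1 / 2 * r \<le> (1 - e) ^ (n * M) * r" using half r0 by (rule mult_right_mono)
      also have "\<dots> = (\<Prod>i\<in>{1..M}. \<Prod>t\<in>{1..n}. (1 - e) * pmf (S i) (y i t))"
        unfolding r_def by (simp add: prod.distrib power_mult)
      also have "\<dots> \<le> (\<Prod>i\<in>{1..M}. \<Prod>t\<in>{1..n}. pmf (source C Q PA' i) (y i t))"
        using e ge by (intro prod_mono conjI prod_nonneg mult_nonneg_nonneg) auto
      also have "\<dots> = pmf (observation_law M n C Q PA') y"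
        by (rule pmf_observation_law[OF yo, symmetric])
      finally show ?thesis by simp
    qed
    then have "exp a * r \<le> exp a * (2 * pmf (observation_law M n C Q PA') y)" by (intro mult_left_mono) auto
    finally show ?thesis by simp
  qed
  have "measure_pmf.prob (observation_law M n B PN PA) E
    = (\<Sum>y\<in>observations M n \<inter> E. pmf (observation_law M n B PN PA) y)"
    by (rule prob_observation_law)
  also have "\<dots> \<le> (\<Sum>y\<in>observations M n \<inter> E. 2 * exp a * pmf (observation_law M n C Q PA') y)"
    by (intro sum_mono bound)
  also have "\<dots> = 2 * exp a * measure_pmf.prob (observation_law M n C Q PA') E"
    unfolding sum_distrib_left[symmetric] prob_observation_law ..
  also have "\<dots> \<le> 2 * exp a * \<beta>"
  proof (intro mult_left_mono)
    have "measure_pmf.prob (observation_law M n C Q PA') E \<le> misclassification_prob M n \<phi> C Q PA'"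
      unfolding misclassification_prob_def using CB by (intro measure_pmf.finite_measure_mono) (auto simp: E_def)
    then show "measure_pmf.prob (observation_law M n C Q PA') E \<le> \<beta>" using error[OF tup'] by linarith
  qed auto
  finally show ?thesis by (simp only: E_def)
qed

text \<open>Every observation is rejected, misclassified, decided as \<open>Hyp B\<close> with
  \<open>total_info\<close> below \<open>a\<close> for some \<open>C\<close>, or has
  \<open>total_info\<close> at least \<open>a\<close> for all \<open>C\<close>; the union bound
  gives the estimate. The last event is taken regardless of the decision, which makes it an orthant
  event.\<close>

lemma false_reject_prob_ge:
  fixes PN :: "'x::finite pmf"
  assumes tup: "distribution_tuple M PN PA" and B: "B \<in> outlier_sets M"
    and error: "\<And>B' (PN' :: 'x pmf) PA'. B' \<in> outlier_sets M \<Longrightarrow> distribution_tuple M PN' PA' \<Longrightarrow>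
      misclassification_prob M n \<phi> B' PN' PA' \<le> \<beta>"
  shows "false_reject_prob M n \<phi> B PN PA \<ge> 1 - \<beta> - 2 * real (card (outlier_sets M)) * exp a * \<beta>
    - measure_pmf.prob (observation_law M n B PN PA) {y. \<forall>C\<in>outlier_sets M - {B}. a \<le> total_info M n B C PN PA y}"
proof -
  let ?P = "measure_pmf.prob (observation_law M n B PN PA)"
  define D where "D C = {y. \<phi> y = Hyp B \<and> total_info M n B C PN PA y < a}" for C
  define F where "F = {y. \<forall>C\<in>outlier_sets M - {B}. a \<le> total_info M n B C PN PA y}"
  have fin: "finite (outlier_sets M - {B})" using finite_outlier_sets by simp
  have \<beta>: "\<beta> \<ge> 0" using error[OF B tup] measure_nonneg[of "measure_pmf (observation_law M n B PN PA)"]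
    unfolding misclassification_prob_def by (rule order_trans[rotated])
  have "1 = ?P UNIV" by simp
  also have "\<dots> \<le> ?P ({y. \<phi> y = Reject} \<union> ({y. \<phi> y \<notin> {Hyp B, Reject}} \<union> ((\<Union>C\<in>outlier_sets M - {B}. D C) \<union> F)))"
    by (intro measure_pmf.finite_measure_mono) (auto simp: D_def F_def not_less[symmetric])
  also have "\<dots> \<le> ?P {y. \<phi> y = Reject} + (?P {y. \<phi> y \<notin> {Hyp B, Reject}} + (?P (\<Union>C\<in>outlier_sets M - {B}. D C) + ?P F))"
    by (intro order_trans[OF measure_Un_le] add_mono order_refl) auto
  also have "?P (\<Union>C\<in>outlier_sets M - {B}. D C) \<le> (\<Sum>C\<in>outlier_sets M - {B}. ?P (D C))"
    using fin by (intro measure_UNION_le) auto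
  also have "\<dots> \<le> (\<Sum>C\<in>outlier_sets M - {B}. 2 * exp a * \<beta>)"
    unfolding D_def using error by (intro sum_mono correct_decision_with_small_info[OF tup B]) auto
  also have "\<dots> \<le> 2 * real (card (outlier_sets M)) * exp a * \<beta>"
  proof -
    have "card (outlier_sets M - {B}) \<le> card (outlier_sets M)" by (intro card_mono finite_outlier_sets) auto
    then have "real (card (outlier_sets M - {B})) * (2 * exp a * \<beta>) \<le> real (card (outlier_sets M)) * (2 * exp a * \<beta>)"
      using \<beta> by (intro mult_right_mono) auto
    then show ?thesis by (simp add: mult_ac)
  qed
  also have "?P {y. \<phi> y \<notin> {Hyp B, Reject}} \<le> \<beta>"
    using error[OF B tup] by (simp add: misclassification_prob_def)
  finally show ?thesis by (simp add: false_reject_prob_def F_def)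
qed

section \<open>Identification of the Gaussian term and conclusion\<close>

text \<open>\<open>gaussian_law\<close> is chosen by \<open>SOME\<close>. The given factor,
  reindexed by \<open>{1..card L}\<close>, shows that a Gaussian law exists; the chosen one comes
  with an unknown factor \<open>A'\<close> of the same Gram matrix, and
  \<open>gaussian_orthant_prob_eq_of_gram_eq\<close> equates the orthant probabilities.\<close>

lemma gaussian_Q_eq_orthant_prob:
  fixes A :: "nat \<Rightarrow> 'l \<Rightarrow> real"
  assumes L: "finite L" and gram: "\<And>i j. i \<in> {1..k} \<Longrightarrow> j \<in> {1..k} \<Longrightarrow> \<Sigma> i j = (\<Sum>l\<in>L. A i l * A j l)"
  shows "gaussian_Q k x (\<lambda>_. 0) \<Sigma>
    = measure (std_gaussian L) {w \<in> space (std_gaussian L). \<forall>i\<in>{1..k}. x i \<le> (\<Sum>l\<in>L. A i l * w l)}"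
proof -
  obtain h where h: "bij_betw h {1..card L} L"
    using ex_bij_betw_nat_finite_1[OF L] by blast
  have "\<Sigma> i j = (\<Sum>l\<in>{1..card L}. A i (h l) * A j (h l))" if "i \<in> {1..k}" "j \<in> {1..k}" for i j
    unfolding gram[OF that] by (rule sum.reindex_bij_betw[OF h, symmetric])
  then have "\<exists>N. is_gaussian_law k (\<lambda>_. 0) \<Sigma> N"
    unfolding is_gaussian_law_def by (intro exI[of _ "card L"] exI conjI ballI[of _ "\<lambda>i. \<forall>j\<in>{1..k}. _ i j"]) (auto intro!: refl)
  then have "is_gaussian_law k (\<lambda>_. 0) \<Sigma> (gaussian_law k (\<lambda>_. 0) \<Sigma>)"
    unfolding gaussian_law_def by (rule someI_ex)
  then obtain m A' where gram': "\<forall>i\<in>{1..k}. \<forall>j\<in>{1..k}. \<Sigma> i j = (\<Sum>l\<in>{1..m::nat}. A' i l * A' j l)"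
    and law: "gaussian_law k (\<lambda>_. 0) \<Sigma> = distr (std_gaussian {1..m}) (Pi\<^sub>M {1..k} (\<lambda>_. borel))
      (\<lambda>w. \<lambda>i\<in>{1..k}. 0 + (\<Sum>l\<in>{1..m}. A' i l * w l))"
    unfolding is_gaussian_law_def by (elim exE conjE)
  define F where "F w = (\<lambda>i\<in>{1..k}. 0 + (\<Sum>l\<in>{1..m}. A' i l * w l))" for w :: "nat \<Rightarrow> real"
  have F: "F \<in> measurable (std_gaussian {1..m}) (Pi\<^sub>M {1..k} (\<lambda>_. borel))"
    unfolding F_def by (intro measurable_restrict) measurable
  define E where "E = {z \<in> space (Pi\<^sub>M {1..k} (\<lambda>_. borel :: real measure)). \<forall>i\<in>{1..k}. x i \<le> z i}"
  have E: "E \<in> sets (Pi\<^sub>M {1..k} (\<lambda>_. borel))"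
    unfolding E_def by measurable
  have "gaussian_Q k x (\<lambda>_. 0) \<Sigma> = measure (distr (std_gaussian {1..m}) (Pi\<^sub>M {1..k} (\<lambda>_. borel)) F) E"
    unfolding gaussian_Q_def Let_def law F_def[symmetric] space_distr E_def ..
  also have "\<dots> = measure (std_gaussian {1..m}) (F -` E \<inter> space (std_gaussian {1..m}))"
    by (rule measure_distr[OF F E])
  also have "F -` E \<inter> space (std_gaussian {1..m})
    = {w \<in> space (std_gaussian {1..m}). \<forall>i\<in>{1..k}. x i \<le> (\<Sum>l\<in>{1..m}. A' i l * w l)}"
    using measurable_space[OF F] by (auto simp: E_def F_def)
  also have "measure (std_gaussian {1..m}) \<dots>
    = measure (std_gaussian L) {w \<in> space (std_gaussian L). \<forall>i\<in>{1..k}. x i \<le> (\<Sum>l\<in>L. A i l * w l)}"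
    using gram gram' L by (intro gaussian_orthant_prob_eq_of_gram_eq) auto
  finally show ?thesis .
qed

text \<open>After transposition the vector of all \<open>total_info\<close> values is, up to the
  centring \<open>n * h i\<close>, the position of a walk whose steps are the columns of the
  observation.\<close>

lemma prob_total_info_orthant:
  fixes M n :: nat and B :: "nat set" and C :: "nat \<Rightarrow> nat set"
    and PN :: "'x::finite pmf" and PA :: "nat \<Rightarrow> 'x pmf" and h :: "nat \<Rightarrow> real"
  defines "c \<equiv> Pi_pmf {1..M} undefined (source B PN PA)"
  defines "X \<equiv> \<lambda>i xs. info_sum M B (C i) PN PA xs - h i"
  assumes B: "B \<in> outlier_sets M" and walk: "centered_walk (set_pmf c) I (pmf c) X"
  shows "measure_pmf.prob (observation_law M n B PN PA) {y. \<forall>i\<in>I. a \<le> total_info M n B (C i) PN PA y}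
    = centered_walk.walk_orthant (set_pmf c) I (pmf c) X n (\<lambda>i. a - real n * h i)"
proof -
  define T where "T = (\<lambda>(y :: nat \<Rightarrow> nat \<Rightarrow> 'x) t. if t \<in> {1..n} then (\<lambda>i. if i \<in> {1..M} then y i t else undefined) else undefined)"
  define E where "E = {z. \<forall>i\<in>I. a - real n * h i \<le> (\<Sum>t\<in>{1..n}. X i (z t))}"
  have tr: "map_pmf T (observation_law M n B PN PA) = Pi_pmf {1..n} undefined (\<lambda>_. c)"
    unfolding T_def observation_law_def c_def by (rule Pi_pmf_transpose) simp_all
  have "total_info M n B (C i) PN PA y = (\<Sum>t\<in>{1..n}. X i (T y t)) + real n * h i" for i y
  proof -
    have "info_sum M B (C i) PN PA (\<lambda>j. y j t) = X i (T y t) + h i" if "t \<in> {1..n}" for t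
    proof -
      \<comment> \<open>\<open>info_sum\<close> reads only coordinates in \<open>{1..M}\<close>, so
        the default values filled in by \<open>T\<close> do not change it.\<close>
      have "info_sum M B (C i) PN PA (\<lambda>j. y j t) = info_sum M B (C i) PN PA (T y t)"
        unfolding info_sum_eq[OF outlier_setD(1)[OF B]] T_def using that by (intro sum.cong refl) simp
      then show ?thesis by (simp add: X_def)
    qed
    then have "total_info M n B (C i) PN PA y = (\<Sum>t\<in>{1..n}. X i (T y t) + h i)"
      unfolding total_info_def by (intro sum.cong refl)
    then show ?thesis by (simp add: sum.distrib)
  qed
  then have "{y. \<forall>i\<in>I. a \<le> total_info M n B (C i) PN PA y} = T -` E"
    unfolding E_def by (simp add: vimage_def diff_le_eq)
  then have "measure_pmf.prob (observation_law M n B PN PA) {y. \<forall>i\<in>I. a \<le> total_info M n B (C i) PN PA y}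
    = measure_pmf.prob (map_pmf T (observation_law M n B PN PA)) E"
    by simp
  then show ?thesis
    unfolding tr E_def walk_orthant_eq_prob[OF walk] .
qed

lemma exp_minus_le_inverse_sqrt:
  fixes lam :: real
  assumes "lam > 0" "n \<ge> 1"
  shows "exp (- real n * lam) \<le> 1 / lam * (1 / sqrt (real n))"
proof -
  have "sqrt (real n) \<le> real n"
    using assms by (intro real_le_lsqrt) (auto simp: power2_eq_square)
  then have "lam * sqrt (real n) \<le> real n * lam" using assms by simp
  also have "\<dots> \<le> exp (real n * lam)" using exp_ge_add_one_self[of "real n * lam"] by linarith
  finally have "inverse (exp (real n * lam)) \<le> inverse (lam * sqrt (real n))"
    using assms by (intro le_imp_inverse_le) auto
  then show ?thesis by (simp add: exp_minus[symmetric] divide_inverse inverse_mult_distrib)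
qed

theorem theorem2:
  fixes M :: nat and lam :: real
    and PN :: "'x::finite pmf" and PA :: "nat \<Rightarrow> 'x pmf"
    and B :: "nat set" and C :: "nat \<Rightarrow> nat set"
  assumes "lam > 0"
    and "distribution_tuple M PN PA"
    and "B \<in> outlier_sets M"
    and "bij_betw C {1..card (outlier_sets M) - 1} (outlier_sets M - {B})"
  shows "\<exists>f g :: nat \<Rightarrow> real.
    f \<in> O(\<lambda>n. 1 / sqrt (real n)) \<and> g \<in> O(\<lambda>n. ln (real n) / real n) \<and>
    (\<forall>n\<ge>1. \<forall>\<phi> :: (nat \<Rightarrow> nat \<Rightarrow> 'x) \<Rightarrow> decision.
       is_test M n \<phi> \<longrightarrow>
       (\<forall>B'\<in>outlier_sets M. \<forall>(PN' :: 'x pmf) PA'. distribution_tuple M PN' PA' \<longrightarrow>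
          misclassification_prob M n \<phi> B' PN' PA' \<le> exp (- real n * lam)) \<longrightarrow>
       false_reject_prob M n \<phi> B PN PA \<ge> 1 + f n
         - gaussian_Q (card (outlier_sets M) - 1)
             (\<lambda>i. sqrt (real n) * (lam - GD M B (C i) PN PA + g n))
             (\<lambda>_. 0)
             (dispersion_matrix M B C PN PA))"
proof -
  note tup = assms(2) and B = assms(3)
  define k where "k = card (outlier_sets M) - 1"
  define s where "s = real (card (outlier_sets M))"
  define c where "c = Pi_pmf {1..M} undefined (source B PN PA)"
  define X where "X i xs = info_sum M B (C i) PN PA xs - GD M B (C i) PN PA" for i xs
  have C_image: "C ` {1..k} = outlier_sets M - {B}"
    using assms(4) by (simp add: k_def bij_betw_def)
  then have C: "C i \<in> outlier_sets M" if "i \<in> {1..k}" for i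
    using that by blast
  have fin: "finite (set_pmf c)" unfolding c_def by (intro finite_set_Pi_pmf) simp
  have expect: "measure_pmf.expectation c f = (\<Sum>xs\<in>set_pmf c. pmf c xs * f xs)" for f :: "_ \<Rightarrow> real"
    using integral_measure_pmf[OF fin, of c f] by simp
  have walk: "centered_walk (set_pmf c) {1..k} (pmf c) X"
  proof
    show "(\<Sum>xs\<in>set_pmf c. pmf c xs) = 1" using fin by (rule sum_pmf_eq_1) simp
    fix i assume i: "i \<in> {1..k}"
    have "measure_pmf.expectation c (X i) = 0"
      unfolding X_def c_def expectation_info_sum(2)[OF tup B C[OF i], symmetric]
      by (subst Bochner_Integration.integral_diff) (auto intro!: integrable_measure_pmf_finite finite_set_Pi_pmf)
    then show "(\<Sum>xs\<in>set_pmf c. pmf c xs * X i xs) = 0" unfolding expect .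
  qed (use fin in \<open>auto intro: pmf_positive\<close>)
  interpret W: centered_walk "set_pmf c" "{1..k}" "pmf c" X by (rule walk)
  have gram: "dispersion_matrix M B C PN PA i j = (\<Sum>l\<in>set_pmf c. W.A i l * W.A j l)"
    if "i \<in> {1..k}" "j \<in> {1..k}" for i j
  proof -
    have "dispersion_matrix M B C PN PA i j = measure_pmf.expectation c (\<lambda>xs. X i xs * X j xs)"
      unfolding c_def X_def by (rule dispersion_matrix_eq_covariance[OF tup B C[OF that(1)] C[OF that(2)]])
    also have "\<dots> = (\<Sum>l\<in>set_pmf c. W.A i l * W.A j l)"
      unfolding expect
    proof (intro sum.cong refl)
      fix l
      have "W.A i l * W.A j l = (sqrt (pmf c l) * sqrt (pmf c l)) * (X i l * X j l)"
        unfolding W.A_def by (simp only: mult_ac)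
      then show "pmf c l * (X i l * X j l) = W.A i l * W.A j l" by simp
    qed
    finally show ?thesis .
  qed
  obtain K where K: "K \<ge> 0" and "\<forall>n\<ge>1. \<forall>x. W.walk_orthant n x \<le> W.V (real n) x + K / sqrt (real n)"
    using W.berry_esseen_upper by (elim exE conjE)
  then have be: "W.walk_orthant n x \<le> W.V (real n) x + K / sqrt (real n)" if "n \<ge> 1" for n x
    using that by blast
  \<comment> \<open>Three losses, none depending on the test: misclassification under the true
    hypothesis, the change of measure at \<open>2 / n\<close> for each of at most \<open>s\<close>
    competitors, and the Berry-Esseen error.\<close>
  define f where "f n = - (exp (- real n * lam) + 2 * s / real n + K / sqrt (real n))" for n
  \<comment> \<open>Chosen so that \<open>n * (lam + g n)\<close> is the lowered threshold
    \<open>a\<close>; the same \<open>g\<close> serves all coordinates.\<close>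
  define g where "g n = - ln (real n) / real n" for n :: nat
  have s0: "s \<ge> 0" by (simp add: s_def)
  have "norm (f n) \<le> (1 / lam + 2 * s + K) * norm (1 / sqrt (real n))" if n: "n \<ge> 1" for n
  proof -
    have "sqrt (real n) \<le> real n"
      using n by (intro real_le_lsqrt) (auto simp: power2_eq_square)
    then have "2 * s / real n \<le> 2 * s / sqrt (real n)"
      using n s0 by (intro divide_left_mono) auto
    moreover have "0 \<le> 2 * s / real n" "0 \<le> K / sqrt (real n)" "0 \<le> exp (- real n * lam)"
      using s0 K by auto
    ultimately have "\<bar>f n\<bar> \<le> 1 / lam * (1 / sqrt (real n)) + 2 * s / sqrt (real n) + K / sqrt (real n)"
      unfolding f_def using exp_minus_le_inverse_sqrt[OF assms(1) n] by linarith
    then show ?thesis using n by (simp add: algebra_simps)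
  qed
  then have "f \<in> O(\<lambda>n. 1 / sqrt (real n))"
    by (intro bigoI[of _ "1 / lam + 2 * s + K"] eventually_sequentiallyI[of 1])
  moreover have "g \<in> O(\<lambda>n. ln (real n) / real n)"
    by (intro bigoI[of _ 1] always_eventually) (simp add: g_def)
  moreover have "false_reject_prob M n \<phi> B PN PA \<ge> 1 + f n
      - gaussian_Q k (\<lambda>i. sqrt (real n) * (lam - GD M B (C i) PN PA + g n)) (\<lambda>_. 0) (dispersion_matrix M B C PN PA)"
    if n: "n \<ge> 1"
      and error: "\<forall>B'\<in>outlier_sets M. \<forall>(PN' :: 'x pmf) PA'. distribution_tuple M PN' PA' \<longrightarrow>
        misclassification_prob M n \<phi> B' PN' PA' \<le> exp (- real n * lam)" for n \<phi>
  proof -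
    define a where "a = real n * lam - ln (real n)"
    define \<beta> where "\<beta> = exp (- real n * lam)"
    let ?P = "measure_pmf.prob (observation_law M n B PN PA)"
    have a\<beta>: "exp a * \<beta> = 1 / real n"
      using n by (simp add: a_def \<beta>_def exp_add[symmetric] exp_diff exp_minus)
    have "false_reject_prob M n \<phi> B PN PA \<ge> 1 - \<beta> - 2 * s * exp a * \<beta>
        - ?P {y. \<forall>D\<in>outlier_sets M - {B}. a \<le> total_info M n B D PN PA y}"
      unfolding s_def using error by (intro false_reject_prob_ge[OF tup B]) (simp add: \<beta>_def)
    also have "{y. \<forall>D\<in>outlier_sets M - {B}. a \<le> total_info M n B D PN PA y} = {y. \<forall>i\<in>{1..k}. a \<le> total_info M n B (C i) PN PA y}"
      unfolding C_image[symmetric] by simp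
    also have "?P \<dots> = W.walk_orthant n (\<lambda>i. a - real n * GD M B (C i) PN PA)"
      using prob_total_info_orthant[OF B, of PN PA "{1..k}" C "\<lambda>i. GD M B (C i) PN PA" n a] walk
      unfolding c_def X_def[abs_def] by simp
    finally have 1: "1 - \<beta> - 2 * s * exp a * \<beta> - W.walk_orthant n (\<lambda>i. a - real n * GD M B (C i) PN PA) \<le> false_reject_prob M n \<phi> B PN PA" .
    have 2: "W.V (real n) (\<lambda>i. a - real n * GD M B (C i) PN PA)
      = gaussian_Q k (\<lambda>i. sqrt (real n) * (lam - GD M B (C i) PN PA + g n)) (\<lambda>_. 0) (dispersion_matrix M B C PN PA)"
    proof -
      \<comment> \<open>In \<open>W.V (real n)\<close> the Gaussian vector is scaled by
        \<open>sqrt n\<close>; cancelling this factor leaves the argument of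
        \<open>gaussian_Q\<close>, with one remaining \<open>sqrt n\<close>.\<close>
      have "a - real n * GD M B (C i) PN PA = sqrt (real n) * (sqrt (real n) * (lam - GD M B (C i) PN PA + g n))" for i
      proof -
        have "sqrt (real n) * (sqrt (real n) * (lam - GD M B (C i) PN PA + g n)) = real n * (lam - GD M B (C i) PN PA + g n)"
          by (simp add: mult.assoc[symmetric])
        then show ?thesis using n by (simp add: a_def g_def algebra_simps)
      qed
      then have "a - real n * GD M B (C i) PN PA \<le> sqrt (real n) * z \<longleftrightarrow> sqrt (real n) * (lam - GD M B (C i) PN PA + g n) \<le> z" for i z
        using n by simp
      moreover have "gaussian_Q k x (\<lambda>_. 0) (dispersion_matrix M B C PN PA)
        = measure W.G {w \<in> space W.G. \<forall>i\<in>{1..k}. x i \<le> (\<Sum>l\<in>set_pmf c. W.A i l * w l)}" for x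
        by (rule gaussian_Q_eq_orthant_prob[OF fin]) (rule gram)
      ultimately show ?thesis
        unfolding gaussian_orthant_def by simp
    qed
    have 3: "2 * s * exp a * \<beta> = 2 * s / real n" using a\<beta> by (simp add: mult.assoc)
    have f: "f n = - (\<beta> + 2 * s / real n + K / sqrt (real n))" by (simp add: f_def \<beta>_def)
    show ?thesis
      using 1 be[OF n, of "\<lambda>i. a - real n * GD M B (C i) PN PA"] unfolding 2 3 f by linarith
  qed
  ultimately show ?thesis
    unfolding k_def by (intro exI[of _ f] exI[of _ g]) blast
qed

end
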